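(* Let $s\ge 1$ and $k\ge 1$ be integers and consider the fully discrete scheme RKSV$(s,k)$ (with either the LSV or the RRSV choice of subdividing points) on a regular family of meshes. Let $\zeta$ be the termination index, $\rho$ the contribution index and $a^{(\zeta)}_{\zeta\zeta}$ the corresponding diagonal entry produced by the matrix transferring process described in the context. Then: (1) if $a^{(\zeta)}_{\zeta\zeta}<0$ and $\rho=\zeta$, then the scheme has monotonicity stability; (2) if $a^{(\zeta)}_{\zeta\zeta}<0$ and $\rho<\zeta$, then the scheme has weak$(2\rho+1)$ stability; (3) if $a^{(\zeta)}_{\zeta\zeta}>0$, then the scheme has weak$(\gamma)$ stability with $\gamma=\min(2\zeta,\,2\rho+1)$.
   Context: **Problem.** $\partial_t u+\partial_x u=0$ on $[a,b]\times(0,T]$, $u(x,0)=u_0(x)$, with either the homogeneous boundary condition $u(a,t)=0$ or the periodic condition $u(a,t)=u(b,t)$. **Mesh.** $a=x_{1/2}<x_{3/2}<\dots<x_{N+1/2}=b$, $I_i=[x_{i-1/2},x_{i+1/2}]$, $h_i=x_{i+1/2}-x_{i-1/2}$, $x_i=\frac12(x_{i-1/2}+x_{i+1/2})$, $h=\max_i h_i$. The mesh is regular: there is a fixed $\alpha_*>0$ with $\alpha_* \max_i h_i\le \min_i h_i$. Given reference points $-1=y_0<y_1<\dots<y_k<y_{k+1}=1$, put $x_{i,j}=\frac12 h_i y_j+x_i$ and control volumes $C_{i,j}=[x_{i,j},x_{i,j+1}]$, $0\le j\le k$. - LSV: $y_1,\dots,y_k$ are the $k$ Gauss-Legendre points;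 $A_1,\dots,A_k$ are the Gauss weights and $A_0=A_{k+1}=0$. - RRSV: $y_1,\dots,y_{k+1}=1$ are the $k+1$ right Radau points (zeros of $P_{k+1}-P_k$, where $P_m$ is the Legendre polynomial of degree $m$); $A_1,\dots,A_{k+1}$ are the right Radau weights and $A_0=0$. Thus $\sum_{j=0}^{k+1}A_jf(y_j)$ is the interpolatory quadrature for $\int_{-1}^1 f\,dy$. Set $A_{i,j}=\frac{h_i}{2}A_j$. **Spaces, map, forms.** $\mathcal U_h=\{w\in L_2(a,b): w|_{I_i}\in \mathbf P^k(I_i),\ 1\le i\le N\}$ (polynomials of degree at most $k$ on each $I_i$); $\mathcal V_h$ is the space of functions constant on each $C_{i,j}$. For $w\in\mathcal U_h$, $w^*\in\mathcal V_h$ has value $w^*_{i,j}$ on $C_{i,j}$, where $w^*_{i,0}=w^+_{i-1/2}+A_{i,0}w_x(x_{i,0})$ and $w^*_{i,j}-w^*_{i,j-1}=A_{i,j}w_x(x_{i,j})$ for $1\le j\le k$. Here $\pm$ denotes right/left limits. $(\cdot,\cdot)$ is the $L_2(a,b)$ inner product; $(v,w^* )$ is symmetric in $v,w\in\mathcal U_h$, and $|||w|||^2:=(w,w^* )$ defines a norm on $\mathcal U_h$ equivalent to the $L_2$ norm. Define $$a_h(v,w^* )=-\sum_{i=1}^N\sum_{j=0}^k w^*_{i,j}\,(v^-_{i,j+1}-v^-_{i,j}),\qquad v^-_{i,j}=v^-(x_{i,j}),$$ where $v^-_{i,0}$ for $i\ge2$ is the left limit from $I_{i-1}$, and $v^-_{1,0}$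 is $0$ (homogeneous case) or $v^-(b)$ (periodic case). **Scheme RKSV$(s,k)$.** $\tau=T/M$, $t_n=n\tau$. Let $g_{00}=1$ and for $s\ge2$ let $g_{s-1,\ell}=\frac1\ell g_{s-2,\ell-1}$ ($1\le\ell\le s-2$), $g_{s-1,s-1}=\frac1{s!}$, $g_{s-1,0}=1-\sum_{\ell=1}^{s-1}g_{s-1,\ell}$. Starting from $u_h^{n,0}=u_h^n\in\mathcal U_h$, the stages $u_h^{n,\ell}\in\mathcal U_h$ satisfy, for all $w\in\mathcal U_h$, $$(u_h^{n,\ell+1},w^* )=(u_h^{n,\ell},w^* )+\tau a_h(u_h^{n,\ell},w^* ),\quad 0\le\ell\le s-2,$$ $$(u_h^{n,s},w^* )=\sum_{\kappa=0}^{s-1}g_{s-1,\kappa}(u_h^{n,\kappa},w^* )+\tau g_{s-1,s-1}a_h(u_h^{n,s-1},w^* ),$$ and $u_h^{n+1}=u_h^{n,s}$. The CFL number is $\lambda=\tau/h$. **Temporal differences.** $\mathbb D_0u_h^n=u_h^n$ and, for $1\le\kappa\le s$, $\mathbb D_\kappa u_h^n=\sum_{0\le \ell\le\kappa}\sigma_{\kappa \ell}u_h^{n,\ell}$ with $\sum_\ell\sigma_{\kappa \ell}=0$, where the constants $\sigma_{\kappa\ell}$ are determined recursively from the scheme by $(\mathbb D_\kappa u_h^n,w^* )=\tau a_h(\mathbb D_{\kappa-1}u_h^n,w^* )$ for all $w\in\mathcal U_h$. The coefficients $\alpha_0,\dots,\alpha_s$ ($\alpha_0>0$, used only for scaling)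 are those of the evolution identity $\alpha_0u_h^{n+1}=\sum_{p=0}^s\alpha_p\mathbb D_pu_h^n$ (an identity between linear combinations of the stages). **Matrix transferring process.** All matrices are symmetric with indices $0,\dots,s$; entries with an index exceeding $s$ are read as $0$. Start with $\mathbb A^{(0)}=\{a^{(0)}_{pq}\}$, $a^{(0)}_{00}=0$, $a^{(0)}_{pq}=\alpha_p\alpha_q$ if $p+q>0$, and $\mathbb B^{(0)}=0$. For $l=1,2,\dots$ define, for $q\le p$, $$a^{(l)}_{pq}=a^{(l)}_{qp}=\begin{cases}0,&0\le q\le l-1,\\ a^{(l-1)}_{pq}-2a^{(l-1)}_{p+1,q-1},&p=q=l,\\ a^{(l-1)}_{pq}-a^{(l-1)}_{p+1,q-1},&l+1\le p\le s-1,\ q=l,\\ a^{(l-1)}_{pq},&\text{otherwise},\end{cases}$$ $$b^{(l)}_{pq}=b^{(l)}_{qp}=\begin{cases}2a^{(l-1)}_{p+1,q},&l-1\le p\le s-1,\ q=l-1,\\ b^{(l-1)}_{pq},&\text{otherwise}.\end{cases}$$ Stop at the first $l\ge1$ with $a^{(l)}_{ll}\ne0$; this $l$ is the termination index $\zeta$. For $0\le\kappa\le\zeta-1$ let $\mathbb B^{\zeta}_\kappa$ be the leading principal submatrix of $\mathbb B^{(\zeta)}$ of order $\kappa+1$. The contribution index is $\rho=\min\{\kappa:0\le\kappa\le\zeta-1,\ \det\mathbb B^\zeta_\kappa\le0\}$ if this set is nonempty, and $\rho=\zeta$ otherwise. **Stability notions** (in both, the CFL number $\lambda$ is assumed small enough,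 i.e. $\lambda\le\lambda_0$ for some $\lambda_0>0$ independent of $\tau,h,n$). Monotonicity stability: $|||u_h^{n+1}|||^2\le|||u_h^n|||^2$ for all $n\ge0$. Weak$(\gamma)$ stability: $|||u_h^{n+1}|||^2\le(1+C\lambda^\gamma)|||u_h^n|||^2$ for all $n\ge0$, with $C>0$ independent of $\tau,h,n$. *)

theory Defs
  imports
    "HOL-Analysis.Analysis"
    "HOL-Computational_Algebra.Polynomial"
    "Jordan_Normal_Form.Determinant"
begin

section \<open>Reference points and weights\<close>

text \<open>Rodrigues' formula.\<close>

definition legendre_poly :: "nat \<Rightarrow> real poly" where
  "legendre_poly m = Polynomial.smult (1 / (2 ^ m * fact m)) ((pderiv ^^ m) ([:-1, 0, 1:] ^ m))"

datatype sv_method = LSV | RRSV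

datatype boundary_condition = Homogeneous | Periodic

primrec quadrature_indices :: "sv_method \<Rightarrow> nat \<Rightarrow> nat set" where
  "quadrature_indices LSV k = {1..k}"
| "quadrature_indices RRSV k = {1..k + 1}"

primrec quadrature_poly :: "sv_method \<Rightarrow> nat \<Rightarrow> real poly" where
  "quadrature_poly LSV k = legendre_poly k"
| "quadrature_poly RRSV k = legendre_poly (k + 1) - legendre_poly k"

definition reference_points :: "sv_method \<Rightarrow> nat \<Rightarrow> (nat \<Rightarrow> real) \<Rightarrow> bool" where
  "reference_points meth k y \<longleftrightarrow>
     y 0 = -1 \<and> y (k + 1) = 1 \<and> (\<forall>j\<le>k. y j < y (j + 1)) \<and>
     y ` quadrature_indices meth k = {t. poly (quadrature_poly meth k) t = 0}"

text \<open>The weights of the interpolatory quadrature on \<open>[-1, 1]\<close> at the Gauss, respectively right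
  Radau, points: integrals of the Lagrange basis polynomials. Indices of reference points which
  are not quadrature points get weight 0.\<close>

definition reference_weight :: "sv_method \<Rightarrow> nat \<Rightarrow> (nat \<Rightarrow> real) \<Rightarrow> nat \<Rightarrow> real" where
  "reference_weight meth k y j =
     (if j \<in> quadrature_indices meth k
      then integral {-1..1}
             (\<lambda>t. \<Prod>m\<in>quadrature_indices meth k - {j}. (t - y m) / (y j - y m))
      else 0)"


section \<open>Spectral volume discretization in space\<close>

text \<open>\<open>node D i\<close> is \<open>x\<^bsub>i+1/2\<^esub>\<close>, so the cells are \<open>[node D (i - 1), node D i]\<close>
  for \<open>1 \<le> i \<le> num_cells D\<close>.\<close>

record discretization =
  sv_kind :: sv_method
  bc_kind :: boundary_condition
  poly_deg :: nat
  ref_pt :: "nat \<Rightarrow> real"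
  num_cells :: nat
  node :: "nat \<Rightarrow> real"

definition cell_size :: "discretization \<Rightarrow> nat \<Rightarrow> real" where
  "cell_size D i = node D i - node D (i - 1)"

definition cell_mid :: "discretization \<Rightarrow> nat \<Rightarrow> real" where
  "cell_mid D i = (node D (i - 1) + node D i) / 2"

definition mesh_size :: "discretization \<Rightarrow> real" where
  "mesh_size D = Max (cell_size D ` {1..num_cells D})"

definition cv_point :: "discretization \<Rightarrow> nat \<Rightarrow> nat \<Rightarrow> real" where
  "cv_point D i j = cell_size D i / 2 * ref_pt D j + cell_mid D i"

definition cv_weight :: "discretization \<Rightarrow> nat \<Rightarrow> nat \<Rightarrow> real" where
  "cv_weight D i j =
     cell_size D i / 2 * reference_weight (sv_kind D) (poly_deg D) (ref_pt D) j"

text \<open>All discretizations of \<open>[a, b]\<close> of the given kind whose mesh is regular with constant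
  \<open>\<alpha>star\<close>.\<close>

definition regular_family ::
  "sv_method \<Rightarrow> boundary_condition \<Rightarrow> nat \<Rightarrow> (nat \<Rightarrow> real) \<Rightarrow> real \<Rightarrow> real \<Rightarrow> real \<Rightarrow> discretization set"
  where
  "regular_family meth bc k y a b \<alpha>star =
     {D. sv_kind D = meth \<and> bc_kind D = bc \<and> poly_deg D = k \<and> ref_pt D = y \<and>
         1 \<le> num_cells D \<and> node D 0 = a \<and> node D (num_cells D) = b \<and>
         (\<forall>i\<in>{1..num_cells D}. node D (i - 1) < node D i) \<and>
         \<alpha>star * mesh_size D \<le> Min (cell_size D ` {1..num_cells D})}"

text \<open>Elements of the trial space are functions on the line of which only the restrictions to the
  open cells matter: the values at the cell interfaces (and outside of \<open>[a, b]\<close>) are arbitrary,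
  as for representatives of elements of \<open>L\<^sub>2(a, b)\<close>. Everything below depends only on
  integrals, one-sided limits, and derivatives in the open cells.\<close>

definition trial_space :: "discretization \<Rightarrow> (real \<Rightarrow> real) set" where
  "trial_space D =
     {w. \<forall>i\<in>{1..num_cells D}. \<exists>p :: real poly. degree p \<le> poly_deg D \<and>
           (\<forall>x\<in>{node D (i - 1)<..<node D i}. w x = poly p x)}"

text \<open>The value of \<open>w\<^sup>*\<close> on the control volume \<open>C\<^bsub>i,j\<^esub>\<close>. At \<open>j = 0\<close> the derivative is taken at
  a cell interface, but there the weight is 0.\<close>

primrec star_val :: "discretization \<Rightarrow> (real \<Rightarrow> real) \<Rightarrow> nat \<Rightarrow> nat \<Rightarrow> real" where
  "star_val D w i 0 =
     Lim (at_right (node D (i - 1))) w + cv_weight D i 0 * deriv w (cv_point D i 0)"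
| "star_val D w i (Suc j) =
     star_val D w i j + cv_weight D i (Suc j) * deriv w (cv_point D i (Suc j))"

definition star :: "discretization \<Rightarrow> (real \<Rightarrow> real) \<Rightarrow> real \<Rightarrow> real" where
  "star D w x =
     (\<Sum>i\<in>{1..num_cells D}. \<Sum>j\<in>{0..poly_deg D}.
        star_val D w i j * indicator {cv_point D i j<..<cv_point D i (j + 1)} x)"

definition L2_inner :: "discretization \<Rightarrow> (real \<Rightarrow> real) \<Rightarrow> (real \<Rightarrow> real) \<Rightarrow> real" where
  "L2_inner D v w = integral {node D 0..node D (num_cells D)} (\<lambda>x. v x * w x)"

definition sv_norm_sq :: "discretization \<Rightarrow> (real \<Rightarrow> real) \<Rightarrow> real" where
  "sv_norm_sq D w = L2_inner D w (star D w)"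

text \<open>The left trace \<open>v\<^sup>-\<close> at \<open>cv_point D i j\<close>; for \<open>i \<ge> 2\<close> and \<open>j = 0\<close> this is the limit from
  within cell \<open>i - 1\<close>, as \<open>cv_point D i 0 = node D (i - 1)\<close>.\<close>

definition left_trace :: "discretization \<Rightarrow> (real \<Rightarrow> real) \<Rightarrow> nat \<Rightarrow> nat \<Rightarrow> real" where
  "left_trace D v i j =
     (if i = 1 \<and> j = 0
      then (case bc_kind D of
              Homogeneous \<Rightarrow> 0
            | Periodic \<Rightarrow> Lim (at_left (node D (num_cells D))) v)
      else Lim (at_left (cv_point D i j)) v)"

text \<open>\<open>sv_form D v w\<close> is \<open>a\<^sub>h(v, w\<^sup>*)\<close>.\<close>

definition sv_form :: "discretization \<Rightarrow> (real \<Rightarrow> real) \<Rightarrow> (real \<Rightarrow> real) \<Rightarrow> real" where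
  "sv_form D v w =
     - (\<Sum>i\<in>{1..num_cells D}. \<Sum>j\<in>{0..poly_deg D}.
          star_val D w i j * (left_trace D v i (j + 1) - left_trace D v i j))"


section \<open>Runge--Kutta discretization in time\<close>

text \<open>\<open>rk_coeff m \<ell>\<close> is \<open>g\<^bsub>m,\<ell>\<^esub>\<close>, where \<open>m = s - 1\<close>; it is 0 for \<open>\<ell> > m\<close>.\<close>

primrec rk_coeff :: "nat \<Rightarrow> nat \<Rightarrow> real" where
  "rk_coeff 0 = (\<lambda>l. if l = 0 then 1 else 0)"
| "rk_coeff (Suc m) =
     (let g = (\<lambda>l. if l = Suc m then 1 / fact (m + 2) else rk_coeff m (l - 1) / real l)
      in (\<lambda>l. if l = 0 then 1 - (\<Sum>r\<in>{1..Suc m}. g r) else if l \<le> Suc m then g l else 0))"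

text \<open>\<open>u n \<ell>\<close> is the stage \<open>u\<^sub>h\<^bsup>n,\<ell>\<^esup>\<close>, and \<open>u n 0\<close> is \<open>u\<^sub>h\<^sup>n\<close>. The initial value \<open>u 0 0\<close> is an
  arbitrary element of the trial space.\<close>

definition rksv_solution ::
  "discretization \<Rightarrow> nat \<Rightarrow> real \<Rightarrow> (nat \<Rightarrow> nat \<Rightarrow> real \<Rightarrow> real) \<Rightarrow> bool" where
  "rksv_solution D s \<tau> u \<longleftrightarrow>
     (\<forall>n. \<forall>l\<le>s. u n l \<in> trial_space D) \<and>
     (\<forall>n. u (Suc n) 0 = u n s) \<and>
     (\<forall>n. \<forall>w\<in>trial_space D.
        (\<forall>l. l + 2 \<le> s \<longrightarrow>
           L2_inner D (u n (l + 1)) (star D w) =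
             L2_inner D (u n l) (star D w) + \<tau> * sv_form D (u n l) w) \<and>
        L2_inner D (u n s) (star D w) =
          (\<Sum>\<kappa>\<in>{0..s - 1}. rk_coeff (s - 1) \<kappa> * L2_inner D (u n \<kappa>) (star D w)) +
          \<tau> * rk_coeff (s - 1) (s - 1) * sv_form D (u n (s - 1)) w)"


section \<open>Temporal differences\<close>

text \<open>Linear combinations of the stages \<open>u\<^sub>h\<^bsup>n,0\<^esup>, \<dots>, u\<^sub>h\<^bsup>n,s\<^esup>\<close> are given by their coefficients.
  For \<open>m < s\<close>, solving the stage equation in which \<open>\<tau> a\<^sub>h(u\<^sub>h\<^bsup>n,m\<^esup>, w\<^sup>*)\<close> occurs for this term yields
  \<open>\<tau> a\<^sub>h(u\<^sub>h\<^bsup>n,m\<^esup>, w\<^sup>*) = (z, w\<^sup>*)\<close>, where \<open>z\<close> is the combination of the stages with coefficients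
  \<open>stage_increment s m\<close>.\<close>

definition stage_increment :: "nat \<Rightarrow> nat \<Rightarrow> nat \<Rightarrow> real" where
  "stage_increment s m l =
     (if m + 2 \<le> s then of_bool (l = m + 1) - of_bool (l = m)
      else (of_bool (l = s) - rk_coeff (s - 1) l) / rk_coeff (s - 1) (s - 1))"

text \<open>The coefficients \<open>\<sigma>\<^bsub>\<kappa>\<ell>\<^esub>\<close> of \<open>\<DD>\<^sub>\<kappa>\<close>. Substituting the above into \<open>\<tau> a\<^sub>h(\<DD>\<^sub>\<kappa> u\<^sub>h\<^sup>n, w\<^sup>*)\<close> gives the
  recursion; see lemmas \<open>temporal_difference\<close> and \<open>sum_diff_coeff\<close>.\<close>

primrec diff_coeff :: "nat \<Rightarrow> nat \<Rightarrow> nat \<Rightarrow> real" where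
  "diff_coeff s 0 = (\<lambda>l. of_bool (l = 0))"
| "diff_coeff s (Suc \<kappa>) = (\<lambda>l. \<Sum>m\<in>{0..\<kappa>}. diff_coeff s \<kappa> m * stage_increment s m l)"

lemma rk_coeff_top: "rk_coeff m m = 1 / fact (m + 1)"
  by (cases m) (auto simp: Let_def)

lemma rk_coeff_above: "m < l \<Longrightarrow> rk_coeff m l = 0"
  by (cases m) (auto simp: Let_def)

lemma sum_rk_coeff: "(\<Sum>l\<in>{0..m}. rk_coeff m l) = 1"
proof (cases m)
  case (Suc m')
  have "(\<Sum>l\<in>{0..m}. rk_coeff m l) = rk_coeff m 0 + (\<Sum>l\<in>{1..m}. rk_coeff m l)"
    by (simp add: sum.atLeast_Suc_atMost)
  then show ?thesis
    unfolding Suc by (simp add: Let_def)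
qed simp

text \<open>Summing a stage functional \<open>f\<close> against the increments; \<open>N\<close> is any index containing all the
  stages involved.\<close>

lemma sum_stage_increment:
  assumes "m < s" "m + 1 \<le> N"
  shows "(\<Sum>l\<in>{0..N}. stage_increment s m l * f l) =
    (if m + 2 \<le> s then f (m + 1) - f m
     else (f s - (\<Sum>l\<in>{0..s - 1}. rk_coeff (s - 1) l * f l)) / rk_coeff (s - 1) (s - 1))"
proof -
  have pick: "(\<Sum>l\<in>{0..N}. of_bool (l = i) * f l) = f i" if "i \<le> N" for i
  proof -
    have "(\<Sum>l\<in>{0..N}. of_bool (l = i) * f l) = (\<Sum>l\<in>{0..N}. if l = i then f l else 0)"
      by (rule sum.cong) auto
    then show ?thesis
      using that by simp
  qed
  show ?thesis
  proof (cases "m + 2 \<le> s")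
    case True
    have "(\<Sum>l\<in>{0..N}. stage_increment s m l * f l) =
        (\<Sum>l\<in>{0..N}. of_bool (l = m + 1) * f l - of_bool (l = m) * f l)"
      by (rule sum.cong[OF refl])
        (simp only: stage_increment_def if_P[OF True] left_diff_distrib)
    then show ?thesis
      using assms True by (simp only: sum_subtractf pick if_True)
  next
    case False
    have *: "(\<Sum>l\<in>{0..N}. rk_coeff (s - 1) l * f l) = (\<Sum>l\<in>{0..s - 1}. rk_coeff (s - 1) l * f l)"
      using assms False by (intro sum.mono_neutral_right) (auto simp: rk_coeff_above)
    have "(\<Sum>l\<in>{0..N}. stage_increment s m l * f l) =
       (\<Sum>l\<in>{0..N}. (of_bool (l = s) * f l - rk_coeff (s - 1) l * f l) /
         rk_coeff (s - 1) (s - 1))"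
      by (rule sum.cong[OF refl])
        (simp only: stage_increment_def if_not_P[OF False] left_diff_distrib times_divide_eq_left)
    also have "\<dots> =
       ((\<Sum>l\<in>{0..N}. of_bool (l = s) * f l) - (\<Sum>l\<in>{0..N}. rk_coeff (s - 1) l * f l)) /
         rk_coeff (s - 1) (s - 1)"
      by (simp only: sum_divide_distrib[symmetric] sum_subtractf)
    also have "(\<Sum>l\<in>{0..N}. of_bool (l = s) * f l) = f s"
      using assms False by (intro pick) simp
    finally show ?thesis
      by (simp only: * if_not_P[OF False])
  qed
qed

lemma sum_diff_coeff:
  assumes "1 \<le> \<kappa>" "\<kappa> \<le> s"
  shows "(\<Sum>l\<in>{0..\<kappa>}. diff_coeff s \<kappa> l) = 0"
proof (cases \<kappa>)
  case (Suc \<kappa>')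
  have "(\<Sum>l\<in>{0..\<kappa>}. diff_coeff s \<kappa> l) =
      (\<Sum>m\<in>{0..\<kappa>'}. diff_coeff s \<kappa>' m * (\<Sum>l\<in>{0..\<kappa>}. stage_increment s m l * 1))"
    unfolding Suc diff_coeff.simps sum_distrib_left by (subst sum.swap) simp
  also have "\<dots> = 0"
    by (intro sum.neutral ballI)
      (use assms Suc in \<open>subst sum_stage_increment; simp add: sum_rk_coeff[simplified]\<close>)
  finally show ?thesis .
qed (use assms in simp)

lemma trial_space_poly:
  assumes "v \<in> trial_space D" "i \<in> {1..num_cells D}"
  shows "\<exists>p :: real poly. \<forall>t\<in>{node D (i - 1)<..<node D i}. v t = poly p t"
proof -
  have "\<exists>p :: real poly. degree p \<le> poly_deg D \<and>
      (\<forall>t\<in>{node D (i - 1)<..<node D i}. v t = poly p t)"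
    using bspec[OF assms(1)[unfolded trial_space_def mem_Collect_eq] assms(2)] .
  then show ?thesis
    by (elim exE conjE) (rule exI)
qed

lemma trial_space_left_limit:
  assumes "v \<in> trial_space D" "i \<in> {1..num_cells D}" "node D (i - 1) < x" "x \<le> node D i"
  shows "\<exists>L. (v \<longlongrightarrow> L) (at_left x)"
proof -
  obtain p :: "real poly" where p: "\<forall>t\<in>{node D (i - 1)<..<node D i}. v t = poly p t"
    using trial_space_poly[OF assms(1,2)] ..
  have "(poly p \<longlongrightarrow> poly p x) (at_left x)"
    by (intro tendsto_intros)
  moreover have "eventually (\<lambda>t. poly p t = v t) (at_left x)"
    unfolding eventually_at_left_field
    by (rule exI[of _ "node D (i - 1)"]) (use assms(3,4) p in auto)
  ultimately show ?thesis
    by (intro exI) (rule Lim_transform_eventually)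
qed

lemma temporal_difference:
  assumes y: "reference_points meth k y"
    and D: "D \<in> regular_family meth bc k y a b \<alpha>star"
    and u: "rksv_solution D s \<tau> u"
    and \<kappa>: "1 \<le> \<kappa>" "\<kappa> \<le> s" and w: "w \<in> trial_space D"
  shows "L2_inner D (\<lambda>x. \<Sum>l\<in>{0..\<kappa>}. diff_coeff s \<kappa> l * u n l x) (star D w) =
    \<tau> * sv_form D (\<lambda>x. \<Sum>l\<in>{0..\<kappa> - 1}. diff_coeff s (\<kappa> - 1) l * u n l x) w"
proof -
  have U: "u n l \<in> trial_space D" if "l \<le> s" for l
    using u that by (simp add: rksv_solution_def)
  have node: "node D (i - 1) < node D i" if "i \<in> {1..num_cells D}" for i
    using D that by (auto simp: regular_family_def)
  have y_bounds: "-1 \<le> ref_pt D j \<and> ref_pt D j \<le> 1" if "j \<le> k + 1" for j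
  proof -
    have inc: "y i \<le> y j" if "i \<le> j" "j \<le> k + 1" for i j
      using that
    proof (induction j rule: dec_induct)
      case (step m)
      then show ?case
        using y by (fastforce simp: reference_points_def)
    qed simp
    show ?thesis
      using inc[of 0 j] inc[of j "k + 1"] that y D
      by (simp add: reference_points_def regular_family_def)
  qed
  have y_pos: "-1 < ref_pt D (Suc j)" if "j \<le> k" for j
    using y_bounds[of j] that y D by (fastforce simp: reference_points_def regular_family_def)
  have deg: "poly_deg D = k"
    using D by (simp add: regular_family_def)
  have cv: "cv_point D i j = node D (i - 1) + cell_size D i * (ref_pt D j + 1) / 2"
      "cv_point D i j = node D i - cell_size D i * (1 - ref_pt D j) / 2" for i j
    by (simp_all add: cv_point_def cell_mid_def cell_size_def field_simps)
  have cs: "cell_size D i > 0" if "i \<in> {1..num_cells D}" for i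
    using node[OF that] by (simp add: cell_size_def)
  have cv_ge: "node D (i - 1) \<le> cv_point D i j" and cv_le: "cv_point D i j \<le> node D i"
    if "i \<in> {1..num_cells D}" "j \<le> k + 1" for i j
    using cs[OF that(1)] y_bounds[OF that(2)] by (simp add: cv(1), simp add: cv(2))
  have cv_gt: "node D (i - 1) < cv_point D i (Suc j)"
    if "i \<in> {1..num_cells D}" "j \<le> k" for i j
    using cs[OF that(1)] y_pos[OF that(2)] cv(1)[of i "Suc j"] by simp
  have cv_0: "cv_point D i 0 = node D (i - 1)" for i
    using y D by (simp add: cv(1) reference_points_def regular_family_def)

  have trace_sum: "left_trace D (\<lambda>x. \<Sum>l\<in>A. c l * u n l x) i j =
      (\<Sum>l\<in>A. c l * left_trace D (u n l) i j)"
    if A: "A \<subseteq> {0..s}" and ij: "i \<in> {1..num_cells D}" "j \<le> k + 1" for A c i j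
  proof -
    have lin: "Lim (at_left x) (\<lambda>x. \<Sum>l\<in>A. c l * u n l x) =
        (\<Sum>l\<in>A. c l * Lim (at_left x) (u n l))"
      if "i' \<in> {1..num_cells D}" "node D (i' - 1) < x" "x \<le> node D i'" for x i'
    proof -
      have "(u n l \<longlongrightarrow> Lim (at_left x) (u n l)) (at_left x)" if "l \<in> A" for l
        using trial_space_left_limit[OF U[of l] \<open>i' \<in> _\<close> \<open>_ < x\<close> \<open>x \<le> _\<close>] that A
        by (metis atLeastAtMost_iff subsetD tendsto_Lim trivial_limit_at_left_real)
      then show ?thesis
        by (intro tendsto_Lim tendsto_sum tendsto_mult tendsto_const)
          (auto simp: trivial_limit_at_left_real)
    qed
    show ?thesis
    proof (cases j)
      case (Suc j')
      then show ?thesis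
        using lin[of i "cv_point D i j"] cv_gt[of i j'] cv_le[of i j] ij
        by (simp add: left_trace_def)
    next
      case 0
      show ?thesis
      proof (cases "i = 1")
        case True
        then show ?thesis
          using 0 lin[of "num_cells D" "node D (num_cells D)"] node[of "num_cells D"] ij
          by (auto simp: left_trace_def split: boundary_condition.split)
      next
        case False
        then have "i - 1 \<in> {1..num_cells D}"
          using ij by auto
        then show ?thesis
          using 0 False lin[of "i - 1" "node D (i - 1)"] node[of "i - 1"]
          by (simp add: left_trace_def cv_0)
      qed
    qed
  qed
  have form_sum: "sv_form D (\<lambda>x. \<Sum>l\<in>A. c l * u n l x) w = (\<Sum>l\<in>A. c l * sv_form D (u n l) w)"
    if "A \<subseteq> {0..s}" for A c
  proof -
    have "sv_form D (\<lambda>x. \<Sum>l\<in>A. c l * u n l x) w =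
      - (\<Sum>i\<in>{1..num_cells D}. \<Sum>j\<in>{0..poly_deg D}. \<Sum>l\<in>A.
          c l * (star_val D w i j * (left_trace D (u n l) i (j + 1) - left_trace D (u n l) i j)))"
      unfolding sv_form_def
      by (intro arg_cong[where f = uminus] sum.cong refl)
        (simp add: trace_sum[OF that] deg sum_subtractf[symmetric] sum_distrib_left
          right_diff_distrib mult.left_commute del: star_val.simps)
    also have "\<dots> = - (\<Sum>l\<in>A. \<Sum>i\<in>{1..num_cells D}. \<Sum>j\<in>{0..poly_deg D}.
          c l * (star_val D w i j * (left_trace D (u n l) i (j + 1) - left_trace D (u n l) i j)))"
      by (simp only: sum.swap[of _ A "{0..poly_deg D}"] sum.swap[of _ A "{1..num_cells D}"])
    also have "\<dots> = (\<Sum>l\<in>A. c l * sv_form D (u n l) w)"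
      by (simp only: sv_form_def sum_negf[symmetric] sum_distrib_left mult_minus_right)
    finally show ?thesis .
  qed

  have integrable: "(\<lambda>x. v x * star D w x) integrable_on {node D 0..node D (num_cells D)}"
    if v: "v \<in> trial_space D" for v
  proof -
    have "(\<lambda>x. v x * (star_val D w i j * indicator {cv_point D i j<..<cv_point D i (j + 1)} x))
        integrable_on {node D 0..node D (num_cells D)}"
      if ij: "i \<in> {1..num_cells D}" "j \<in> {0..k}" for i j
    proof -
      obtain p :: "real poly" where
        p: "\<forall>t\<in>{node D (i - 1)<..<node D i}. v t = poly p t"
        using trial_space_poly[OF v ij(1)] ..
      let ?S = "{cv_point D i j<..<cv_point D i (j + 1)}"
      have S: "?S \<subseteq> {node D (i - 1)<..<node D i}"
        using cv_ge[of i j] cv_le[of i "j + 1"] ij by auto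
      let ?f = "\<lambda>x. star_val D w i j * poly p x"
      have "?f integrable_on ?S"
        by (subst integrable_on_open_interval_real)
          (intro integrable_continuous_real continuous_intros)
      then have "(\<lambda>x. if x \<in> ?S then ?f x else 0) integrable_on {node D 0..node D (num_cells D)}"
        by (subst (asm) integrable_restrict_UNIV[symmetric])
          (metis box_real(2) integrable_on_subcbox subset_UNIV)
      then show ?thesis
        by (rule integrable_eq) (use p S in \<open>auto simp: indicator_def\<close>)
    qed
    then have "(\<lambda>x. \<Sum>i\<in>{1..num_cells D}. \<Sum>j\<in>{0..poly_deg D}.
        v x * (star_val D w i j * indicator {cv_point D i j<..<cv_point D i (j + 1)} x))
        integrable_on {node D 0..node D (num_cells D)}"
      unfolding deg by (intro integrable_sum) auto
    then show ?thesis
      by (simp only: star_def sum_distrib_left)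
  qed
  have inner_sum: "L2_inner D (\<lambda>x. \<Sum>l\<in>A. c l * u n l x) (star D w) =
      (\<Sum>l\<in>A. c l * L2_inner D (u n l) (star D w))"
    if A: "A \<subseteq> {0..s}" for A c
  proof -
    have "L2_inner D (\<lambda>x. \<Sum>l\<in>A. c l * u n l x) (star D w) =
        integral {node D 0..node D (num_cells D)} (\<lambda>x. \<Sum>l\<in>A. c l * (u n l x * star D w x))"
      by (simp add: L2_inner_def sum_distrib_right mult.assoc)
    also have "\<dots> = (\<Sum>l\<in>A. integral {node D 0..node D (num_cells D)}
        (\<lambda>x. c l * (u n l x * star D w x)))"
      using A U integrable finite_subset[OF A]
      by (intro integral_sum integrable_on_mult_right) auto
    finally show ?thesis
      by (simp add: L2_inner_def)
  qed

  have increment: "(\<Sum>l\<in>{0..\<kappa>}. stage_increment s m l * L2_inner D (u n l) (star D w)) =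
      \<tau> * sv_form D (u n m) w"
    if "m \<in> {0..\<kappa> - 1}" for m
  proof -
    have m: "m < s" "m + 1 \<le> \<kappa>"
      using that \<kappa> by auto
    note step = bspec[OF spec[OF conjunct2[OF conjunct2[OF u[unfolded rksv_solution_def]]], of n] w]
    show ?thesis
    proof (cases "m + 2 \<le> s")
      case True
      then show ?thesis
        using spec[OF conjunct1[OF step], of m]
        by (simp only: sum_stage_increment[OF m]) simp
    next
      case False
      then have "s - 1 = m"
        using m by simp
      then show ?thesis
        using False conjunct2[OF step]
        by (simp only: sum_stage_increment[OF m]) (simp add: rk_coeff_top)
    qed
  qed
  obtain \<kappa>' where \<kappa>': "\<kappa> = Suc \<kappa>'"
    using \<kappa> by (cases \<kappa>) auto
  have "L2_inner D (\<lambda>x. \<Sum>l\<in>{0..\<kappa>}. diff_coeff s \<kappa> l * u n l x) (star D w) =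
      (\<Sum>l\<in>{0..\<kappa>}. diff_coeff s \<kappa> l * L2_inner D (u n l) (star D w))"
    using \<kappa> by (intro inner_sum) auto
  also have "\<dots> = (\<Sum>m\<in>{0..\<kappa> - 1}. diff_coeff s (\<kappa> - 1) m *
      (\<Sum>l\<in>{0..\<kappa>}. stage_increment s m l * L2_inner D (u n l) (star D w)))"
    by (simp only: \<kappa>' diff_coeff.simps sum_distrib_left sum_distrib_right diff_Suc_1 mult.assoc)
      (rule sum.swap)
  also have "\<dots> = (\<Sum>m\<in>{0..\<kappa> - 1}. diff_coeff s (\<kappa> - 1) m * (\<tau> * sv_form D (u n m) w))"
    by (intro sum.cong refl) (simp only: increment)
  also have "\<dots> = \<tau> * sv_form D (\<lambda>x. \<Sum>l\<in>{0..\<kappa> - 1}. diff_coeff s (\<kappa> - 1) l * u n l x) w"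
    using form_sum[of "{0..\<kappa> - 1}"] \<kappa> by (simp add: sum_distrib_left mult.left_commute del: diff_coeff.simps)
  finally show ?thesis .
qed

text \<open>\<open>\<alpha>\<^sub>0 u\<^sub>h\<^bsup>n,s\<^esup> = \<Sum>\<^sub>p \<alpha>\<^sub>p \<DD>\<^sub>p u\<^sub>h\<^sup>n\<close> as an identity between linear combinations of the stages.\<close>

definition evolution_coeffs :: "nat \<Rightarrow> (nat \<Rightarrow> real) \<Rightarrow> bool" where
  "evolution_coeffs s \<alpha> \<longleftrightarrow>
     \<alpha> 0 > 0 \<and>
     (\<forall>l\<le>s. \<alpha> 0 * of_bool (l = s) = (\<Sum>p\<in>{0..s}. \<alpha> p * diff_coeff s p l))"


section \<open>Matrix transferring process\<close>

primrec transfer_a :: "nat \<Rightarrow> (nat \<Rightarrow> real) \<Rightarrow> nat \<Rightarrow> nat \<Rightarrow> nat \<Rightarrow> real" where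
  "transfer_a s \<alpha> 0 = (\<lambda>p' q'.
     if p' > s \<or> q' > s \<or> p' + q' = 0 then 0 else \<alpha> p' * \<alpha> q')"
| "transfer_a s \<alpha> (Suc l') = (\<lambda>p' q'.
     let l = Suc l'; p = max p' q'; q = min p' q'; a = transfer_a s \<alpha> l' in
     if p > s then 0
     else if q \<le> l - 1 then 0
     else if p = l \<and> q = l then a p q - 2 * a (p + 1) (q - 1)
     else if l + 1 \<le> p \<and> p \<le> s - 1 \<and> q = l then a p q - a (p + 1) (q - 1)
     else a p q)"

primrec transfer_b :: "nat \<Rightarrow> (nat \<Rightarrow> real) \<Rightarrow> nat \<Rightarrow> nat \<Rightarrow> nat \<Rightarrow> real" where
  "transfer_b s \<alpha> 0 = (\<lambda>p' q'. 0)"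
| "transfer_b s \<alpha> (Suc l') = (\<lambda>p' q'.
     let l = Suc l'; p = max p' q'; q = min p' q' in
     if p > s then 0
     else if l - 1 \<le> p \<and> p \<le> s - 1 \<and> q = l - 1 then 2 * transfer_a s \<alpha> l' (p + 1) q
     else transfer_b s \<alpha> l' p q)"

definition termination_index :: "nat \<Rightarrow> (nat \<Rightarrow> real) \<Rightarrow> nat" where
  "termination_index s \<alpha> = (LEAST l. 1 \<le> l \<and> transfer_a s \<alpha> l l l \<noteq> 0)"

definition leading_minor :: "nat \<Rightarrow> (nat \<Rightarrow> real) \<Rightarrow> nat \<Rightarrow> real" where
  "leading_minor s \<alpha> \<kappa> =
     Determinant.det (Matrix.mat (\<kappa> + 1) (\<kappa> + 1)
       (\<lambda>(p, q). transfer_b s \<alpha> (termination_index s \<alpha>) p q))"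

definition contribution_index :: "nat \<Rightarrow> (nat \<Rightarrow> real) \<Rightarrow> nat" where
  "contribution_index s \<alpha> =
     (let \<zeta> = termination_index s \<alpha> in
      if \<exists>\<kappa><\<zeta>. leading_minor s \<alpha> \<kappa> \<le> 0
      then (LEAST \<kappa>. \<kappa> < \<zeta> \<and> leading_minor s \<alpha> \<kappa> \<le> 0)
      else \<zeta>)"


section \<open>Stability\<close>

text \<open>The argument \<open>\<F>\<close> is a family of discretizations; the constants are uniform over the
  family, the number \<open>M\<close> of time steps, the time step \<open>n\<close> and the numerical solution.\<close>

definition monotonicity_stable :: "discretization set \<Rightarrow> nat \<Rightarrow> real \<Rightarrow> bool" where
  "monotonicity_stable \<F> s T \<longleftrightarrow>
     (\<exists>\<Lambda>>0. \<forall>D\<in>\<F>. \<forall>M::nat. \<forall>\<tau> u.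
        1 \<le> M \<and> \<tau> = T / real M \<and> \<tau> / mesh_size D \<le> \<Lambda> \<and> rksv_solution D s \<tau> u \<longrightarrow>
        (\<forall>n. sv_norm_sq D (u (Suc n) 0) \<le> sv_norm_sq D (u n 0)))"

definition weakly_stable :: "nat \<Rightarrow> discretization set \<Rightarrow> nat \<Rightarrow> real \<Rightarrow> bool" where
  "weakly_stable \<gamma> \<F> s T \<longleftrightarrow>
     (\<exists>\<Lambda>>0. \<exists>C>0. \<forall>D\<in>\<F>. \<forall>M::nat. \<forall>\<tau> u.
        1 \<le> M \<and> \<tau> = T / real M \<and> \<tau> / mesh_size D \<le> \<Lambda> \<and> rksv_solution D s \<tau> u \<longrightarrow>
        (\<forall>n. sv_norm_sq D (u (Suc n) 0)
               \<le> (1 + C * (\<tau> / mesh_size D) ^ \<gamma>) * sv_norm_sq D (u n 0)))"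

end

theory Submission
  imports Defs
begin

text \<open>The scheme is stable because, after one time step, the change of the energy can be rewritten
  as a form in the temporal differences \<open>\<DD>\<^sub>p u\<close> of which all but small terms have a sign.

  A few properties of the space discretization suffice. Summation by parts turns the control-volume
  form \<open>a\<^sub>h(v, w\<^sup>*)\<close> of either method into the upwind discontinuous Galerkin form, since both quadratures are exact in the degrees
  that occur (\<open>ref_form\<close>), and turns \<open>(v, w\<^sup>*)\<close> into the \<open>L\<^sub>2\<close> product plus a nonnegative multiple of
  the product of the leading coefficients on each cell (\<open>ref_mass\<close>). Hence \<open>(\<cdot>, \<cdot>\<^sup>*)\<close> is an inner
  product, \<open>a\<^sub>h(v, w\<^sup>*) + a\<^sub>h(w, v\<^sup>*)\<close> is minus a sum of products of interface jumps (\<open>sv_form_sym\<close>), and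
  by an inverse inequality \<open>a\<^sub>h\<close> is bounded by a constant over \<open>h\<close> (\<open>sv_form_bound\<close>). Since
  \<open>(\<DD>\<^sub>p\<^sub>+\<^sub>1 u, w\<^sup>*) = \<tau> a\<^sub>h(\<DD>\<^sub>p u, w\<^sup>*)\<close>, boundedness makes each temporal difference smaller than its
  predecessor by a factor of the order of the CFL number, and the symmetric part gives the exchange rule
  \<open>(\<DD>\<^sub>p\<^sub>+\<^sub>1 u, \<DD>\<^sub>q u\<^sup>*) + (\<DD>\<^sub>q\<^sub>+\<^sub>1 u, \<DD>\<^sub>p u\<^sup>*) = - \<tau> \<Sum> jump \<cdot> jump\<close>.

  Squaring the evolution identity expresses \<open>\<alpha>\<^sub>0\<^sup>2 (|||u\<^sup>n\<^sup>+\<^sup>1|||\<^sup>2 - |||u\<^sup>n|||\<^sup>2)\<close> by the Gram matrix of the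
  temporal differences with the initial matrix of the transferring process as coefficients. Every step
  of the process is one application of the exchange rule to a whole column (\<open>transfer_step\<close>), so that
  at termination the same quantity is the form of \<open>transfer_a s \<alpha> \<zeta>\<close> in the Gram matrix minus \<open>\<tau>/2\<close>
  times the form of \<open>transfer_b s \<alpha> \<zeta>\<close> in the jumps. The first is \<open>a\<^sub>\<zeta>\<^sub>\<zeta> |||\<DD>\<^sub>\<zeta> u|||\<^sup>2\<close> up to a small
  multiple of \<open>|||\<DD>\<^sub>\<zeta> u|||\<^sup>2\<close>. In the second, the leading block of order \<open>\<rho>\<close> has positive leading minors and is therefore positive
  definite (\<open>sylvester_coercive\<close>), so the dissipation can fail only through differences of order at
  least \<open>\<rho>\<close>, at the cost of a constant times \<open>\<lambda> |||\<DD>\<^sub>\<rho> u|||\<^sup>2\<close>. This is \<open>energy_increment\<close>; the three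
  claims follow by inserting \<open>|||\<DD>\<^sub>p u|||\<^sup>2 \<le> C \<lambda>\<^sup>2\<^sup>p |||u|||\<^sup>2\<close> and choosing \<open>\<lambda>\<close> small.\<close>


section \<open>Quadratic forms with positive leading minors\<close>

lemma leading_block_solvable:
  fixes b :: "nat \<Rightarrow> nat \<Rightarrow> real"
  assumes det: "Determinant.det (Matrix.mat n n (\<lambda>(p, q). b p q)) \<noteq> 0"
  shows "\<exists>z. \<forall>p<n. (\<Sum>q<n. b p q * z q) = c p"
proof -
  let ?B = "Matrix.mat n n (\<lambda>(p, q). b p q)"
  obtain C where C: "C \<in> carrier_mat n n" "?B * C = 1\<^sub>m n"
    using det_non_zero_imp_unit[where n=n and b="()", OF _ det]
    by (auto simp: Units_def ring_mat_def)
  have entry: "(\<Sum>q<n. b p q * C $$ (q, r)) = of_bool (p = r)" if "p < n" "r < n" for p r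
  proof -
    have "(?B * C) $$ (p, r) = (\<Sum>q<n. b p q * C $$ (q, r))"
      using that C(1) by (auto simp: scalar_prod_def atLeast0LessThan intro!: sum.cong)
    then show ?thesis
      using that C(2) by (auto simp: of_bool_def split: if_splits)
  qed
  define z where "z q = (\<Sum>r<n. C $$ (q, r) * c r)" for q
  have "(\<Sum>q<n. b p q * z q) = c p" if "p < n" for p
  proof -
    have "(\<Sum>q<n. b p q * z q) = (\<Sum>r<n. (\<Sum>q<n. b p q * C $$ (q, r)) * c r)"
      unfolding z_def sum_distrib_left sum_distrib_right
      by (subst sum.swap) (simp add: mult.assoc)
    also have "\<dots> = (\<Sum>r<n. if r = p then c r else 0)"
      by (intro sum.cong) (auto simp: entry that)
    finally show ?thesis using that by simp
  qed
  then show ?thesis by blast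
qed

text \<open>Multiplication from the right by the unit upper triangular matrix with last column \<open>(-z, 1)\<close> clears
  the last column above the corner and leaves the Schur complement in the corner.\<close>

lemma det_bordered:
  fixes b :: "nat \<Rightarrow> nat \<Rightarrow> real"
  assumes z: "\<And>p. p < n \<Longrightarrow> (\<Sum>q<n. b p q * z q) = b p n"
  shows "Determinant.det (Matrix.mat (n + 1) (n + 1) (\<lambda>(p, q). b p q)) =
    Determinant.det (Matrix.mat n n (\<lambda>(p, q). b p q)) * (b n n - (\<Sum>q<n. b n q * z q))"
proof -
  let ?B = "Matrix.mat n n (\<lambda>(p, q). b p q)"
  let ?B' = "Matrix.mat (n + 1) (n + 1) (\<lambda>(p, q). b p q)"
  let ?\<delta> = "b n n - (\<Sum>q<n. b n q * z q)"
  let ?U = "four_block_mat (1\<^sub>m n) (Matrix.mat n 1 (\<lambda>(p, q). - z p)) (0\<^sub>m 1 n) (1\<^sub>m 1) :: real mat"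
  let ?L = "four_block_mat ?B (0\<^sub>m n 1) (Matrix.mat 1 n (\<lambda>(p, q). b n q))
              (Matrix.mat 1 1 (\<lambda>_. ?\<delta>)) :: real mat"
  have "?B' * ?U = ?L"
  proof (rule eq_matI)
    fix i j assume "i < dim_row ?L" "j < dim_col ?L"
    then have ij: "i < n + 1" "j < n + 1" by auto
    have "(?B' * ?U) $$ (i, j) = (\<Sum>q<n + 1. b i q * ?U $$ (q, j))"
      using ij by (auto simp: scalar_prod_def atLeast0LessThan intro!: sum.cong)
    also have "\<dots> = (\<Sum>q<n. b i q * ?U $$ (q, j)) + b i n * ?U $$ (n, j)"
      by simp
    also have "\<dots> = ?L $$ (i, j)"
    proof (cases "j = n")
      case True
      have "(\<Sum>q<n. b i q * ?U $$ (q, j)) = - (\<Sum>q<n. b i q * z q)"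
        unfolding sum_negf[symmetric] using True by (intro sum.cong) auto
      then show ?thesis
        using ij True by (cases "i < n") (auto simp: z less_Suc_eq)
    next
      case False
      then have j: "j < n" using ij by simp
      have "(\<Sum>q<n. b i q * ?U $$ (q, j)) = (\<Sum>q<n. if q = j then b i q else 0)"
        using j by (intro sum.cong) auto
      then show ?thesis
        using ij j by (cases "i < n") (auto simp: less_Suc_eq)
    qed
    finally show "(?B' * ?U) $$ (i, j) = ?L $$ (i, j)" .
  qed auto
  moreover have "Determinant.det ?U = 1"
    by (subst det_four_block_mat_lower_left_zero[of _ n _ 1]) auto
  moreover have "Determinant.det ?L = Determinant.det ?B * ?\<delta>"
    by (subst det_four_block_mat_upper_right_zero[of _ n _ 1]) (auto simp: det_single)
  moreover have "Determinant.det (?B' * ?U) = Determinant.det ?B' * Determinant.det ?U"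
    by (rule det_mult[of _ "n + 1"]) auto
  ultimately show ?thesis by simp
qed

text \<open>Sylvester's criterion with an explicit lower bound. Completing the square in the last variable leaves
  the form of order \<open>n\<close> in the shifted variables \<open>x p + z p * x n\<close> and, as coefficient of \<open>(x n)\<^sup>2\<close>, the
  Schur complement; this is a quotient of consecutive minors and hence positive.\<close>

lemma sylvester_coercive:
  fixes b :: "nat \<Rightarrow> nat \<Rightarrow> real"
  assumes sym: "\<And>p q. b p q = b q p"
    and minors: "\<And>m. m < n \<Longrightarrow>
      Determinant.det (Matrix.mat (m + 1) (m + 1) (\<lambda>(p, q). b p q)) > 0"
  shows "\<exists>\<epsilon>>0. \<forall>x. (\<Sum>p<n. \<Sum>q<n. b p q * x p * x q) \<ge> \<epsilon> * (\<Sum>p<n. (x p)\<^sup>2)"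
  using minors
proof (induction n)
  case 0
  show ?case by (intro exI[of _ 1]) simp
next
  case (Suc n)
  let ?B = "\<lambda>n. Matrix.mat n n (\<lambda>(p, q). b p q)"
  obtain \<epsilon> where \<epsilon>: "\<epsilon> > 0" "\<And>x. (\<Sum>p<n. \<Sum>q<n. b p q * x p * x q) \<ge> \<epsilon> * (\<Sum>p<n. (x p)\<^sup>2)"
    using Suc by force
  have det_pos: "Determinant.det (?B n) > 0"
  proof (cases n)
    case 0
    then show ?thesis by (simp add: det_dim_zero)
  next
    case (Suc m)
    then show ?thesis using Suc.prems[of m] by simp
  qed
  obtain z where z: "\<And>p. p < n \<Longrightarrow> (\<Sum>q<n. b p q * z q) = b p n"
    using leading_block_solvable[of n b "\<lambda>p. b p n"] det_pos by auto
  define \<delta> where "\<delta> = b n n - (\<Sum>q<n. b n q * z q)"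
  have "Determinant.det (?B n) * \<delta> > 0"
    using Suc.prems[of n] det_bordered[of n b z] z by (simp add: \<delta>_def)
  then have \<delta>: "\<delta> > 0"
    using det_pos by (simp add: zero_less_mult_iff)
  define Z where "Z = (\<Sum>p<n. (z p)\<^sup>2)"
  have Z: "Z \<ge> 0" unfolding Z_def by (intro sum_nonneg) simp
  \<comment> \<open>The shift costs \<open>(x p)\<^sup>2 \<le> 2 * (y p)\<^sup>2 + 2 * (z p)\<^sup>2 * (x n)\<^sup>2\<close>; the first bound on \<open>\<eta>\<close> pays for
    the squares of \<open>y\<close>, the second for those of the last variable.\<close>
  define \<eta> where "\<eta> = min (\<epsilon> / 2) (\<delta> / (1 + 2 * Z))"
  have pos: "1 + 2 * Z > 0" using Z by simp
  have \<eta>: "\<eta> > 0" "2 * \<eta> \<le> \<epsilon>"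
    using \<epsilon>(1) \<delta> pos by (auto simp: \<eta>_def)
  have \<eta>_\<delta>: "\<eta> * (1 + 2 * Z) \<le> \<delta>"
    using pos by (subst pos_le_divide_eq[symmetric]) (simp_all add: \<eta>_def)
  have "\<eta> * (\<Sum>p<Suc n. (x p)\<^sup>2) \<le> (\<Sum>p<Suc n. \<Sum>q<Suc n. b p q * x p * x q)" for x
  proof -
    let ?t = "x n"
    define y where "y p = x p + z p * ?t" for p
    have "(\<Sum>p<n. \<Sum>q<n. b p q * y p * y q) =
        (\<Sum>p<n. \<Sum>q<n. b p q * x p * x q) + ?t * (\<Sum>p<n. x p * (\<Sum>q<n. b p q * z q))
          + ?t * (\<Sum>q<n. x q * (\<Sum>p<n. b p q * z p))
          + ?t\<^sup>2 * (\<Sum>p<n. z p * (\<Sum>q<n. b p q * z q))"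
    proof -
      have "(\<Sum>p<n. \<Sum>q<n. b p q * y p * y q) =
        (\<Sum>p<n. \<Sum>q<n. b p q * x p * x q + ?t * (x p * (b p q * z q))
          + ?t * (x q * (b p q * z p)) + ?t\<^sup>2 * (z p * (b p q * z q)))"
        by (intro sum.cong refl) (simp add: y_def algebra_simps power2_eq_square)
      also have "\<dots> = (\<Sum>p<n. \<Sum>q<n. b p q * x p * x q) + (\<Sum>p<n. \<Sum>q<n. ?t * (x p * (b p q * z q)))
          + (\<Sum>q<n. \<Sum>p<n. ?t * (x q * (b p q * z p)))
          + (\<Sum>p<n. \<Sum>q<n. ?t\<^sup>2 * (z p * (b p q * z q)))"
        by (simp only: sum.distrib sum.swap[of "\<lambda>q p. ?t * (x q * (b p q * z p))"])
      finally show ?thesis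
        by (simp only: sum_distrib_left)
    qed
    also have "\<dots> = (\<Sum>p<n. \<Sum>q<n. b p q * x p * x q) + 2 * ?t * (\<Sum>p<n. x p * b p n)
        + ?t\<^sup>2 * (\<Sum>p<n. b n p * z p)"
    proof -
      have z': "(\<Sum>p<n. b p q * z p) = b q n" if "q < n" for q
        using z[OF that] by (simp only: sym[of _ q])
      have "(\<Sum>p<n. z p * b p n) = (\<Sum>p<n. b n p * z p)"
        by (simp only: sym[of _ n] mult.commute)
      then show ?thesis
        by (simp add: z z')
    qed
    also have "(\<Sum>p<n. \<Sum>q<n. b p q * x p * x q) + 2 * ?t * (\<Sum>p<n. x p * b p n) =
        (\<Sum>p<Suc n. \<Sum>q<Suc n. b p q * x p * x q) - b n n * ?t\<^sup>2"
    proof -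
      have row: "(\<Sum>p<n. b p n * x p * ?t) = ?t * (\<Sum>p<n. x p * b p n)"
        by (simp add: sum_distrib_left mult_ac)
      have "(\<Sum>q<n. b n q * ?t * x q) = (\<Sum>p<n. b p n * x p * ?t)"
        by (intro sum.cong refl) (simp add: sym[of n] mult_ac)
      then show ?thesis
        by (simp add: sum.distrib row power2_eq_square)
    qed
    finally have "(\<Sum>p<Suc n. \<Sum>q<Suc n. b p q * x p * x q) =
        (\<Sum>p<n. \<Sum>q<n. b p q * y p * y q) + \<delta> * ?t\<^sup>2"
      unfolding \<delta>_def by (simp add: algebra_simps)
    moreover have "(\<Sum>p<n. (x p)\<^sup>2) \<le> 2 * (\<Sum>p<n. (y p)\<^sup>2) + 2 * Z * ?t\<^sup>2"
    proof -
      have "(x p)\<^sup>2 \<le> 2 * (y p)\<^sup>2 + 2 * ((z p)\<^sup>2 * ?t\<^sup>2)" for p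
      proof -
        have "2 * (y p)\<^sup>2 + 2 * ((z p)\<^sup>2 * ?t\<^sup>2) - (x p)\<^sup>2 = (x p + 2 * z p * ?t)\<^sup>2"
          by (simp add: y_def power2_eq_square algebra_simps)
        then show ?thesis using zero_le_power2[of "x p + 2 * z p * ?t"] by linarith
      qed
      then have "(\<Sum>p<n. (x p)\<^sup>2) \<le> (\<Sum>p<n. 2 * (y p)\<^sup>2 + 2 * ((z p)\<^sup>2 * ?t\<^sup>2))"
        by (intro sum_mono)
      then show ?thesis
        by (simp add: Z_def sum.distrib sum_distrib_left sum_distrib_right mult.assoc)
    qed
    moreover have "\<epsilon> * (\<Sum>p<n. (y p)\<^sup>2) \<le> (\<Sum>p<n. \<Sum>q<n. b p q * y p * y q)"
      by (rule \<epsilon>(2))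
    moreover have "2 * \<eta> * (\<Sum>p<n. (y p)\<^sup>2) \<le> \<epsilon> * (\<Sum>p<n. (y p)\<^sup>2)"
      by (intro mult_right_mono \<eta>(2) sum_nonneg) simp
    moreover have "\<eta> * (2 * Z * ?t\<^sup>2) + \<eta> * ?t\<^sup>2 \<le> \<delta> * ?t\<^sup>2"
    proof -
      have "\<eta> * (1 + 2 * Z) * ?t\<^sup>2 \<le> \<delta> * ?t\<^sup>2"
        by (intro mult_right_mono \<eta>_\<delta>) simp
      then show ?thesis by (simp add: algebra_simps)
    qed
    moreover have "\<eta> * (\<Sum>p<n. (x p)\<^sup>2) \<le> \<eta> * (2 * (\<Sum>p<n. (y p)\<^sup>2) + 2 * Z * ?t\<^sup>2)"
      using calculation(2) \<eta>(1) by (intro mult_left_mono) auto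
    ultimately show ?thesis
      by (simp add: algebra_simps)
  qed
  then show ?case using \<eta>(1) by blast
qed

text \<open>If only the minors up to order \<open>r\<close> are known to be positive, the remaining rows, including their
  coupling to the definite block, can be paid for by the squares of the variables with index at least
  \<open>r\<close>. With \<open>r\<close> the contribution index, this bounds the dissipation from below.\<close>

lemma form_lower_bound:
  fixes b :: "nat \<Rightarrow> nat \<Rightarrow> real"
  assumes sym: "\<And>p q. b p q = b q p" and r: "r \<le> s + 1"
    and minors: "\<And>m. m < r \<Longrightarrow>
      Determinant.det (Matrix.mat (m + 1) (m + 1) (\<lambda>(p, q). b p q)) > 0"
  shows "\<exists>C\<ge>0. \<forall>x. (\<Sum>p\<le>s. \<Sum>q\<le>s. b p q * x p * x q) \<ge> - C * (\<Sum>q\<in>{r..s}. (x q)\<^sup>2)"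
proof -
  obtain \<epsilon> where \<epsilon>: "\<epsilon> > 0" "\<And>x. (\<Sum>p<r. \<Sum>q<r. b p q * x p * x q) \<ge> \<epsilon> * (\<Sum>p<r. (x p)\<^sup>2)"
    using sylvester_coercive[OF sym minors] by blast
  define M where "M = (\<Sum>p\<le>s. \<Sum>q\<le>s. \<bar>b p q\<bar>)"
  have M: "\<bar>b p q\<bar> \<le> M" if "p \<le> s" "q \<le> s" for p q
  proof -
    have "\<bar>b p q\<bar> \<le> (\<Sum>q\<le>s. \<bar>b p q\<bar>)"
      using that by (intro member_le_sum) auto
    also have "\<dots> \<le> M"
      unfolding M_def using that by (intro member_le_sum) (auto intro: sum_nonneg)
    finally show ?thesis .
  qed
  have M0: "M \<ge> 0" unfolding M_def by (intro sum_nonneg) auto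
  \<comment> \<open>The mixed terms are absorbed by Young's inequality; this \<open>\<eta>\<close> is small enough for the
    resulting \<open>2 * (s + 1) * \<eta>\<close> to be covered by the coercivity constant.\<close>
  define \<eta> where "\<eta> = \<epsilon> / (2 * (real s + 1))"
  have \<eta>: "\<eta> > 0" using \<epsilon>(1) by (simp add: \<eta>_def)
  define c where "c = M\<^sup>2 / (4 * \<eta>) + M"
  have c: "c \<ge> M" "c \<ge> M\<^sup>2 / (4 * \<eta>)" "c \<ge> 0"
    using \<eta> M0 by (simp_all add: c_def)
  have "(\<Sum>p\<le>s. \<Sum>q\<le>s. b p q * x p * x q) \<ge> - (2 * (real s + 1) * c) * (\<Sum>q\<in>{r..s}. (x q)\<^sup>2)" for x
  proof -
    define u where "u p = (if p < r then (x p)\<^sup>2 else 0)" for p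
    define v where "v p = (if p < r then 0 else (x p)\<^sup>2)" for p
    have young: "\<bar>B * X * Y\<bar> \<le> \<eta> * X\<^sup>2 + c * Y\<^sup>2" if "\<bar>B\<bar> \<le> M" for B X Y :: real
    proof -
      have "\<bar>B * X * Y\<bar> = \<bar>B\<bar> * (\<bar>X\<bar> * \<bar>Y\<bar>)" by (simp add: abs_mult)
      also have "\<dots> \<le> M * (\<bar>X\<bar> * \<bar>Y\<bar>)" using that by (intro mult_right_mono) auto
      also have "\<dots> \<le> \<eta> * X\<^sup>2 + M\<^sup>2 / (4 * \<eta>) * Y\<^sup>2"
      proof -
        have "0 \<le> (2 * \<eta> * \<bar>X\<bar> - M * \<bar>Y\<bar>)\<^sup>2 / (4 * \<eta>)" using \<eta> by simp
        also have "\<dots> = \<eta> * \<bar>X\<bar>\<^sup>2 + M\<^sup>2 / (4 * \<eta>) * \<bar>Y\<bar>\<^sup>2 - M * (\<bar>X\<bar> * \<bar>Y\<bar>)"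
          using \<eta> by (simp add: field_simps power2_eq_square)
        finally show ?thesis by simp
      qed
      also have "\<dots> \<le> \<eta> * X\<^sup>2 + c * Y\<^sup>2"
        using c(2) by (intro add_left_mono mult_right_mono) auto
      finally show ?thesis .
    qed
    have young': "\<bar>B * X * Y\<bar> \<le> c * X\<^sup>2 + c * Y\<^sup>2" if "\<bar>B\<bar> \<le> M" for B X Y :: real
    proof -
      have "0 \<le> (\<bar>X\<bar> - \<bar>Y\<bar>)\<^sup>2" by simp
      moreover have "0 \<le> \<bar>X\<bar> * \<bar>Y\<bar>" by simp
      ultimately have "\<bar>X\<bar> * \<bar>Y\<bar> \<le> X\<^sup>2 + Y\<^sup>2"
        unfolding power2_diff power2_abs by linarith
      moreover have "\<bar>B\<bar> \<le> c" using that c(1) by simp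
      ultimately have "\<bar>B\<bar> * (\<bar>X\<bar> * \<bar>Y\<bar>) \<le> c * (X\<^sup>2 + Y\<^sup>2)"
        using c(3) by (intro mult_mono) auto
      then show ?thesis by (simp add: abs_mult algebra_simps)
    qed
    have "(if p < r \<and> q < r then b p q * x p * x q else 0) - \<eta> * (u p + u q) - c * (v p + v q)
        \<le> b p q * x p * x q" if "p \<le> s" "q \<le> s" for p q
    proof -
      note B = M[OF that]
      consider "p < r" "q < r" | "p < r" "\<not> q < r" | "\<not> p < r" "q < r" | "\<not> p < r" "\<not> q < r"
        by blast
      then show ?thesis
      proof cases
        case 1
        then show ?thesis using \<eta> by (simp add: u_def v_def)
      next
        case 2
        then show ?thesis using young[OF B, of "x p" "x q"] by (simp add: u_def v_def abs_le_iff)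
      next
        case 3
        then show ?thesis using young[OF B, of "x q" "x p"]
          by (simp add: u_def v_def abs_le_iff mult_ac)
      next
        case 4
        then show ?thesis using young'[OF B, of "x p" "x q"]
          by (simp add: u_def v_def abs_le_iff algebra_simps)
      qed
    qed
    then have "(\<Sum>p\<le>s. \<Sum>q\<le>s. (if p < r \<and> q < r then b p q * x p * x q else 0)
          - \<eta> * (u p + u q) - c * (v p + v q)) \<le> (\<Sum>p\<le>s. \<Sum>q\<le>s. b p q * x p * x q)"
      by (intro sum_mono) auto
    also have "(\<Sum>p\<le>s. \<Sum>q\<le>s. (if p < r \<and> q < r then b p q * x p * x q else 0)
          - \<eta> * (u p + u q) - c * (v p + v q)) =
        (\<Sum>p\<le>s. \<Sum>q\<le>s. if p < r \<and> q < r then b p q * x p * x q else 0)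
          - \<eta> * (2 * (real s + 1) * sum u {..s}) - c * (2 * (real s + 1) * sum v {..s})"
    proof -
      have double: "(\<Sum>p\<le>s. \<Sum>q\<le>s. f p + f q) = 2 * (real s + 1) * sum f {..s}"
        for f :: "nat \<Rightarrow> real"
        by (simp add: sum.distrib sum_distrib_left algebra_simps)
      show ?thesis
        by (simp only: sum_subtractf sum_distrib_left[symmetric] double)
    qed
    also have "(\<Sum>p\<le>s. \<Sum>q\<le>s. if p < r \<and> q < r then b p q * x p * x q else 0) =
        (\<Sum>p<r. \<Sum>q<r. b p q * x p * x q)"
    proof -
      have "(\<Sum>p\<le>s. \<Sum>q\<le>s. if p < r \<and> q < r then b p q * x p * x q else 0) =
          (\<Sum>p\<le>s. if p < r then (\<Sum>q\<le>s. if q < r then b p q * x p * x q else 0) else 0)"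
        by (intro sum.cong refl) auto
      also have "\<dots> = (\<Sum>p<r. \<Sum>q<r. b p q * x p * x q)"
      proof -
        have restrict: "(\<Sum>p\<le>s. if p < r then f p else 0) = sum f {..<r}" for f :: "nat \<Rightarrow> real"
        proof -
          have "{..s} \<inter> {p. p < r} = {..<r}" using r by auto
          then show ?thesis by (simp add: sum.If_cases)
        qed
        show ?thesis by (simp only: restrict)
      qed
      finally show ?thesis .
    qed
    finally have main: "(\<Sum>p<r. \<Sum>q<r. b p q * x p * x q)
        - \<eta> * (2 * (real s + 1) * sum u {..s}) - c * (2 * (real s + 1) * sum v {..s})
        \<le> (\<Sum>p\<le>s. \<Sum>q\<le>s. b p q * x p * x q)" .
    have su: "sum u {..s} = (\<Sum>p<r. (x p)\<^sup>2)"
    proof -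
      have "{..s} \<inter> {p. p < r} = {..<r}" using r by auto
      then show ?thesis by (simp add: u_def sum.If_cases)
    qed
    have sv: "sum v {..s} = (\<Sum>q\<in>{r..s}. (x q)\<^sup>2)"
    proof -
      have "{..s} \<inter> - {p. p < r} = {r..s}" by auto
      then show ?thesis by (simp add: v_def sum.If_cases)
    qed
    have "\<eta> * (2 * (real s + 1) * sum u {..s}) = \<epsilon> * sum u {..s}"
      by (simp add: \<eta>_def field_simps)
    moreover have "\<epsilon> * sum u {..s} \<le> (\<Sum>p<r. \<Sum>q<r. b p q * x p * x q)"
      using \<epsilon>(2)[of x] by (simp only: su)
    ultimately have "- (c * (2 * (real s + 1) * sum v {..s})) \<le> (\<Sum>p\<le>s. \<Sum>q\<le>s. b p q * x p * x q)"
      using main by linarith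
    then show ?thesis
      by (simp add: sv mult_ac)
  qed
  moreover have "2 * (real s + 1) * c \<ge> 0" using c(3) by simp
  ultimately show ?thesis by blast
qed


section \<open>The matrix transferring process as summation by parts in time\<close>

lemma transfer_a_sym: "transfer_a s \<alpha> l p q = transfer_a s \<alpha> l q p"
  by (cases l) (simp_all add: Let_def max.commute min.commute add.commute mult.commute)

lemma transfer_b_sym: "transfer_b s \<alpha> l p q = transfer_b s \<alpha> l q p"
  by (cases l) (simp_all add: Let_def max.commute min.commute)

lemma transfer_a_outside: "s < p \<or> s < q \<Longrightarrow> transfer_a s \<alpha> l p q = 0"
  by (cases l) (auto simp: Let_def max_def)

lemma transfer_a_done: "min p q < l \<Longrightarrow> transfer_a s \<alpha> l p q = 0"
  by (cases l) (auto simp: Let_def)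

lemma transfer_b_pending: "l \<le> min p q \<Longrightarrow> transfer_b s \<alpha> l p q = 0"
  by (induction l arbitrary: p q) (auto simp: Let_def min_def max_def)

text \<open>The case distinction of the process as a single correction formula: column \<open>m\<close> is cleared and, shifted
  up by one row, subtracted from column \<open>m + 1\<close>. An entry that arrives on the diagonal counts twice since the two
  symmetric entries it stands for meet there. The cases \<open>p < s\<close> and \<open>p = s\<close> agree because row \<open>s + 1\<close>
  is zero.\<close>

lemma transfer_a_Suc_diff:
  assumes pq: "p \<le> s" "q \<le> s" and diag: "transfer_a s \<alpha> m m m = 0"
  shows "transfer_a s \<alpha> (Suc m) p q = transfer_a s \<alpha> m p q
    - (if min p q = m then transfer_a s \<alpha> m (max p q) m else 0)
    - (if min p q = Suc m
       then (if p = q then 2 else 1) * transfer_a s \<alpha> m (Suc (max p q)) m else 0)"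
proof -
  let ?a = "transfer_a s \<alpha>"
  have *: "?a (Suc m) p q = ?a m p q
    - (if q = m then ?a m p m else 0)
    - (if q = Suc m then (if p = q then 2 else 1) * ?a m (Suc p) m else 0)"
    if "p \<le> s" "q \<le> p" for p q
  proof -
    note le = that
    have mm: "max p q = p" "min p q = q" using that by auto
    consider "q < m" | "q = m" | "q = Suc m" | "q > Suc m"
      by linarith
    then show ?thesis
    proof cases
      case 1
      then show ?thesis using that mm transfer_a_done[of p q m] transfer_a_done[of p q "Suc m"] by simp
    next
      case 2
      then show ?thesis using that mm transfer_a_done[of p q "Suc m"] by simp
    next
      case 3
      note q = 3
      consider "p = q" | "p > q" "p < s" | "p > q" "p = s"
        using le by (metis le_neq_implies_less)
      then show ?thesis
      proof cases
        case 1
        then show ?thesis using 1 q le mm by (simp add: Let_def)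
      next
        case 2
        then have "p \<le> s - 1" by simp
        then show ?thesis using 2 q le mm by (simp add: Let_def)
      next
        case 3
        then show ?thesis using 3 q le mm by (simp add: Let_def transfer_a_outside)
      qed
    next
      case 4
      then show ?thesis using that mm by (simp add: Let_def)
    qed
  qed
  show ?thesis
  proof (cases "q \<le> p")
    case True
    then show ?thesis using *[of p q] pq by (simp add: max_absorb1 min_absorb2)
  next
    case False
    then show ?thesis using *[of q p] pq
      by (simp only: transfer_a_sym[of _ _ _ p q]) (auto simp: max_absorb2 min_absorb1)
  qed
qed

lemma transfer_b_Suc_diff:
  assumes pq: "p \<le> s" "q \<le> s"
  shows "transfer_b s \<alpha> (Suc m) p q = transfer_b s \<alpha> m p q
    + (if min p q = m then 2 * transfer_a s \<alpha> m (Suc (max p q)) m else 0)"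
proof -
  have *: "transfer_b s \<alpha> (Suc m) p q = transfer_b s \<alpha> m p q
      + (if q = m then 2 * transfer_a s \<alpha> m (Suc p) m else 0)"
    if "p \<le> s" "q \<le> p" for p q
  proof -
    have mm: "max p q = p" "min p q = q" using that by auto
    show ?thesis
    proof (cases "q = m")
      case True
      then have pend: "transfer_b s \<alpha> m p q = 0"
        using that by (intro transfer_b_pending) simp
      show ?thesis
      proof (cases "p = s")
        case True
        then show ?thesis using that mm pend \<open>q = m\<close> by (simp add: Let_def transfer_a_outside)
      next
        case False
        then have "p \<le> s - 1" using that by simp
        then show ?thesis using that mm pend \<open>q = m\<close> by (simp add: Let_def)
      qed
    next
      case False
      then show ?thesis using that mm by (simp add: Let_def)
    qed
  qed
  show ?thesis
  proof (cases "q \<le> p")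
    case True
    then show ?thesis using *[of p q] pq by (simp add: max_absorb1 min_absorb2)
  next
    case False
    then show ?thesis using *[of q p] pq
      by (simp add: transfer_b_sym[of _ _ _ p q] max_absorb2 min_absorb1)
  qed
qed

text \<open>The corrections made by one step of the process are supported on hooks \<open>min p q = m\<close>.\<close>

lemma sum_min_eq:
  fixes f :: "nat \<Rightarrow> nat \<Rightarrow> real"
  assumes sym: "\<And>p q. f p q = f q p" and m: "m \<le> s"
  shows "(\<Sum>p\<le>s. \<Sum>q\<le>s. if min p q = m then f p q else 0) = f m m + 2 * (\<Sum>p\<in>{m<..s}. f p m)"
proof -
  have "(\<Sum>p\<le>s. \<Sum>q\<le>s. if min p q = m then f p q else 0) =
    (\<Sum>p\<le>s. \<Sum>q\<le>s. (if p = m then if q = m then f m m else 0 else 0)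
      + (if q = m then if m < p then f p m else 0 else 0)
      + (if p = m then if m < q then f q m else 0 else 0))"
  proof (intro sum.cong refl)
    fix p q
    show "(if min p q = m then f p q else 0) = (if p = m then if q = m then f m m else 0 else 0)
      + (if q = m then if m < p then f p m else 0 else 0)
      + (if p = m then if m < q then f q m else 0 else 0)"
      using sym[of p q] by (cases p q rule: linorder_cases) auto
  qed
  also have "\<dots> = f m m + (\<Sum>p\<le>s. if m < p then f p m else 0) + (\<Sum>q\<le>s. if m < q then f q m else 0)"
  proof -
    have "(\<Sum>p\<le>s. \<Sum>q\<le>s. if p = m then g q else 0) = sum g {..s}" for g :: "nat \<Rightarrow> real"
      by (subst sum.swap) (simp add: m)
    then show ?thesis
      using m by (simp add: sum.distrib)
  qed
  also have "(\<Sum>p\<le>s. if m < p then f p m else 0) = (\<Sum>p\<in>{m<..s}. f p m)"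
  proof -
    have "{..s} \<inter> {p. m < p} = {m<..s}" by auto
    then show ?thesis by (simp add: sum.If_cases)
  qed
  finally show ?thesis by simp
qed

definition stage_energy :: "nat \<Rightarrow> (nat \<Rightarrow> nat \<Rightarrow> real) \<Rightarrow> (nat \<Rightarrow> nat \<Rightarrow> real) \<Rightarrow> real" where
  "stage_energy s a G = (\<Sum>p\<le>s. \<Sum>q\<le>s. a p q * G p q)"

text \<open>In column \<open>m\<close>, each \<open>G (p + 1) m\<close> is replaced by \<open>- H p m - G p (m + 1)\<close>; the first part is collected
  in the matrix of the dissipation, the second is the move to column \<open>m + 1\<close>. For \<open>p = m\<close> the two Gram
  entries coincide, so that \<open>G (m + 1) m = - H m m / 2\<close>. The diagonal entry has no partner to be
  exchanged with, which is why the process can pass only if its coefficient is zero.\<close>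

lemma transfer_step:
  assumes G: "\<And>p q. G p q = G q p" and H: "\<And>p q. H p q = H q p"
    and skew: "\<And>p q. p < s \<Longrightarrow> q < s \<Longrightarrow> G (Suc p) q + G p (Suc q) = - H p q"
    and m: "m < s" and diag: "transfer_a s \<alpha> m m m = 0"
  shows "stage_energy s (transfer_a s \<alpha> (Suc m)) G - stage_energy s (transfer_b s \<alpha> (Suc m)) H / 2
    = stage_energy s (transfer_a s \<alpha> m) G - stage_energy s (transfer_b s \<alpha> m) H / 2"
proof -
  define c where "c p = transfer_a s \<alpha> m p m" for p
  have cm: "c m = 0" using diag by (simp add: c_def)
  have cs: "c (Suc s) = 0" by (simp add: c_def transfer_a_outside)
  have "stage_energy s (transfer_a s \<alpha> (Suc m)) G = (\<Sum>p\<le>s. \<Sum>q\<le>s. transfer_a s \<alpha> m p q * G p q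
      - (if min p q = m then c (max p q) * G p q else 0)
      - (if min p q = Suc m then (if p = q then 2 else 1) * c (Suc (max p q)) * G p q else 0))"
    unfolding stage_energy_def
    by (intro sum.cong refl)
      (simp add: transfer_a_Suc_diff diag c_def algebra_simps del: transfer_a.simps)
  also have "\<dots> = stage_energy s (transfer_a s \<alpha> m) G
      - (\<Sum>p\<le>s. \<Sum>q\<le>s. if min p q = m then c (max p q) * G p q else 0)
      - (\<Sum>p\<le>s. \<Sum>q\<le>s. if min p q = Suc m
          then (if p = q then 2 else 1) * c (Suc (max p q)) * G p q else 0)"
    by (simp only: stage_energy_def sum_subtractf)
  also have "(\<Sum>p\<le>s. \<Sum>q\<le>s. if min p q = m then c (max p q) * G p q else 0)
      = 2 * (\<Sum>p\<in>{m<..s}. c p * G p m)"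
    using m by (subst sum_min_eq) (auto simp: G max.commute cm intro!: sum.cong)
  also have "(\<Sum>p\<in>{m<..s}. c p * G p m) = (\<Sum>p\<in>{m..<s}. c (Suc p) * G (Suc p) m)"
    by (rule sum.reindex_bij_witness[of _ Suc "\<lambda>p. p - 1"]) auto
  also have "\<dots> = c (Suc m) * G (Suc m) m + (\<Sum>p\<in>{m<..<s}. c (Suc p) * G (Suc p) m)"
    using m by (simp add: sum.atLeast_Suc_lessThan atLeastSucLessThan_greaterThanLessThan)
  also have "G (Suc m) m = - H m m / 2"
    using skew[of m m] m G[of m "Suc m"] by simp
  also have "(\<Sum>p\<in>{m<..<s}. c (Suc p) * G (Suc p) m) =
      (\<Sum>p\<in>{m<..<s}. - (c (Suc p) * H p m) - c (Suc p) * G p (Suc m))"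
  proof (intro sum.cong refl)
    fix p assume "p \<in> {m<..<s}"
    then have "G (Suc p) m = - H p m - G p (Suc m)"
      using skew[of p m] m by simp
    then show "c (Suc p) * G (Suc p) m = - (c (Suc p) * H p m) - c (Suc p) * G p (Suc m)"
      by (simp only: right_diff_distrib mult_minus_right)
  qed
  also have "\<dots> = - (\<Sum>p\<in>{m<..<s}. c (Suc p) * H p m) - (\<Sum>p\<in>{m<..<s}. c (Suc p) * G p (Suc m))"
    by (simp only: sum_subtractf sum_negf)
  also have "(\<Sum>p\<in>{m<..<s}. c (Suc p) * G p (Suc m)) = (\<Sum>p\<in>{Suc m..s}. c (Suc p) * G p (Suc m))"
    using cs by (intro sum.mono_neutral_left) (auto simp: le_less Suc_le_eq)
  also have "(\<Sum>p\<in>{m<..<s}. c (Suc p) * H p m) = (\<Sum>p\<in>{m<..s}. c (Suc p) * H p m)"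
    using cs by (intro sum.mono_neutral_left) (auto simp: le_less Suc_le_eq)
  also have "(\<Sum>p\<le>s. \<Sum>q\<le>s. if min p q = Suc m
        then (if p = q then 2 else 1) * c (Suc (max p q)) * G p q else 0)
      = 2 * (\<Sum>p\<in>{Suc m..s}. c (Suc p) * G p (Suc m))"
  proof -
    have "(\<Sum>p\<in>{Suc m..s}. c (Suc p) * G p (Suc m)) = c (Suc (Suc m)) * G (Suc m) (Suc m)
        + (\<Sum>p\<in>{Suc m<..s}. c (Suc p) * G p (Suc m))"
      using m by (simp add: sum.head)
    moreover have "(\<Sum>p\<in>{Suc m<..s}. (if p = Suc m then 2 else 1) * c (Suc (max p (Suc m))) * G p (Suc m))
       = (\<Sum>p\<in>{Suc m<..s}. c (Suc p) * G p (Suc m))"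
      by (intro sum.cong) auto
    ultimately show ?thesis
      using m by (subst sum_min_eq) (auto simp: G max.commute)
  qed
  finally have A: "stage_energy s (transfer_a s \<alpha> (Suc m)) G = stage_energy s (transfer_a s \<alpha> m) G
      + c (Suc m) * H m m + 2 * (\<Sum>p\<in>{m<..s}. c (Suc p) * H p m)"
    by (simp add: algebra_simps)
  have "stage_energy s (transfer_b s \<alpha> (Suc m)) H = (\<Sum>p\<le>s. \<Sum>q\<le>s. transfer_b s \<alpha> m p q * H p q
      + (if min p q = m then 2 * c (Suc (max p q)) * H p q else 0))"
    unfolding stage_energy_def
    by (intro sum.cong refl)
      (simp add: transfer_b_Suc_diff c_def algebra_simps del: transfer_b.simps transfer_a.simps)
  also have "\<dots> = stage_energy s (transfer_b s \<alpha> m) H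
      + (\<Sum>p\<le>s. \<Sum>q\<le>s. if min p q = m then 2 * c (Suc (max p q)) * H p q else 0)"
    by (simp only: stage_energy_def sum.distrib)
  also have "(\<Sum>p\<le>s. \<Sum>q\<le>s. if min p q = m then 2 * c (Suc (max p q)) * H p q else 0) =
      2 * c (Suc m) * H m m + 2 * (2 * (\<Sum>p\<in>{m<..s}. c (Suc p) * H p m))"
    using m by (subst sum_min_eq) (auto simp: H max.commute sum_distrib_left mult.assoc intro!: sum.cong)
  finally show ?thesis
    using A by (simp add: sum_distrib_left[symmetric] mult.assoc field_simps del: transfer_a.simps transfer_b.simps)
qed

lemma transfer_identity:
  assumes G: "\<And>p q. G p q = G q p" and H: "\<And>p q. H p q = H q p"
    and skew: "\<And>p q. p < s \<Longrightarrow> q < s \<Longrightarrow> G (Suc p) q + G p (Suc q) = - H p q"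
    and diag: "\<And>m. m < l \<Longrightarrow> transfer_a s \<alpha> m m m = 0" and l: "l \<le> s"
  shows "stage_energy s (transfer_a s \<alpha> 0) G =
    stage_energy s (transfer_a s \<alpha> l) G - stage_energy s (transfer_b s \<alpha> l) H / 2"
  using diag l
proof (induction l)
  case 0
  then show ?case by (simp add: stage_energy_def)
next
  case (Suc l)
  have "l < s" "transfer_a s \<alpha> l l l = 0"
    using Suc.prems by auto
  from transfer_step[where G = G and H = H, OF G H skew this]
  show ?case
    using Suc by simp
qed


section \<open>The energy estimate for one time step\<close>

text \<open>What the energy argument uses about the Gram matrix of the temporal differences: it is positive
  semidefinite in the sense of Cauchy--Schwarz, successive differences shrink by the factor \<open>K * \<mu>\<close>,
  where \<open>\<mu>\<close> is the CFL number, and raising one of two orders is antisymmetric up to a sum over mesh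
  interfaces of products of jumps \<open>J i p\<close>, which are themselves controlled by the Gram matrix.\<close>

definition stage_gram :: "nat \<Rightarrow> real \<Rightarrow> real \<Rightarrow> real \<Rightarrow> (nat \<Rightarrow> nat \<Rightarrow> real) \<Rightarrow> bool" where
  "stage_gram s K \<tau> \<mu> G \<longleftrightarrow>
     0 \<le> \<tau> \<and> 0 \<le> \<mu> \<and> \<mu> \<le> 1 \<and>
     (\<forall>p q. G p q = G q p) \<and> (\<forall>p. 0 \<le> G p p) \<and> (\<forall>p q. (G p q)\<^sup>2 \<le> G p p * G q q) \<and>
     (\<forall>p<s. G (Suc p) (Suc p) \<le> (K * \<mu>)\<^sup>2 * G p p) \<and>
     (\<exists>(I :: nat set) J. finite I \<and>
        (\<forall>p<s. \<forall>q<s. G (Suc p) q + G p (Suc q) = - \<tau> * (\<Sum>i\<in>I. J i p * J i q)) \<and>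
        (\<forall>p\<le>s. \<tau> * (\<Sum>i\<in>I. (J i p)\<^sup>2) \<le> K * \<mu> * G p p))"

lemma stage_gram_decay:
  assumes gram: "stage_gram s K \<tau> \<mu> G" and "r \<le> p" "p \<le> s"
  shows "G p p \<le> (K * \<mu>) ^ (2 * (p - r)) * G r r"
  using assms(2,3)
proof (induction p rule: dec_induct)
  case (step p)
  have "G (Suc p) (Suc p) \<le> (K * \<mu>)\<^sup>2 * G p p"
    using gram step by (simp add: stage_gram_def)
  also have "\<dots> \<le> (K * \<mu>)\<^sup>2 * ((K * \<mu>) ^ (2 * (p - r)) * G r r)"
    using step by (intro mult_left_mono) auto
  also have "\<dots> = (K * \<mu>) ^ (2 * (Suc p - r)) * G r r"
    using step by (simp add: Suc_diff_le power_add power2_eq_square mult.assoc)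
  finally show ?case .
qed simp

lemma stage_gram_bound:
  assumes gram: "stage_gram s K \<tau> \<mu> G" and K: "1 \<le> K" and r: "r \<le> p" "p \<le> s"
  shows "G p p \<le> K ^ (2 * s) * G r r"
    and "r < p \<Longrightarrow> G p p \<le> \<mu>\<^sup>2 * (K ^ (2 * s) * G r r)"
proof -
  have l: "0 \<le> \<mu>" "\<mu> \<le> 1" and G: "0 \<le> G r r" using gram by (auto simp: stage_gram_def)
  have Kp: "K ^ (2 * (p - r)) \<le> K ^ (2 * s)" using K r by (intro power_increasing) auto
  have dec: "G p p \<le> \<mu> ^ (2 * (p - r)) * (K ^ (2 * (p - r)) * G r r)"
    using stage_gram_decay[OF gram r] by (simp add: power_mult_distrib mult_ac)
  also have "\<dots> \<le> \<mu> ^ (2 * (p - r)) * (K ^ (2 * s) * G r r)"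
    using Kp G l by (intro mult_left_mono mult_right_mono) auto
  finally have main: "G p p \<le> \<mu> ^ (2 * (p - r)) * (K ^ (2 * s) * G r r)" .
  have KG: "0 \<le> K ^ (2 * s) * G r r" using K G by simp
  have "\<mu> ^ (2 * (p - r)) * (K ^ (2 * s) * G r r) \<le> 1 * (K ^ (2 * s) * G r r)"
    using l KG by (intro mult_right_mono power_le_one) auto
  then show "G p p \<le> K ^ (2 * s) * G r r" using main by simp
  assume "r < p"
  then have "\<mu> ^ (2 * (p - r)) \<le> \<mu>\<^sup>2"
    using l by (intro power_decreasing) auto
  then show "G p p \<le> \<mu>\<^sup>2 * (K ^ (2 * s) * G r r)"
    using main KG by (meson mult_right_mono order_trans)
qed

text \<open>Apart from the entry \<open>(z, z)\<close>, every nonzero coefficient multiplies an inner product with a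
  temporal difference of order greater than \<open>z\<close>, which is smaller by a factor \<open>\<mu>\<close>.\<close>

lemma energy_remainder:
  assumes K: "1 \<le> K" and z: "z \<le> s" and a: "\<And>p q. min p q < z \<Longrightarrow> a p q = 0"
  shows "\<exists>C\<ge>0. \<forall>\<tau> \<mu> G. stage_gram s K \<tau> \<mu> G \<longrightarrow>
    stage_energy s a G \<le> a z z * G z z + C * \<mu> * G z z"
proof -
  define M where "M = K ^ (2 * s)"
  define C where "C = (\<Sum>p\<le>s. \<Sum>q\<le>s. \<bar>a p q\<bar>) * M"
  have M: "1 \<le> M" using K by (simp add: M_def)
  have "stage_energy s a G \<le> a z z * G z z + C * \<mu> * G z z"
    if gram: "stage_gram s K \<tau> \<mu> G" for \<tau> \<mu> G
  proof -
    have l: "0 \<le> \<mu>" "\<mu> \<le> 1" and G0: "\<And>p. 0 \<le> G p p" and CS: "\<And>p q. (G p q)\<^sup>2 \<le> G p p * G q q"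
      using gram by (auto simp: stage_gram_def)
    have off: "\<bar>G p q\<bar> \<le> \<mu> * M * G z z"
      if "p \<le> s" "q \<le> s" "z \<le> p" "z \<le> q" "p \<noteq> z \<or> q \<noteq> z" for p q
    proof -
      have b1: "G r r \<le> M * G z z" "z < r \<Longrightarrow> G r r \<le> \<mu>\<^sup>2 * (M * G z z)" if "r \<le> s" "z \<le> r" for r
        using stage_gram_bound[OF gram K that(2,1)] by (simp_all add: M_def)
      have MG: "0 \<le> M * G z z" using M G0 by simp
      have "G p p * G q q \<le> \<mu>\<^sup>2 * (M * G z z) * (M * G z z)"
      proof (cases "z < p")
        case True
        then show ?thesis using b1[of p] b1[of q] that G0 MG by (intro mult_mono) auto
      next
        case False
        then have "z < q" using that by auto
        then have "G q q * G p p \<le> \<mu>\<^sup>2 * (M * G z z) * (M * G z z)"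
          using b1[of p] b1[of q] that G0 MG by (intro mult_mono) auto
        then show ?thesis by (simp add: mult.commute)
      qed
      also have "\<dots> = (\<mu> * M * G z z)\<^sup>2" by (simp add: power2_eq_square mult_ac)
      finally have "(G p q)\<^sup>2 \<le> (\<mu> * M * G z z)\<^sup>2" using CS[of p q] by linarith
      then show ?thesis
        using l M G0 by (simp add: abs_le_square_iff[symmetric])
    qed
    have "stage_energy s a G \<le>
      (\<Sum>p\<le>s. \<Sum>q\<le>s. (if p = z then if q = z then a z z * G z z else 0 else 0) + \<bar>a p q\<bar> * (\<mu> * M * G z z))"
      unfolding stage_energy_def
    proof (intro sum_mono)
      fix p q assume pq: "p \<in> {..s}" "q \<in> {..s}"
      have nn: "0 \<le> \<bar>a p q\<bar> * (\<mu> * M * G z z)"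
        using l M G0 by (intro mult_nonneg_nonneg) auto
      show "a p q * G p q \<le> (if p = z then if q = z then a z z * G z z else 0 else 0)
          + \<bar>a p q\<bar> * (\<mu> * M * G z z)"
      proof (cases "p = z \<and> q = z")
        case True
        then show ?thesis using nn by simp
      next
        case False
        have "a p q * G p q \<le> \<bar>a p q\<bar> * (\<mu> * M * G z z)"
        proof (cases "z \<le> p \<and> z \<le> q")
          case True
          then have "\<bar>a p q\<bar> * \<bar>G p q\<bar> \<le> \<bar>a p q\<bar> * (\<mu> * M * G z z)"
            using off[of p q] pq False by (intro mult_left_mono) auto
          then show ?thesis by (metis abs_ge_self abs_mult order_trans)
        next
          case False
          then have "a p q = 0" by (intro a) auto
          then show ?thesis by simp
        qed
        then show ?thesis using False by auto
      qed
    qed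
    also have "\<dots> = a z z * G z z + C * \<mu> * G z z"
    proof -
      have "(\<Sum>p\<le>s. \<Sum>q\<le>s. if p = z then if q = z then a z z * G z z else 0 else 0)
          = (\<Sum>p\<le>s. if p = z then \<Sum>q\<le>s. if q = z then a z z * G z z else 0 else 0)"
        by (intro sum.cong refl) auto
      then show ?thesis
        using z by (simp add: sum.distrib C_def sum_distrib_right sum_distrib_left mult_ac)
    qed
    finally show ?thesis .
  qed
  moreover have "0 \<le> C" using M by (auto simp: C_def intro!: mult_nonneg_nonneg sum_nonneg)
  ultimately show ?thesis by blast
qed

text \<open>The dissipation is a sum over the interfaces of the form \<open>b\<close> in the jumps at one interface, so the
  bound for real variables applies interface by interface.\<close>

lemma dissipation_lower_bound:
  assumes K: "1 \<le> K" and sym: "\<And>p q. b p q = b q p" and r: "r \<le> s"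
    and minors: "\<And>m. m < r \<Longrightarrow>
      Determinant.det (Matrix.mat (m + 1) (m + 1) (\<lambda>(p, q). b p q)) > 0"
  shows "\<exists>C\<ge>0. \<forall>\<tau> \<mu> G. \<forall>(I :: nat set) J. stage_gram s K \<tau> \<mu> G \<and> finite I \<and>
      (\<forall>p\<le>s. \<tau> * (\<Sum>i\<in>I. (J i p)\<^sup>2) \<le> K * \<mu> * G p p) \<longrightarrow>
    - C * \<mu> * G r r \<le> stage_energy s b (\<lambda>p q. \<tau> * (\<Sum>i\<in>I. J i p * J i q))"
proof -
  obtain c where c: "c \<ge> 0"
    "\<And>x. (\<Sum>p\<le>s. \<Sum>q\<le>s. b p q * x p * x q) \<ge> - c * (\<Sum>q\<in>{r..s}. (x q)\<^sup>2)"
    using form_lower_bound[OF sym _ minors, of r s] r by auto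
  define C where "C = c * K * K ^ (2 * s) * real (card {r..s})"
  have "- C * \<mu> * G r r \<le> stage_energy s b (\<lambda>p q. \<tau> * (\<Sum>i\<in>I. J i p * J i q))"
    if gram: "stage_gram s K \<tau> \<mu> G" and I: "finite (I :: nat set)"
      and J: "\<And>p. p \<le> s \<Longrightarrow> \<tau> * (\<Sum>i\<in>I. (J i p)\<^sup>2) \<le> K * \<mu> * G p p" for \<tau> \<mu> G I J
  proof -
    have l: "0 \<le> \<mu>" "0 \<le> \<tau>" using gram by (auto simp: stage_gram_def)
    have "stage_energy s b (\<lambda>p q. \<tau> * (\<Sum>i\<in>I. J i p * J i q)) =
        (\<Sum>p\<le>s. \<Sum>q\<le>s. \<Sum>i\<in>I. \<tau> * (b p q * J i p * J i q))"
      by (simp add: stage_energy_def sum_distrib_left mult_ac)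
    also have "\<dots> = (\<Sum>p\<le>s. \<Sum>i\<in>I. \<Sum>q\<le>s. \<tau> * (b p q * J i p * J i q))"
      by (intro sum.cong refl sum.swap)
    also have "\<dots> = \<tau> * (\<Sum>i\<in>I. \<Sum>p\<le>s. \<Sum>q\<le>s. b p q * J i p * J i q)"
      by (subst sum.swap) (simp add: sum_distrib_left)
    also have "\<dots> \<ge> \<tau> * (\<Sum>i\<in>I. - c * (\<Sum>q\<in>{r..s}. (J i q)\<^sup>2))"
      using c(2) l by (intro mult_left_mono sum_mono) auto
    also have "\<tau> * (\<Sum>i\<in>I. - c * (\<Sum>q\<in>{r..s}. (J i q)\<^sup>2)) =
        - c * (\<tau> * (\<Sum>i\<in>I. \<Sum>q\<in>{r..s}. (J i q)\<^sup>2))"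
      by (simp only: sum_distrib_left[symmetric]) simp
    also have "(\<Sum>i\<in>I. \<Sum>q\<in>{r..s}. (J i q)\<^sup>2) = (\<Sum>q\<in>{r..s}. \<Sum>i\<in>I. (J i q)\<^sup>2)"
      by (rule sum.swap)
    also have "\<tau> * \<dots> = (\<Sum>q\<in>{r..s}. \<tau> * (\<Sum>i\<in>I. (J i q)\<^sup>2))"
      by (rule sum_distrib_left)
    finally have *: "- c * (\<Sum>q\<in>{r..s}. \<tau> * (\<Sum>i\<in>I. (J i q)\<^sup>2))
        \<le> stage_energy s b (\<lambda>p q. \<tau> * (\<Sum>i\<in>I. J i p * J i q))" .
    have "(\<Sum>q\<in>{r..s}. \<tau> * (\<Sum>i\<in>I. (J i q)\<^sup>2)) \<le> (\<Sum>q\<in>{r..s}. K * \<mu> * (K ^ (2 * s) * G r r))"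
    proof (intro sum_mono)
      fix q assume q: "q \<in> {r..s}"
      have "\<tau> * (\<Sum>i\<in>I. (J i q)\<^sup>2) \<le> K * \<mu> * G q q" using q by (intro J) auto
      also have "\<dots> \<le> K * \<mu> * (K ^ (2 * s) * G r r)"
        using q l K by (intro mult_left_mono stage_gram_bound(1)[OF gram K]) auto
      finally show "\<tau> * (\<Sum>i\<in>I. (J i q)\<^sup>2) \<le> K * \<mu> * (K ^ (2 * s) * G r r)" .
    qed
    then have "c * (\<Sum>q\<in>{r..s}. \<tau> * (\<Sum>i\<in>I. (J i q)\<^sup>2)) \<le> c * (\<Sum>q\<in>{r..s}. K * \<mu> * (K ^ (2 * s) * G r r))"
      by (intro mult_left_mono c(1))
    also have "\<dots> = C * \<mu> * G r r" by (simp add: C_def mult_ac)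
    finally show ?thesis using * by simp
  qed
  moreover have "0 \<le> C" using c(1) K by (simp add: C_def)
  ultimately show ?thesis by blast
qed

text \<open>Here \<open>z\<close> and \<open>r\<close> are the termination and the contribution index. That the entry \<open>(z, z)\<close> is nonzero
  ensures that the least index in the definition of the termination index exists and is at most \<open>s\<close>, and
  minimality makes all earlier diagonal entries vanish, as \<open>transfer_identity\<close> requires.\<close>

lemma energy_increment:
  assumes K: "1 \<le> K" and nz: "transfer_a s \<alpha> z z z \<noteq> 0"
    and z: "z = termination_index s \<alpha>" and r: "r = contribution_index s \<alpha>"
  shows "\<exists>C>0. \<forall>\<tau> \<mu> G. stage_gram s K \<tau> \<mu> G \<longrightarrow>
    stage_energy s (transfer_a s \<alpha> 0) G \<le>
      transfer_a s \<alpha> z z z * G z z + C * \<mu> * G z z + C * \<mu> * G r r"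
    and "z \<le> s" and "r \<le> z"
proof -
  have zs: "z \<le> s"
    using nz transfer_a_outside[of s z z \<alpha> z] by force
  have diag: "transfer_a s \<alpha> m m m = 0" if "m < z" for m
  proof (cases "m = 0")
    case False
    then show ?thesis
      using not_less_Least[of m "\<lambda>l. 1 \<le> l \<and> transfer_a s \<alpha> l l l \<noteq> 0"] that
      by (simp add: z termination_index_def)
  qed simp
  have rz: "r \<le> z"
    proof (cases "\<exists>\<kappa><termination_index s \<alpha>. leading_minor s \<alpha> \<kappa> \<le> 0")
      case True
      then show ?thesis
        using LeastI_ex[OF True] by (simp add: r z contribution_index_def Let_def)
    qed (auto simp: r z contribution_index_def Let_def)
    have minors: "leading_minor s \<alpha> m > 0" if "m < r" for m
    proof (rule ccontr)
      assume neg: "\<not> 0 < leading_minor s \<alpha> m"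
      have "m < z" using that rz by simp
      then have P: "m < termination_index s \<alpha> \<and> leading_minor s \<alpha> m \<le> 0" using neg z by auto
      then have "r = (LEAST \<kappa>. \<kappa> < termination_index s \<alpha> \<and> leading_minor s \<alpha> \<kappa> \<le> 0)"
        unfolding r contribution_index_def Let_def by auto
      then show False
        using not_less_Least that P by blast
    qed
  show "z \<le> s" "r \<le> z" by (fact zs, fact rz)
  define b where "b = transfer_b s \<alpha> z"
  have bsym: "b p q = b q p" for p q unfolding b_def by (rule transfer_b_sym)
  have "\<exists>C\<ge>0. \<forall>\<tau> \<mu> G. stage_gram s K \<tau> \<mu> G \<longrightarrow>
      stage_energy s (transfer_a s \<alpha> z) G \<le> transfer_a s \<alpha> z z z * G z z + C * \<mu> * G z z"
    by (rule energy_remainder[OF K zs]) (rule transfer_a_done)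
  then obtain C1 where C1: "C1 \<ge> 0" "\<forall>\<tau> \<mu> G. stage_gram s K \<tau> \<mu> G \<longrightarrow>
      stage_energy s (transfer_a s \<alpha> z) G \<le> transfer_a s \<alpha> z z z * G z z + C1 * \<mu> * G z z"
    by (elim exE conjE)
  have "\<exists>C\<ge>0. \<forall>\<tau> \<mu> G. \<forall>(I :: nat set) J. stage_gram s K \<tau> \<mu> G \<and> finite I \<and>
      (\<forall>p\<le>s. \<tau> * (\<Sum>i\<in>I. (J i p)\<^sup>2) \<le> K * \<mu> * G p p) \<longrightarrow>
      - C * \<mu> * G r r \<le> stage_energy s b (\<lambda>p q. \<tau> * (\<Sum>i\<in>I. J i p * J i q))"
  proof (rule dissipation_lower_bound[OF K bsym])
    show "r \<le> s" using rz zs by simp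
    show "0 < Determinant.det (Matrix.mat (m + 1) (m + 1) (\<lambda>(p, q). b p q))" if "m < r" for m
      using minors[OF that] by (simp add: leading_minor_def b_def z)
  qed
  then obtain C2 where C2: "C2 \<ge> 0" "\<forall>\<tau> \<mu> G. \<forall>(I :: nat set) J. stage_gram s K \<tau> \<mu> G \<and> finite I \<and>
      (\<forall>p\<le>s. \<tau> * (\<Sum>i\<in>I. (J i p)\<^sup>2) \<le> K * \<mu> * G p p) \<longrightarrow>
      - C2 * \<mu> * G r r \<le> stage_energy s b (\<lambda>p q. \<tau> * (\<Sum>i\<in>I. J i p * J i q))"
    by (elim exE conjE)
  define C where "C = C1 + C2 + 1"
  have C: "C > 0" "C1 \<le> C" "C2 / 2 \<le> C" using C1(1) C2(1) by (auto simp: C_def)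
  have "stage_energy s (transfer_a s \<alpha> 0) G \<le>
      transfer_a s \<alpha> z z z * G z z + C * \<mu> * G z z + C * \<mu> * G r r"
    if gram: "stage_gram s K \<tau> \<mu> G" for \<tau> \<mu> G
  proof -
    have l: "0 \<le> \<mu>" and G0: "\<And>p. 0 \<le> G p p" and sym: "\<And>p q. G p q = G q p"
      using gram by (simp_all add: stage_gram_def)
    from gram obtain I :: "nat set" and J where J: "finite I"
      "\<forall>p<s. \<forall>q<s. G (Suc p) q + G p (Suc q) = - \<tau> * (\<Sum>i\<in>I. J i p * J i q)"
      "\<forall>p\<le>s. \<tau> * (\<Sum>i\<in>I. (J i p)\<^sup>2) \<le> K * \<mu> * G p p"
      unfolding stage_gram_def by (elim exE conjE)
    define H where "H p q = \<tau> * (\<Sum>i\<in>I. J i p * J i q)" for p q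
    have Hsym: "H p q = H q p" for p q by (simp add: H_def mult.commute)
    have "stage_energy s (transfer_a s \<alpha> 0) G =
        stage_energy s (transfer_a s \<alpha> z) G - stage_energy s b H / 2"
      unfolding b_def
      by (rule transfer_identity[OF sym Hsym _ diag zs]) (use J(2) in \<open>simp add: H_def\<close>)
    moreover have "- C2 * \<mu> * G r r \<le> stage_energy s b H"
      unfolding H_def[abs_def] using C2(2) gram J(1,3) by blast
    moreover have "C1 * \<mu> * G z z \<le> C * \<mu> * G z z"
      using C l G0 by (intro mult_right_mono) auto
    moreover have "C2 / 2 * \<mu> * G r r \<le> C * \<mu> * G r r"
      using C l G0 by (intro mult_right_mono) auto
    ultimately show ?thesis using C1(2)[rule_format, OF gram] by simp
  qed
  then show "\<exists>C>0. \<forall>\<tau> \<mu> G. stage_gram s K \<tau> \<mu> G \<longrightarrow>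
    stage_energy s (transfer_a s \<alpha> 0) G \<le>
      transfer_a s \<alpha> z z z * G z z + C * \<mu> * G z z + C * \<mu> * G r r"
    using C(1) by blast
qed


section \<open>Legendre polynomials and quadrature\<close>

definition ref_integral :: "real poly \<Rightarrow> real" where
  "ref_integral p = integral {-1..1} (poly p)"

lemma poly_integrable [simp]: "poly (p :: real poly) integrable_on {a..b}"
  by (intro integrable_continuous_real continuous_intros)

lemma integral_poly_pderiv:
  assumes "a \<le> b"
  shows "integral {a..b} (poly (pderiv p)) = poly p b - poly (p :: real poly) a"
proof (intro integral_unique fundamental_theorem_of_calculus assms)
  show "(poly p has_vector_derivative poly (pderiv p) x) (at x within {a..b})" for x
    using poly_DERIV[of p x]
    by (simp add: has_real_derivative_iff_has_vector_derivative has_vector_derivative_at_within)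
qed

lemma ref_integral_add: "ref_integral (p + q) = ref_integral p + ref_integral q"
  unfolding ref_integral_def poly_add by (rule Henstock_Kurzweil_Integration.integral_add) auto

lemma ref_integral_diff: "ref_integral (p - q) = ref_integral p - ref_integral q"
  unfolding ref_integral_def poly_diff by (rule Henstock_Kurzweil_Integration.integral_diff) auto

lemma ref_integral_smult: "ref_integral (Polynomial.smult c p) = c * ref_integral p"
proof -
  have "poly (Polynomial.smult c p) = (\<lambda>x. c * poly p x)" by auto
  then show ?thesis by (simp add: ref_integral_def)
qed

lemma ref_integral_0 [simp]: "ref_integral 0 = 0"
  using ref_integral_smult[of 0 0] by simp

lemma ref_integral_sum: "ref_integral (sum f A) = (\<Sum>i\<in>A. ref_integral (f i))"
  by (induction A rule: infinite_finite_induct) (simp_all add: ref_integral_add)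

lemma ref_integral_pderiv: "ref_integral (pderiv p) = poly p 1 - poly p (-1)"
  unfolding ref_integral_def by (rule integral_poly_pderiv) simp

lemma ref_integral_square_nonneg: "0 \<le> ref_integral (p * p)"
  unfolding ref_integral_def by (rule Henstock_Kurzweil_Integration.integral_nonneg) auto

lemma ref_integral_square_pos:
  assumes "p \<noteq> 0"
  shows "0 < ref_integral (p * p)"
proof -
  have "ref_integral (p * p) \<noteq> 0"
  proof
    assume "ref_integral (p * p) = 0"
    then have "\<forall>x\<in>{-1..1}. poly (p * p) x = 0"
      unfolding ref_integral_def
      by (subst (asm) integral_eq_0_iff) (auto intro!: continuous_intros)
    then have "{-1..1} \<subseteq> {x. poly p x = 0}" by auto
    then have "finite {-1..1::real}"
      using poly_roots_finite[OF assms] finite_subset by blast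
    then show False using infinite_Icc[of "-1" "1 :: real"] by simp
  qed
  then show ?thesis using ref_integral_square_nonneg[of p] by simp
qed

text \<open>For \<open>q = x\<^sup>2 - 1\<close> this makes the derivatives in Rodrigues' formula of order less than \<open>m\<close> vanish at
  both end points, so that no boundary terms occur in the integrations by parts below.\<close>

lemma power_dvd_higher_pderiv:
  fixes q :: "real poly"
  assumes "j \<le> m"
  shows "q ^ (m - j) dvd (pderiv ^^ j) (q ^ m)"
  using assms
proof (induction j)
  case (Suc j)
  then obtain r where r: "(pderiv ^^ j) (q ^ m) = q ^ Suc (m - Suc j) * r"
    by (auto simp: Suc_diff_Suc elim: dvdE)
  have "(pderiv ^^ Suc j) (q ^ m) =
      q ^ Suc (m - Suc j) * pderiv r + r * pderiv (q ^ Suc (m - Suc j))"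
    by (simp only: funpow.simps o_apply r pderiv_mult)
  also have "q ^ (m - Suc j) dvd \<dots>"
    proof (intro dvd_add)
    show "q ^ (m - Suc j) dvd q ^ Suc (m - Suc j) * pderiv r" by simp
    show "q ^ (m - Suc j) dvd r * pderiv (q ^ Suc (m - Suc j))"
      unfolding pderiv_power_Suc by (intro dvd_mult dvd_mult2 dvd_smult) simp
  qed
  finally show ?case .
qed simp

text \<open>Each integration by parts lowers both the order of the derivative and the degree of \<open>v\<close>, until \<open>v\<close> is
  differentiated away.\<close>

lemma higher_pderiv_orthogonal:
  assumes "j \<le> m" "degree v < j"
  shows "ref_integral ((pderiv ^^ j) ([:-1, 0, 1:] ^ m) * v) = 0"
  using assms
proof (induction j arbitrary: v)
  case (Suc j)
  let ?U = "(pderiv ^^ j) ([:-1, 0, 1:] ^ m :: real poly)"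
  have "[:-1, 0, 1:] ^ (m - j) dvd ?U"
    using Suc.prems by (intro power_dvd_higher_pderiv) simp
  then have "[:-1, 0, 1:] dvd ?U"
    using Suc.prems by (metis Suc_diff_Suc Suc_le_lessD dvd_mult_left power_Suc)
  then have zero: "poly ?U 1 = 0" "poly ?U (-1) = 0"
    by (auto elim!: dvdE)
  have "(pderiv ^^ Suc j) ([:-1, 0, 1:] ^ m) * v = pderiv (?U * v) - ?U * pderiv v"
    by (simp add: pderiv_mult algebra_simps)
  then have "ref_integral ((pderiv ^^ Suc j) ([:-1, 0, 1:] ^ m) * v) = - ref_integral (?U * pderiv v)"
    by (simp only: ref_integral_diff ref_integral_pderiv poly_mult zero mult_zero_left diff_self diff_0)
  also have "\<dots> = 0"
  proof (cases "degree v = 0")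
    case True
    then have "pderiv v = 0" by (simp add: pderiv_eq_0_iff)
    then show ?thesis by simp
  next
    case False
    then show ?thesis using Suc by (simp add: degree_pderiv)
  qed
  finally show ?case .
qed simp

lemma legendre_orthogonal:
  assumes "degree v < m"
  shows "ref_integral (legendre_poly m * v) = 0"
  using higher_pderiv_orthogonal[of m m v] assms
  by (simp only: legendre_poly_def mult_smult_left ref_integral_smult)

lemma degree_legendre: "degree (legendre_poly m) = m"
proof -
  have "degree ((pderiv ^^ j) p) = degree p - j" for j and p :: "real poly"
    by (induction j) (simp_all add: degree_pderiv)
  then show ?thesis
    by (simp add: legendre_poly_def degree_power_eq)
qed

lemma legendre_nonzero: "legendre_poly m \<noteq> 0"
proof (cases m)
  case 0
  then show ?thesis by (simp add: legendre_poly_def)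
next
  case (Suc m)
  then show ?thesis using degree_legendre[of "Suc m"] by auto
qed

lemma degree_legendre_diff: "degree (legendre_poly (k + 1) - legendre_poly k) = k + 1"
  using degree_add_eq_left[of "- legendre_poly k" "legendre_poly (k + 1)"]
  by (simp add: degree_legendre)

lemma quadrature_poly_degree: "degree (quadrature_poly meth k) = card (quadrature_indices meth k)"
  by (cases meth) (simp_all add: degree_legendre degree_legendre_diff[simplified])

lemma quadrature_poly_orthogonal:
  assumes "degree v < k"
  shows "ref_integral (quadrature_poly meth k * v) = 0"
  using assms
  by (cases meth) (simp_all add: legendre_orthogonal left_diff_distrib ref_integral_diff)

definition quadrature :: "sv_method \<Rightarrow> nat \<Rightarrow> (nat \<Rightarrow> real) \<Rightarrow> real poly \<Rightarrow> real" where
  "quadrature meth k y f = (\<Sum>j\<in>quadrature_indices meth k. reference_weight meth k y j * poly f (y j))"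

lemma quadrature_add: "quadrature meth k y (f + g) = quadrature meth k y f + quadrature meth k y g"
  by (simp add: quadrature_def sum.distrib algebra_simps)

lemma quadrature_smult: "quadrature meth k y (Polynomial.smult c f) = c * quadrature meth k y f"
  by (simp add: quadrature_def sum_distrib_left mult_ac)

lemma finite_quadrature_indices [simp]: "finite (quadrature_indices meth k)"
  by (cases meth) auto

lemma reference_points_strict_mono:
  assumes y: "reference_points meth k y" and "i < j" "j \<le> k + 1"
  shows "y i < y j"
  using assms(2,3)
proof (induction j)
  case (Suc j)
  have "y j < y (Suc j)" using y Suc.prems by (simp add: reference_points_def)
  then show ?case using Suc by (cases "i = j") auto
qed simp

lemma reference_points_inj:
  assumes "reference_points meth k y"
  shows "inj_on y (quadrature_indices meth k)"
proof (rule inj_onI)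
  fix i j assume ij: "i \<in> quadrature_indices meth k" "j \<in> quadrature_indices meth k" "y i = y j"
  then have "i \<le> k + 1" "j \<le> k + 1" by (cases meth; auto)+
  then show "i = j"
    using reference_points_strict_mono[OF assms] ij(3) by (metis less_irrefl linorder_neqE_nat)
qed

lemma quadrature_interpolatory:
  assumes inj: "inj_on y (quadrature_indices meth k)"
    and deg: "degree r < card (quadrature_indices meth k)"
  shows "ref_integral r = quadrature meth k y r"
proof -
  let ?J = "quadrature_indices meth k"
  define L where "L j = (\<Prod>m\<in>?J - {j}. [:- y m / (y j - y m), 1 / (y j - y m):])" for j
  have polyL: "poly (L j) t = (\<Prod>m\<in>?J - {j}. (t - y m) / (y j - y m))" for j t
    by (simp add: L_def poly_prod diff_divide_distrib)
  have polyL': "poly (L j) = (\<lambda>t. \<Prod>m\<in>?J - {j}. (t - y m) / (y j - y m))" for j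
    using polyL by (intro ext)
  have LL: "poly (L j) (y i) = of_bool (i = j)" if "i \<in> ?J" "j \<in> ?J" for i j
  proof (cases "i = j")
    case True
    have "(y j - y m) / (y j - y m) = 1" if "m \<in> ?J - {j}" for m
      using inj_onD[OF inj, of j m] that \<open>j \<in> ?J\<close> by auto
    then show ?thesis
      using True by (simp add: polyL)
  next
    case False
    then have "i \<in> ?J - {j}" using that by simp
    then have "poly (L j) (y i) = 0"
      unfolding polyL by (intro prod_zero bexI[of _ i]) auto
    then show ?thesis using False by simp
  qed
  have degL: "degree (L j) < card ?J" if "j \<in> ?J" for j
  proof -
    have "degree (L j) \<le> sum (degree \<circ> (\<lambda>m. [:- y m / (y j - y m), 1 / (y j - y m):])) (?J - {j})"
      unfolding L_def by (intro degree_prod_sum_le) simp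
    also have "\<dots> \<le> (\<Sum>m\<in>?J - {j}. 1)" by (intro sum_mono) simp
    also have "\<dots> < card ?J"
      using card_Diff1_less[OF finite_quadrature_indices that] by simp
    finally show ?thesis .
  qed
  have "r = (\<Sum>j\<in>?J. Polynomial.smult (poly r (y j)) (L j))" (is "_ = ?s")
  proof (rule poly_eqI_degree[where A = "y ` ?J"])
    fix x assume "x \<in> y ` ?J"
    then obtain i where i: "i \<in> ?J" "x = y i" by auto
    have "poly ?s x = (\<Sum>j\<in>?J. if j = i then poly r (y j) else 0)"
      unfolding poly_sum i(2) using i(1) by (intro sum.cong refl) (auto simp: LL)
    then show "poly r x = poly ?s x" using i by simp
  next
    have card: "card (y ` ?J) = card ?J" using inj by (rule card_image)
    show "degree r < card (y ` ?J)" using deg card by simp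
    have "degree ?s \<le> card ?J - 1"
    proof (intro degree_sum_le finite_quadrature_indices)
      fix j assume "j \<in> ?J"
      then show "degree (Polynomial.smult (poly r (y j)) (L j)) \<le> card ?J - 1"
        using degL[of j] by (intro order.trans[OF degree_smult_le]) linarith
    qed
    then show "degree ?s < card (y ` ?J)" using deg card by simp
  qed
  then have "ref_integral r = ref_integral ?s" by simp
  also have "\<dots> = (\<Sum>j\<in>?J. poly r (y j) * ref_integral (L j))"
    by (simp only: ref_integral_sum ref_integral_smult)
  also have "\<dots> = quadrature meth k y r"
    unfolding quadrature_def reference_weight_def
    by (intro sum.cong refl) (simp add: ref_integral_def polyL' mult.commute)
  finally show ?thesis .
qed

lemma quadrature_at_roots:
  assumes y: "reference_points meth k y"
  shows "quadrature meth k y (quadrature_poly meth k * d) = 0"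
proof -
  have "poly (quadrature_poly meth k) (y j) = 0" if "j \<in> quadrature_indices meth k" for j
    using y that unfolding reference_points_def by blast
  then show ?thesis by (simp add: quadrature_def)
qed

text \<open>Divide \<open>f\<close> by the nodal polynomial \<open>Q\<close>. The multiple of \<open>Q\<close> integrates to zero, as the quotient has
  degree less than \<open>k\<close> and \<open>Q\<close> is orthogonal to such polynomials, and the quadrature of it is zero since
  \<open>Q\<close> vanishes at the nodes; the remainder is integrated exactly by interpolation. With \<open>n\<close> nodes this
  gives exactness up to degree \<open>2 * k - 1\<close> for Gauss and \<open>2 * k\<close> for right Radau points.\<close>

lemma quadrature_exact:
  assumes y: "reference_points meth k y" and k: "1 \<le> k"
    and deg: "degree f < card (quadrature_indices meth k) + k"
  shows "ref_integral f = quadrature meth k y f"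
proof -
  let ?Q = "quadrature_poly meth k" and ?n = "card (quadrature_indices meth k)"
  have n: "1 \<le> ?n" using k by (cases meth) auto
  have Q: "degree ?Q = ?n" by (rule quadrature_poly_degree)
  then have Q0: "?Q \<noteq> 0" using n by auto
  have f: "f = ?Q * (f div ?Q) + f mod ?Q" by simp
  have r: "degree (f mod ?Q) < ?n"
    using degree_mod_less[OF Q0, of f] n by (auto simp: Q)
  have d: "degree (f div ?Q) < k"
  proof (cases "f div ?Q = 0")
    case False
    have "degree (?Q * (f div ?Q)) = ?n + degree (f div ?Q)"
      using Q0 False by (simp add: degree_mult_eq Q)
    moreover have "degree (?Q * (f div ?Q)) < ?n + k"
    proof -
      have "?Q * (f div ?Q) = f - f mod ?Q" by (simp add: minus_mod_eq_mult_div)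
      then show ?thesis using degree_diff_le_max[of f "f mod ?Q"] deg r by simp
    qed
    ultimately show ?thesis by simp
  qed (use k in simp)
  have "ref_integral f = ref_integral (?Q * (f div ?Q)) + ref_integral (f mod ?Q)"
    by (subst f) (rule ref_integral_add)
  also have "\<dots> = quadrature meth k y (?Q * (f div ?Q)) + quadrature meth k y (f mod ?Q)"
    using quadrature_poly_orthogonal[OF d] quadrature_at_roots[OF y]
      quadrature_interpolatory[OF reference_points_inj[OF y] r] by simp
  also have "\<dots> = quadrature meth k y f"
    by (subst (3) f) (rule quadrature_add[symmetric])
  finally show ?thesis .
qed

text \<open>In degree \<open>2 * k\<close> Gauss quadrature fails only on the leading coefficient. Testing with the square of
  the Legendre polynomial, on which the quadrature is zero, shows that the defect has the sign of a
  squared norm; for Radau quadrature \<open>e = 0\<close>.\<close>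

lemma quadrature_defect:
  assumes y: "reference_points meth k y" and k: "1 \<le> k"
  shows "\<exists>e\<ge>0. \<forall>f. degree f \<le> 2 * k \<longrightarrow>
    ref_integral f - quadrature meth k y f = e * coeff f (2 * k)"
proof (cases meth)
  case RRSV
  have "ref_integral f - quadrature meth k y f = 0" if "degree f \<le> 2 * k" for f
    using quadrature_exact[OF y k, of f] that by (simp add: RRSV)
  then show ?thesis by (intro exI[of _ 0]) simp
next
  case LSV
  let ?Q = "legendre_poly k"
  define e where "e = ref_integral (?Q * ?Q) / (lead_coeff ?Q)\<^sup>2"
  have "ref_integral f - quadrature meth k y f = e * coeff f (2 * k)" if f: "degree f \<le> 2 * k" for f
  proof -
    have lc: "lead_coeff ?Q \<noteq> 0" using legendre_nonzero by simp
    define c where "c = coeff f (2 * k) / (lead_coeff ?Q)\<^sup>2"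
    define g where "g = f - Polynomial.smult c (?Q * ?Q)"
    have top: "coeff (?Q * ?Q) (2 * k) = (lead_coeff ?Q)\<^sup>2"
      using coeff_mult_degree_sum[of ?Q ?Q] by (simp add: degree_legendre mult_2 power2_eq_square)
    have "degree g \<le> 2 * k"
      unfolding g_def using f degree_mult_le[of ?Q ?Q]
      by (intro degree_diff_le order.trans[OF degree_smult_le]) (simp_all add: degree_legendre mult_2)
    moreover have "coeff g (2 * k) = 0"
      using lc by (simp add: g_def c_def top)
    ultimately have "degree g < 2 * k"
      using k by (metis degree_0 le_neq_implies_less leading_coeff_0_iff mult_pos_pos not_one_le_zero
          pos2 zero_less_iff_neq_zero)
    then have "ref_integral g = quadrature meth k y g"
      by (intro quadrature_exact[OF y k]) (simp add: LSV)
    moreover have fg: "f = g + Polynomial.smult c (?Q * ?Q)" by (simp add: g_def)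
    moreover have "quadrature meth k y (?Q * ?Q) = 0"
      using quadrature_at_roots[OF y, of ?Q] by (simp add: LSV)
    ultimately have "ref_integral f - quadrature meth k y f = c * ref_integral (?Q * ?Q)"
      by (simp only: ref_integral_add ref_integral_smult quadrature_add quadrature_smult)
    then show ?thesis by (simp add: c_def e_def)
  qed
  moreover have "e \<ge> 0" by (simp add: e_def ref_integral_square_nonneg)
  ultimately show ?thesis by blast
qed

text \<open>On polynomials of degree at most \<open>k\<close> this norm dominates the end point values and grows at most by
  the factor \<open>k\<close> under differentiation, so comparing it with the \<open>L\<^sub>2\<close> norm gives the trace and the inverse inequality together.\<close>

definition coeff_norm :: "nat \<Rightarrow> real poly \<Rightarrow> real" where
  "coeff_norm k p = (\<Sum>i\<le>k. \<bar>coeff p i\<bar>)"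

lemma coeff_norm_nonneg: "0 \<le> coeff_norm k p"
  by (simp add: coeff_norm_def sum_nonneg)

lemma coeff_norm_smult_add:
  "coeff_norm k (Polynomial.smult c p + q) \<le> \<bar>c\<bar> * coeff_norm k p + coeff_norm k q"
  unfolding coeff_norm_def sum_distrib_left sum.distrib[symmetric]
  by (intro sum_mono) (simp add: abs_mult[symmetric] abs_triangle_ineq)

text \<open>Equivalence of norms on polynomials of bounded degree, by induction along the Legendre basis: splitting
  off the top Legendre component splits the squared \<open>L\<^sub>2\<close> norm orthogonally.\<close>

lemma coeff_norm_le_L2:
  "\<exists>C\<ge>0. \<forall>p. degree p \<le> m \<longrightarrow> (coeff_norm k p)\<^sup>2 \<le> C * ref_integral (p * p)"
proof (induction m)
  case 0
  have I: "ref_integral (1 * 1) > 0" by (intro ref_integral_square_pos) simp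
  have "(coeff_norm k p)\<^sup>2 \<le> (coeff_norm k 1)\<^sup>2 / ref_integral (1 * 1) * ref_integral (p * p)"
    if "degree p \<le> 0" for p
  proof -
    from that have "degree p = 0" by simp
    then obtain c where "p = [:c:]" by (rule degree_eq_zeroE)
    then have p: "p = Polynomial.smult c 1" by (simp add: one_pCons)
    have "coeff_norm k p = \<bar>c\<bar> * coeff_norm k 1"
      unfolding coeff_norm_def p coeff_smult abs_mult sum_distrib_left ..
    moreover have "p * p = Polynomial.smult (c\<^sup>2) (1 * 1)"
      by (simp add: p power2_eq_square)
    ultimately show ?thesis
      using I by (simp only: ref_integral_smult) (simp add: power_mult_distrib)
  qed
  moreover have "0 \<le> (coeff_norm k 1)\<^sup>2 / ref_integral (1 * 1)" using I by simp
  ultimately show ?case by blast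
next
  case (Suc m)
  then obtain C where C: "C \<ge> 0"
    "\<And>p. degree p \<le> m \<Longrightarrow> (coeff_norm k p)\<^sup>2 \<le> C * ref_integral (p * p)" by blast
  let ?L = "legendre_poly (Suc m)"
  define I where "I = ref_integral (?L * ?L)"
  have I: "I > 0" unfolding I_def by (intro ref_integral_square_pos legendre_nonzero)
  define C' where "C' = 2 * (coeff_norm k ?L)\<^sup>2 / I + 2 * C"
  have "(coeff_norm k p)\<^sup>2 \<le> C' * ref_integral (p * p)" if deg: "degree p \<le> Suc m" for p
  proof -
    have lc: "coeff ?L (Suc m) \<noteq> 0"
      using legendre_nonzero[of "Suc m"] by (metis degree_legendre leading_coeff_0_iff)
    define c where "c = coeff p (Suc m) / coeff ?L (Suc m)"
    define r where "r = p - Polynomial.smult c ?L"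
    have "degree r \<le> Suc m"
      unfolding r_def using deg
      by (intro degree_diff_le order.trans[OF degree_smult_le]) (simp_all add: degree_legendre)
    moreover have "coeff r (Suc m) = 0" using lc by (simp add: r_def c_def)
    ultimately have r: "degree r < Suc m"
      by (metis degree_0 le_neq_implies_less leading_coeff_0_iff zero_less_Suc)
    have p: "p = Polynomial.smult c ?L + r" by (simp add: r_def)
    have pp: "p * p = Polynomial.smult (c\<^sup>2) (?L * ?L) + (Polynomial.smult c (?L * r) + Polynomial.smult c (?L * r)) + r * r"
      unfolding p by (simp only: distrib_left distrib_right mult_smult_left mult_smult_right smult_smult smult_add_right
          power2_eq_square add.assoc mult.commute[of r ?L])
    have int: "ref_integral (p * p) = c\<^sup>2 * I + ref_integral (r * r)"
      unfolding pp by (simp only: ref_integral_add ref_integral_smult legendre_orthogonal[OF r] I_def)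
    have "coeff_norm k p \<le> \<bar>c\<bar> * coeff_norm k ?L + coeff_norm k r"
      unfolding p by (rule coeff_norm_smult_add)
    then have "(coeff_norm k p)\<^sup>2 \<le> (\<bar>c\<bar> * coeff_norm k ?L + coeff_norm k r)\<^sup>2"
      by (intro power_mono coeff_norm_nonneg)
    also have "\<dots> \<le> 2 * (\<bar>c\<bar> * coeff_norm k ?L)\<^sup>2 + 2 * (coeff_norm k r)\<^sup>2"
      using zero_le_power2[of "\<bar>c\<bar> * coeff_norm k ?L - coeff_norm k r"]
      unfolding power2_sum power2_diff by linarith
    also have "\<dots> \<le> 2 * (coeff_norm k ?L)\<^sup>2 * c\<^sup>2 + 2 * (C * ref_integral (r * r))"
      using C(2)[of r] r by (simp add: power_mult_distrib)
    also have "\<dots> = 2 * (coeff_norm k ?L)\<^sup>2 / I * (c\<^sup>2 * I) + 2 * C * ref_integral (r * r)"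
      using I by simp
    also have "\<dots> \<le> C' * (c\<^sup>2 * I) + C' * ref_integral (r * r)"
      using I C(1) ref_integral_square_nonneg[of r]
      by (intro add_mono mult_right_mono) (auto simp: C'_def)
    finally show ?thesis by (simp add: int distrib_left)
  qed
  moreover have "C' \<ge> 0" using I C(1) by (simp add: C'_def)
  ultimately show ?case by blast
qed

lemma abs_poly_le_coeff_norm:
  assumes "degree p \<le> k" "\<bar>x\<bar> \<le> 1"
  shows "\<bar>poly p x\<bar> \<le> coeff_norm k p"
proof -
  have "poly p x = (\<Sum>i\<le>k. coeff p i * x ^ i)"
    unfolding poly_altdef using assms(1)
    by (intro sum.mono_neutral_left) (auto simp: coeff_eq_0)
  also have "\<bar>\<dots>\<bar> \<le> (\<Sum>i\<le>k. \<bar>coeff p i * x ^ i\<bar>)" by (rule sum_abs)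
  also have "\<dots> \<le> (\<Sum>i\<le>k. \<bar>coeff p i\<bar> * 1)"
    unfolding abs_mult power_abs using assms(2) by (intro sum_mono mult_left_mono power_le_one) auto
  finally show ?thesis by (simp add: coeff_norm_def)
qed

lemma coeff_norm_pderiv:
  assumes "degree p \<le> k"
  shows "coeff_norm k (pderiv p) \<le> k * coeff_norm k p"
proof -
  have "coeff_norm k (pderiv p) = (\<Sum>i\<le>k. \<bar>real (Suc i) * coeff p (Suc i)\<bar>)"
    by (simp add: coeff_norm_def coeff_pderiv)
  also have "\<dots> = (\<Sum>i\<in>{1..Suc k}. \<bar>real i * coeff p i\<bar>)"
    by (rule sum.reindex_bij_witness[of _ "\<lambda>i. i - 1" Suc]) auto
  also have "\<dots> = (\<Sum>i\<in>{1..k}. \<bar>real i * coeff p i\<bar>)"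
    using assms by (intro sum.mono_neutral_right) (auto simp: coeff_eq_0 not_le)
  also have "\<dots> \<le> (\<Sum>i\<in>{1..k}. real k * \<bar>coeff p i\<bar>)"
    unfolding abs_mult by (intro sum_mono mult_right_mono) auto
  also have "\<dots> \<le> (\<Sum>i\<le>k. real k * \<bar>coeff p i\<bar>)"
    by (intro sum_mono2) auto
  finally show ?thesis by (simp add: coeff_norm_def sum_distrib_left)
qed


section \<open>The forms on the reference cell\<close>

text \<open>Normalized to vanish at \<open>-1\<close>, so that the integrals of \<open>v\<close> over the control volumes become increments
  without a boundary term at the left end.\<close>

lemma poly_antiderivative:
  fixes v :: "real poly"
  assumes "degree v \<le> k"
  obtains V where "pderiv V = v" "degree V \<le> k + 1" "poly V (-1) = 0"
    "coeff V (k + 1) = coeff v k / real (k + 1)"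
proof -
  define W where "W = (\<Sum>i\<le>k. Polynomial.monom (coeff v i / real (i + 1)) (i + 1))"
  have coeffW: "coeff W (Suc n) = (if n \<le> k then coeff v n / real (n + 1) else 0)" for n
    by (simp add: W_def coeff_sum)
  define V where "V = W - [:poly W (-1):]"
  have coeffV: "coeff V (Suc n) = coeff W (Suc n)" for n by (simp add: V_def)
  show ?thesis
  proof (rule that[of V])
    show "pderiv V = v"
    proof (rule poly_eqI)
      fix n
      show "coeff (pderiv V) n = coeff v n"
        using assms by (auto simp: coeff_pderiv coeffV coeffW coeff_eq_0 simp del: of_nat_Suc)
    qed
    show "degree V \<le> k + 1"
    proof (rule degree_le, intro allI impI)
      fix n assume "k + 1 < n"
      then show "coeff V n = 0" by (cases n) (simp_all add: coeffV coeffW)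
    qed
    show "poly V (-1) = 0" by (simp add: V_def)
    show "coeff V (k + 1) = coeff v k / real (k + 1)" by (simp add: coeffV coeffW)
  qed
qed

lemma quadrature_all_points:
  "quadrature meth k y f = (\<Sum>m\<in>{1..k+1}. reference_weight meth k y m * poly f (y m))"
  unfolding quadrature_def
  by (rule sum.mono_neutral_left) (cases meth; auto simp: reference_weight_def)+

text \<open>The values \<open>w\<^sup>*\<^bsub>i,j\<^esub>\<close> after transformation to \<open>[-1, 1]\<close>; the cell size cancels between weight and
  derivative.\<close>

definition ref_star :: "sv_method \<Rightarrow> nat \<Rightarrow> (nat \<Rightarrow> real) \<Rightarrow> real poly \<Rightarrow> nat \<Rightarrow> real" where
  "ref_star meth k y w j =
     poly w (-1) + (\<Sum>m\<in>{1..j}. reference_weight meth k y m * poly (pderiv w) (y m))"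

lemma summation_by_parts:
  fixes c f d :: "nat \<Rightarrow> real"
  shows "(\<Sum>j\<in>{0..k}. (w + (\<Sum>m\<in>{1..j}. d m)) * (f (j + 1) - f j)) =
    (w + (\<Sum>m\<in>{1..k+1}. d m)) * f (k + 1) - w * f 0 - (\<Sum>m\<in>{1..k+1}. d m * f m)"
  by (induction k) (simp_all add: algebra_simps)

lemma degree_pderiv_mult:
  fixes v w :: "real poly"
  assumes "degree v \<le> m" "degree w \<le> k" "1 \<le> k"
  shows "degree (pderiv w * v) \<le> m + k - 1"
  using degree_mult_le[of "pderiv w" v] assms by (simp add: degree_pderiv)

text \<open>The star values run from \<open>w(-1)\<close> to \<open>w(1)\<close>, because the quadrature of \<open>w'\<close> is exact. For right Radau
  points the node of index \<open>k + 1\<close> does not occur in the star values; adding it on both sides, once to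
  complete \<open>w(1)\<close> and once in the sum, gives the same formula for both methods.\<close>

lemma ref_star_sum:
  assumes y: "reference_points meth k y" and k: "1 \<le> k" and w: "degree w \<le> k"
  shows "(\<Sum>j\<in>{0..k}. ref_star meth k y w j * (f (j + 1) - f j)) =
    poly w 1 * f (k + 1) - poly w (-1) * f 0
    - (\<Sum>m\<in>{1..k+1}. reference_weight meth k y m * poly (pderiv w) (y m) * f m)"
proof -
  have n: "k \<le> card (quadrature_indices meth k)" by (cases meth) auto
  have "quadrature meth k y (pderiv w) = ref_integral (pderiv w)"
    using w k n by (intro quadrature_exact[OF y k, symmetric]) (simp add: degree_pderiv)
  then have "poly w (-1) + (\<Sum>m\<in>{1..k+1}. reference_weight meth k y m * poly (pderiv w) (y m)) = poly w 1"
    by (simp only: quadrature_all_points ref_integral_pderiv)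
  then show ?thesis
    unfolding ref_star_def summation_by_parts by simp
qed

text \<open>The parameter \<open>e\<close> is the contribution of the quadrature defect.\<close>

definition cell_inner :: "nat \<Rightarrow> real \<Rightarrow> real poly \<Rightarrow> real poly \<Rightarrow> real" where
  "cell_inner k e v w = ref_integral (v * w) + e * coeff v k * coeff w k"

lemma coeff_top_mult:
  fixes p q :: "real poly"
  assumes "degree p \<le> m" "degree q \<le> n"
  shows "coeff (p * q) (m + n) = coeff p m * coeff q n"
proof -
  have "coeff (p * q) (m + n) = (\<Sum>i\<le>m + n. coeff p i * coeff q (m + n - i))"
    by (rule coeff_mult)
  also have "\<dots> = (\<Sum>i\<in>{m}. coeff p i * coeff q (m + n - i))"
  proof (rule sum.mono_neutral_right)
    show "\<forall>i\<in>{..m + n} - {m}. coeff p i * coeff q (m + n - i) = 0"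
    proof
      fix i assume "i \<in> {..m + n} - {m}"
      then have "m < i \<or> n < m + n - i" by auto
      then show "coeff p i * coeff q (m + n - i) = 0"
        using assms by (auto simp: coeff_eq_0)
    qed
  qed auto
  finally show ?thesis by simp
qed

text \<open>Summation by parts against an antiderivative \<open>V\<close> of \<open>v\<close> produces \<open>w(1) V(1)\<close> minus the quadrature of
  \<open>w' V\<close>, a polynomial of degree \<open>2 * k\<close>. Integration by parts would give the \<open>L\<^sub>2\<close> product, and the
  defect in degree \<open>2 * k\<close> sees only the product of the leading coefficients of \<open>v\<close> and \<open>w\<close>. This is
  where the symmetry of \<open>(v, w\<^sup>*)\<close> comes from.\<close>

lemma ref_mass:
  assumes y: "reference_points meth k y" and k: "1 \<le> k"
  shows "\<exists>e\<ge>0. \<forall>v w. degree v \<le> k \<longrightarrow> degree w \<le> k \<longrightarrow>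
    (\<Sum>j\<in>{0..k}. ref_star meth k y w j * integral {y j..y (j + 1)} (poly v)) = cell_inner k e v w"
proof -
  obtain e where e: "e \<ge> 0"
    "\<And>f. degree f \<le> 2 * k \<Longrightarrow> ref_integral f - quadrature meth k y f = e * coeff f (2 * k)"
    using quadrature_defect[OF y k] by blast
  define e' where "e' = e * (real k / real (k + 1))"
  have "(\<Sum>j\<in>{0..k}. ref_star meth k y w j * integral {y j..y (j + 1)} (poly v)) = cell_inner k e' v w"
    if v: "degree v \<le> k" and w: "degree w \<le> k" for v w
  proof -
    obtain V where V: "pderiv V = v" "degree V \<le> k + 1" "poly V (-1) = 0"
      "coeff V (k + 1) = coeff v k / real (k + 1)"
      using poly_antiderivative[OF v] by blast
    have y0: "y 0 = -1" "y (k + 1) = 1" using y by (auto simp: reference_points_def)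
    have "(\<Sum>j\<in>{0..k}. ref_star meth k y w j * integral {y j..y (j + 1)} (poly v)) =
        (\<Sum>j\<in>{0..k}. ref_star meth k y w j * (poly V (y (j + 1)) - poly V (y j)))"
    proof (intro sum.cong refl)
      fix j assume "j \<in> {0..k}"
      then have "y j \<le> y (j + 1)" using y by (auto simp: reference_points_def less_imp_le)
      then show "ref_star meth k y w j * integral {y j..y (j + 1)} (poly v) =
          ref_star meth k y w j * (poly V (y (j + 1)) - poly V (y j))"
        by (simp only: V(1)[symmetric] integral_poly_pderiv)
    qed
    also have "\<dots> = poly w 1 * poly V 1 - quadrature meth k y (pderiv w * V)"
      unfolding ref_star_sum[OF y k w, of "\<lambda>j. poly V (y j)"] quadrature_all_points
      by (simp add: y0[simplified] V(3) mult_ac)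
    also have "quadrature meth k y (pderiv w * V) =
        ref_integral (pderiv w * V) - e * coeff (pderiv w * V) (2 * k)"
      using e(2)[of "pderiv w * V"] degree_pderiv_mult[OF V(2) w k] by simp
    also have "coeff (pderiv w * V) (2 * k) = (real k * coeff w k) * (coeff v k / real (k + 1))"
    proof -
      have "coeff (pderiv w * V) ((k - 1) + (k + 1)) = coeff (pderiv w) (k - 1) * coeff V (k + 1)"
        using w V(2) by (intro coeff_top_mult) (simp_all add: degree_pderiv)
      moreover have "(k - 1) + (k + 1) = 2 * k" using k by simp
      moreover have "coeff (pderiv w) (k - 1) = real k * coeff w k"
        using k by (simp add: coeff_pderiv del: of_nat_Suc)
      ultimately show ?thesis by (simp only: V(4))
    qed
    also have "ref_integral (pderiv w * V) = poly w 1 * poly V 1 - ref_integral (v * w)"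
    proof -
      have "pderiv w * V = pderiv (w * V) - v * w" by (simp add: pderiv_mult V(1) algebra_simps)
      then show ?thesis by (simp only: ref_integral_diff ref_integral_pderiv poly_mult V(3))
    qed
    finally show ?thesis by (simp add: cell_inner_def e'_def field_simps)
  qed
  moreover have "e' \<ge> 0" using e(1) by (simp add: e'_def)
  ultimately show ?thesis by blast
qed

text \<open>The upwind discontinuous Galerkin form of one cell, where \<open>t\<close> is the trace that flows in from the
  left.\<close>

definition cell_form :: "real poly \<Rightarrow> real \<Rightarrow> real poly \<Rightarrow> real" where
  "cell_form v t w = ref_integral (pderiv w * v) - poly v 1 * poly w 1 + t * poly w (-1)"

text \<open>The integrand \<open>w' v\<close> has degree at most \<open>2 * k - 1\<close>, where both quadratures are exact.\<close>

lemma ref_form: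
  assumes y: "reference_points meth k y" and k: "1 \<le> k"
    and v: "degree v \<le> k" and w: "degree w \<le> k"
  shows "- (\<Sum>j\<in>{0..k}. ref_star meth k y w j *
      (poly v (y (j + 1)) - (if j = 0 then t else poly v (y j)))) = cell_form v t w"
proof -
  define f where "f j = (if j = 0 then t else poly v (y j))" for j
  have y1: "y (k + 1) = 1" using y by (simp add: reference_points_def)
  have n: "k \<le> card (quadrature_indices meth k)" by (cases meth) auto
  have "(\<Sum>j\<in>{0..k}. ref_star meth k y w j *
      (poly v (y (j + 1)) - (if j = 0 then t else poly v (y j)))) =
      (\<Sum>j\<in>{0..k}. ref_star meth k y w j * (f (j + 1) - f j))"
    by (simp add: f_def)
  also have "\<dots> = poly w 1 * poly v 1 - poly w (-1) * t
    - (\<Sum>m\<in>{1..k+1}. reference_weight meth k y m * poly (pderiv w) (y m) * f m)"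
    unfolding ref_star_sum[OF y k w] by (simp add: f_def y1[simplified])
  also have "(\<Sum>m\<in>{1..k+1}. reference_weight meth k y m * poly (pderiv w) (y m) * f m) =
      quadrature meth k y (pderiv w * v)"
    unfolding quadrature_all_points by (intro sum.cong) (auto simp: f_def)
  also have "\<dots> = ref_integral (pderiv w * v)"
    using degree_pderiv_mult[OF v w k] k n by (intro quadrature_exact[OF y k, symmetric]) simp
  finally show ?thesis by (simp add: cell_form_def)
qed

lemma cell_inner_commute: "cell_inner k e v w = cell_inner k e w v"
  by (simp add: cell_inner_def mult.commute)

lemma cell_inner_ge:
  assumes "0 \<le> e"
  shows "ref_integral (v * v) \<le> cell_inner k e v v"
  using assms by (simp add: cell_inner_def mult.assoc)

text \<open>Completing the square with the inflow traces: the jump at the left end dissipates, and what remains are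
  products of inflow and of outflow traces, which cancel between neighbouring cells.\<close>

lemma cell_form_sym:
  "cell_form v s w + cell_form w t v =
    - (poly v (-1) - s) * (poly w (-1) - t) + s * t - poly v 1 * poly w 1"
proof -
  have "pderiv w * v + pderiv v * w = pderiv (v * w)" by (simp add: pderiv_mult algebra_simps)
  then have "ref_integral (pderiv w * v) + ref_integral (pderiv v * w) =
      poly v 1 * poly w 1 - poly v (-1) * poly w (-1)"
    by (metis ref_integral_add ref_integral_pderiv poly_mult)
  then show ?thesis by (simp add: cell_form_def algebra_simps)
qed

lemma abs_ref_integral_le:
  assumes "\<And>x. \<bar>x\<bar> \<le> 1 \<Longrightarrow> \<bar>poly p x\<bar> \<le> B"
  shows "\<bar>ref_integral p\<bar> \<le> 2 * B"
proof -
  have "norm (integral {-1..1} (poly p)) \<le> integral {-1..1} (\<lambda>_ :: real. B)"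
    using assms by (intro integral_norm_bound_integral) auto
  then show ?thesis by (simp add: ref_integral_def)
qed

lemma abs_cell_form_le:
  assumes v: "degree v \<le> k" and w: "degree w \<le> k"
  shows "\<bar>cell_form v t w\<bar> \<le> (2 * k + 1) * (coeff_norm k v + \<bar>t\<bar>) * coeff_norm k w"
proof -
  let ?v = "coeff_norm k v" and ?w = "coeff_norm k w"
  have v0: "0 \<le> ?v" and w0: "0 \<le> ?w" by (rule coeff_norm_nonneg)+
  have w': "degree (pderiv w) \<le> k" using w by (simp add: degree_pderiv)
  have "\<bar>ref_integral (pderiv w * v)\<bar> \<le> 2 * (k * ?w * ?v)"
  proof (rule abs_ref_integral_le)
    fix x :: real assume x: "\<bar>x\<bar> \<le> 1"
    have "\<bar>poly (pderiv w) x\<bar> \<le> k * ?w"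
      using abs_poly_le_coeff_norm[OF w' x] coeff_norm_pderiv[OF w] by linarith
    then show "\<bar>poly (pderiv w * v) x\<bar> \<le> k * ?w * ?v"
      unfolding poly_mult abs_mult
      using abs_poly_le_coeff_norm[OF v x] w0 by (intro mult_mono) auto
  qed
  moreover have "\<bar>poly v 1 * poly w 1\<bar> \<le> ?v * ?w"
    unfolding abs_mult using v0 by (intro mult_mono abs_poly_le_coeff_norm v w) auto
  moreover have "\<bar>t * poly w (-1)\<bar> \<le> \<bar>t\<bar> * ?w"
    unfolding abs_mult by (intro mult_left_mono abs_poly_le_coeff_norm w) auto
  moreover have "0 \<le> real k * \<bar>t\<bar> * ?w" using w0 by simp
  ultimately show ?thesis
    unfolding cell_form_def by (simp add: algebra_simps)
qed


section \<open>The forms on a mesh\<close>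

text \<open>On the reference cell all constants are independent of the mesh, so trial functions are represented by
  one polynomial on \<open>[-1, 1]\<close> per cell.\<close>

definition cell_rep :: "discretization \<Rightarrow> (real \<Rightarrow> real) \<Rightarrow> (nat \<Rightarrow> real poly) \<Rightarrow> bool" where
  "cell_rep D w P \<longleftrightarrow> (\<forall>i\<in>{1..num_cells D}. degree (P i) \<le> poly_deg D \<and>
     (\<forall>t\<in>{-1<..<1}. w (cell_size D i / 2 * t + cell_mid D i) = poly (P i) t))"

lemma cell_rep_sum:
  assumes "finite A" and "\<And>l. l \<in> A \<Longrightarrow> cell_rep D (u l) (U l)"
  shows "cell_rep D (\<lambda>x. \<Sum>l\<in>A. c l * u l x) (\<lambda>i. \<Sum>l\<in>A. Polynomial.smult (c l) (U l i))"
  unfolding cell_rep_def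
proof (intro ballI conjI)
  fix i assume i: "i \<in> {1..num_cells D}"
  show "degree (\<Sum>l\<in>A. Polynomial.smult (c l) (U l i)) \<le> poly_deg D"
    using assms i by (intro degree_sum_le order.trans[OF degree_smult_le]) (auto simp: cell_rep_def)
  fix t :: real assume "t \<in> {-1<..<1}"
  then show "(\<Sum>l\<in>A. c l * u l (cell_size D i / 2 * t + cell_mid D i)) =
      poly (\<Sum>l\<in>A. Polynomial.smult (c l) (U l i)) t"
    unfolding poly_sum poly_smult using assms(2) i
    by (intro sum.cong refl) (auto simp: cell_rep_def)
qed

locale sv_mesh =
  fixes meth :: sv_method and bc :: boundary_condition and k :: nat and y :: "nat \<Rightarrow> real"
    and a b \<alpha>star :: real and D :: discretization
  assumes y: "reference_points meth k y" and k: "1 \<le> k"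
    and D: "D \<in> regular_family meth bc k y a b \<alpha>star"
begin

abbreviation "N \<equiv> num_cells D"

lemma D_simps [simp]: "sv_kind D = meth" "bc_kind D = bc" "poly_deg D = k" "ref_pt D = y"
  using D by (auto simp: regular_family_def)

lemma N_pos: "1 \<le> N"
  using D by (auto simp: regular_family_def)

lemma cell_size_pos: "i \<in> {1..N} \<Longrightarrow> 0 < cell_size D i"
  using D by (auto simp: regular_family_def cell_size_def)

definition cell_map :: "nat \<Rightarrow> real \<Rightarrow> real" where
  "cell_map i t = cell_size D i / 2 * t + cell_mid D i"

lemma cell_map_ends: "cell_map i (-1) = node D (i - 1)" "cell_map i 1 = node D i"
  by (simp_all add: cell_map_def cell_mid_def cell_size_def field_simps)

lemma cv_point_cell_map: "cv_point D i j = cell_map i (y j)"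
  by (simp add: cv_point_def cell_map_def)

lemma cell_map_less: "i \<in> {1..N} \<Longrightarrow> cell_map i s < cell_map i t \<longleftrightarrow> s < t"
  using cell_size_pos[of i] by (simp add: cell_map_def)

lemma cell_map_le: "i \<in> {1..N} \<Longrightarrow> cell_map i s \<le> cell_map i t \<longleftrightarrow> s \<le> t"
  using cell_size_pos[of i] by (simp add: cell_map_def)

lemma cell_map_in_cell:
  assumes "i \<in> {1..N}"
  shows "node D (i - 1) < cell_map i t \<longleftrightarrow> -1 < t" "cell_map i t < node D i \<longleftrightarrow> t < 1"
    "node D (i - 1) \<le> cell_map i t \<longleftrightarrow> -1 \<le> t" "cell_map i t \<le> node D i \<longleftrightarrow> t \<le> 1"
  using cell_map_less[OF assms] cell_map_le[OF assms] by (metis cell_map_ends)+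

definition physical :: "nat \<Rightarrow> real poly \<Rightarrow> real poly" where
  "physical i p = pcompose p [:- 2 * cell_mid D i / cell_size D i, 2 / cell_size D i:]"

lemma poly_physical:
  assumes "i \<in> {1..N}"
  shows "poly (physical i p) (cell_map i t) = poly p t"
proof -
  have "poly [:- 2 * cell_mid D i / cell_size D i, 2 / cell_size D i:] (cell_map i t) = t"
    using cell_size_pos[OF assms] by (simp add: cell_map_def field_simps)
  then show ?thesis by (simp only: physical_def poly_pcompose)
qed

lemma pderiv_physical: "pderiv (physical i p) = Polynomial.smult (2 / cell_size D i) (physical i (pderiv p))"
  by (simp add: physical_def pderiv_pcompose pderiv_pCons)

lemma degree_physical: "degree (physical i p) \<le> degree p"
proof -
  have "degree (physical i p) \<le> degree p * degree [:- 2 * cell_mid D i / cell_size D i, 2 / cell_size D i:]"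
    unfolding physical_def by (rule degree_pcompose_le)
  also have "\<dots> \<le> degree p * 1" by (intro mult_le_mono) simp_all
  finally show ?thesis by simp
qed

lemma cell_rep_eq:
  assumes w: "cell_rep D w P" and i: "i \<in> {1..N}" and x: "node D (i - 1) < x" "x < node D i"
  shows "w x = poly (physical i (P i)) x"
proof -
  define t where "t = (x - cell_mid D i) * 2 / cell_size D i"
  have xt: "x = cell_map i t" using cell_size_pos[OF i] by (simp add: t_def cell_map_def field_simps)
  have "-1 < t" "t < 1"
    using x unfolding xt cell_map_in_cell[OF i] by auto
  then show ?thesis
    using w i unfolding xt poly_physical[OF i] by (auto simp: cell_rep_def cell_map_def)
qed

lemma trial_space_iff_cell_rep: "w \<in> trial_space D \<longleftrightarrow> (\<exists>P. cell_rep D w P)"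
proof
  assume "w \<in> trial_space D"
  then have "\<forall>i\<in>{1..N}. \<exists>p :: real poly. degree p \<le> k \<and>
      (\<forall>x\<in>{node D (i - 1)<..<node D i}. w x = poly p x)"
    by (simp add: trial_space_def)
  then obtain p :: "nat \<Rightarrow> real poly" where p: "\<forall>i\<in>{1..N}. degree (p i) \<le> k \<and>
      (\<forall>x\<in>{node D (i - 1)<..<node D i}. w x = poly (p i) x)"
    by (rule bchoice[THEN exE])
  define P where "P i = pcompose (p i) [:cell_mid D i, cell_size D i / 2:]" for i
  have "cell_rep D w P"
    unfolding cell_rep_def
  proof (intro ballI conjI)
    fix i assume i: "i \<in> {1..N}"
    have "degree (P i) \<le> degree (p i) * degree [:cell_mid D i, cell_size D i / 2:]"
      unfolding P_def by (rule degree_pcompose_le)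
    also have "\<dots> \<le> degree (p i) * 1" by (intro mult_le_mono) simp_all
    finally show "degree (P i) \<le> poly_deg D" using p i by fastforce
    fix t :: real assume "t \<in> {-1<..<1}"
    then have "cell_map i t \<in> {node D (i - 1)<..<node D i}"
      by (simp only: greaterThanLessThan_iff cell_map_in_cell[OF i])
    then have "w (cell_map i t) = poly (p i) (cell_map i t)" using p i by blast
    then show "w (cell_size D i / 2 * t + cell_mid D i) = poly (P i) t"
      by (simp add: P_def poly_pcompose cell_map_def algebra_simps)
  qed
  then show "\<exists>P. cell_rep D w P" by blast
next
  assume "\<exists>P. cell_rep D w P"
  then obtain P where P: "cell_rep D w P" ..
  have "degree (physical i (P i)) \<le> k \<and>
      (\<forall>x\<in>{node D (i - 1)<..<node D i}. w x = poly (physical i (P i)) x)" if "i \<in> {1..N}" for i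
  proof
    show "degree (physical i (P i)) \<le> k"
    proof (rule order.trans[OF degree_physical])
      show "degree (P i) \<le> k" using P that by (simp add: cell_rep_def)
    qed
  qed (auto intro: cell_rep_eq[OF P that])
  then show "w \<in> trial_space D" unfolding trial_space_def D_simps by blast
qed

lemma right_limit:
  assumes w: "cell_rep D w P" and i: "i \<in> {1..N}"
  shows "Lim (at_right (node D (i - 1))) w = poly (P i) (-1)"
proof (rule tendsto_Lim)
  have lt: "node D (i - 1) < node D i" using cell_map_in_cell(1)[OF i, of 1] by (simp add: cell_map_ends)
  have "(poly (physical i (P i)) \<longlongrightarrow> poly (physical i (P i)) (node D (i - 1))) (at_right (node D (i - 1)))"
    by (intro tendsto_intros)
  moreover have "eventually (\<lambda>x. poly (physical i (P i)) x = w x) (at_right (node D (i - 1)))"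
    unfolding eventually_at_right_field
    by (rule exI[of _ "node D i"]) (use lt in \<open>auto simp: cell_rep_eq[OF w i]\<close>)
  ultimately have "(w \<longlongrightarrow> poly (physical i (P i)) (node D (i - 1))) (at_right (node D (i - 1)))"
    by (rule Lim_transform_eventually)
  then show "(w \<longlongrightarrow> poly (P i) (-1)) (at_right (node D (i - 1)))"
    unfolding cell_map_ends(1)[symmetric] by (simp only: poly_physical[OF i])
qed (simp add: trivial_limit_at_right_real)

lemma left_limit:
  assumes w: "cell_rep D w P" and i: "i \<in> {1..N}" and t: "-1 < t" "t \<le> 1"
  shows "Lim (at_left (cell_map i t)) w = poly (P i) t"
proof (rule tendsto_Lim)
  let ?x = "cell_map i t"
  have lt: "node D (i - 1) < ?x" "?x \<le> node D i"
    using t by (simp_all only: cell_map_in_cell[OF i])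
  have "(poly (physical i (P i)) \<longlongrightarrow> poly (physical i (P i)) ?x) (at_left ?x)"
    by (intro tendsto_intros)
  moreover have "eventually (\<lambda>x. poly (physical i (P i)) x = w x) (at_left ?x)"
    unfolding eventually_at_left_field
    by (rule exI[of _ "node D (i - 1)"]) (use lt in \<open>auto simp: cell_rep_eq[OF w i]\<close>)
  ultimately have "(w \<longlongrightarrow> poly (physical i (P i)) ?x) (at_left ?x)"
    by (rule Lim_transform_eventually)
  then show "(w \<longlongrightarrow> poly (P i) t) (at_left ?x)"
    by (simp only: poly_physical[OF i])
qed (simp add: trivial_limit_at_left_real)

lemma deriv_cell_map:
  assumes w: "cell_rep D w P" and i: "i \<in> {1..N}" and t: "-1 < t" "t < 1"
  shows "cell_size D i / 2 * deriv w (cell_map i t) = poly (pderiv (P i)) t"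
proof -
  let ?S = "{node D (i - 1)<..<node D i}"
  have "cell_map i t \<in> ?S"
    using t by (simp only: greaterThanLessThan_iff cell_map_in_cell[OF i])
  then have "(w has_field_derivative poly (pderiv (physical i (P i))) (cell_map i t)) (at (cell_map i t))"
    by (intro has_field_derivative_transform_within_open[OF poly_DERIV, of ?S])
      (auto simp: cell_rep_eq[OF w i])
  then have "deriv w (cell_map i t) = 2 / cell_size D i * poly (pderiv (P i)) t"
    by (simp add: DERIV_imp_deriv pderiv_physical poly_physical[OF i])
  then show ?thesis using cell_size_pos[OF i] by simp
qed

lemma y_ends: "y 0 = -1" "y (Suc k) = 1"
  using y by (simp_all add: reference_points_def)

lemma y_gt: "0 < j \<Longrightarrow> j \<le> k + 1 \<Longrightarrow> -1 < y j"
  using reference_points_strict_mono[OF y, of 0 j] y_ends by simp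

lemma y_less: "j \<le> k \<Longrightarrow> y j < 1"
  using reference_points_strict_mono[OF y, of j "k + 1"] y_ends by simp

lemma y_bounds: "j \<le> k + 1 \<Longrightarrow> -1 \<le> y j \<and> y j \<le> 1"
  using y_gt[of j] y_less[of j] y_ends by (cases "j = 0"; cases "j = k + 1") auto

lemma star_val_ref:
  assumes w: "cell_rep D w P" and i: "i \<in> {1..N}"
  shows "j \<le> k \<Longrightarrow> star_val D w i j = ref_star meth k y (P i) j"
proof (induction j)
  case 0
  have "cv_weight D i 0 = 0"
    by (cases meth) (simp_all add: cv_weight_def reference_weight_def)
  then show ?case by (simp add: ref_star_def right_limit[OF w i, simplified])
next
  case (Suc j)
  have "cv_weight D i (Suc j) * deriv w (cv_point D i (Suc j)) =
      reference_weight meth k y (Suc j) * (cell_size D i / 2 * deriv w (cell_map i (y (Suc j))))"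
    by (simp add: cv_weight_def cv_point_cell_map)
  also have "\<dots> = reference_weight meth k y (Suc j) * poly (pderiv (P i)) (y (Suc j))"
    using Suc.prems by (subst deriv_cell_map[OF w i]) (auto intro: y_gt y_less)
  finally show ?case using Suc by (simp add: ref_star_def)
qed

definition inflow :: "(nat \<Rightarrow> real poly) \<Rightarrow> nat \<Rightarrow> real" where
  "inflow P i = (if i = 1 then (case bc of Homogeneous \<Rightarrow> 0 | Periodic \<Rightarrow> poly (P N) 1)
     else poly (P (i - 1)) 1)"

lemma left_trace_ref:
  assumes v: "cell_rep D v P" and i: "i \<in> {1..N}" and j: "j \<le> k + 1"
  shows "left_trace D v i j = (if j = 0 then inflow P i else poly (P i) (y j))"
proof (cases "j = 0")
  case False
  then show ?thesis
    using left_limit[OF v i, of "y j"] y_gt[of j] y_bounds[of j] j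
    by (simp add: left_trace_def cv_point_cell_map)
next
  case True
  show ?thesis
  proof (cases "i = 1")
    case True
    have "Lim (at_left (node D N)) v = poly (P N) 1"
      using left_limit[OF v, of N 1] N_pos by (simp add: cell_map_ends)
    then show ?thesis
      using True \<open>j = 0\<close> by (simp add: left_trace_def inflow_def split: boundary_condition.split)
  next
    case False
    then have "i - 1 \<in> {1..N}" using i by auto
    then have "Lim (at_left (node D (i - 1))) v = poly (P (i - 1)) 1"
      using left_limit[OF v, of "i - 1" 1] by (simp add: cell_map_ends)
    then show ?thesis
      using False \<open>j = 0\<close> by (simp add: left_trace_def inflow_def cv_point_cell_map y_ends cell_map_ends)
  qed
qed

lemma sv_form_cells:
  assumes v: "cell_rep D v V" and w: "cell_rep D w W"
  shows "sv_form D v w = (\<Sum>i\<in>{1..N}. cell_form (V i) (inflow V i) (W i))"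
proof -
  have deg: "degree (V i) \<le> k" "degree (W i) \<le> k" if "i \<in> {1..N}" for i
    using v w that by (auto simp: cell_rep_def)
  have cell: "(\<Sum>j\<in>{0..k}. star_val D w i j * (left_trace D v i (j + 1) - left_trace D v i j)) =
      (\<Sum>j\<in>{0..k}. ref_star meth k y (W i) j *
        (poly (V i) (y (j + 1)) - (if j = 0 then inflow V i else poly (V i) (y j))))"
    if i: "i \<in> {1..N}" for i
    by (intro sum.cong refl)
      (simp add: star_val_ref[OF w i] left_trace_ref[OF v i] del: star_val.simps)
  have "sv_form D v w = - (\<Sum>i\<in>{1..N}. \<Sum>j\<in>{0..k}. ref_star meth k y (W i) j *
      (poly (V i) (y (j + 1)) - (if j = 0 then inflow V i else poly (V i) (y j))))"
    unfolding sv_form_def D_simps by (rule arg_cong[where f = uminus], rule sum.cong[OF refl], rule cell)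
  also have "\<dots> = (\<Sum>i\<in>{1..N}. - (\<Sum>j\<in>{0..k}. ref_star meth k y (W i) j *
      (poly (V i) (y (j + 1)) - (if j = 0 then inflow V i else poly (V i) (y j)))))"
    by (rule sum_negf[symmetric])
  also have "\<dots> = (\<Sum>i\<in>{1..N}. cell_form (V i) (inflow V i) (W i))"
    by (intro sum.cong refl ref_form[OF y k] deg)
  finally show ?thesis .
qed

lemma integral_physical:
  assumes i: "i \<in> {1..N}" and "s \<le> t"
  shows "integral {cell_map i s..cell_map i t} (poly (physical i p)) = cell_size D i / 2 * integral {s..t} (poly p)"
proof -
  obtain V where V: "pderiv V = p" using poly_antiderivative[of p "degree p"] by blast
  define W where "W = Polynomial.smult (cell_size D i / 2) (physical i V)"
  have "pderiv W = physical i p"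
    using cell_size_pos[OF i] by (simp add: W_def pderiv_smult pderiv_physical V)
  then have "integral {cell_map i s..cell_map i t} (poly (physical i p)) =
      poly W (cell_map i t) - poly W (cell_map i s)"
    using integral_poly_pderiv[of "cell_map i s" "cell_map i t" W] assms by (simp add: cell_map_le)
  also have "\<dots> = cell_size D i / 2 * (poly V t - poly V s)"
    by (simp add: W_def poly_physical[OF i] algebra_simps)
  also have "poly V t - poly V s = integral {s..t} (poly p)"
    using integral_poly_pderiv[of s t V] assms V by simp
  finally show ?thesis .
qed

lemma node_mono: "i \<le> j \<Longrightarrow> j \<le> N \<Longrightarrow> node D i \<le> node D j"
proof (induction j rule: dec_induct)
  case (step m)
  then have "0 < cell_size D (Suc m)" by (intro cell_size_pos) auto
  then show ?case using step by (simp add: cell_size_def)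
qed simp

lemma L2_inner_star:
  assumes v: "cell_rep D v V" and w: "cell_rep D w W"
  shows "L2_inner D v (star D w) = (\<Sum>i\<in>{1..N}. cell_size D i / 2 *
    (\<Sum>j\<in>{0..k}. ref_star meth k y (W i) j * integral {y j..y (j + 1)} (poly (V i))))"
proof -
  let ?S = "\<lambda>i j. {cv_point D i j<..<cv_point D i (j + 1)}" and ?T = "{node D 0..node D N}"
  have piece: "((\<lambda>x. v x * (star_val D w i j * indicator (?S i j) x)) has_integral
      cell_size D i / 2 * (ref_star meth k y (W i) j * integral {y j..y (j + 1)} (poly (V i)))) ?T"
    if i: "i \<in> {1..N}" and j: "j \<in> {0..k}" for i j
  proof -
    let ?s = "ref_star meth k y (W i) j" and ?p = "physical i (V i)"
    have yj: "y j < y (j + 1)" using y j by (simp add: reference_points_def)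
    have sub: "node D (i - 1) \<le> cv_point D i j" "cv_point D i (j + 1) \<le> node D i"
      unfolding cv_point_cell_map cell_map_in_cell[OF i]
      using y_bounds[of j] y_bounds[of "j + 1"] j by auto
    have "i - 1 \<le> N" using i by auto
    then have ST: "?S i j \<subseteq> ?T"
      using sub node_mono[of 0 "i - 1"] node_mono[of i N] i by auto
    have "(poly ?p has_integral cell_size D i / 2 * integral {y j..y (j + 1)} (poly (V i)))
        {cv_point D i j..cv_point D i (j + 1)}"
      unfolding cv_point_cell_map
      using integral_physical[OF i less_imp_le[OF yj], of "V i"]
        integrable_integral[OF poly_integrable[of ?p]] by metis
    then have "((\<lambda>x. ?s * poly ?p x) has_integral
        ?s * (cell_size D i / 2 * integral {y j..y (j + 1)} (poly (V i)))) (?S i j)"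
      unfolding has_integral_Icc_iff_Ioo by (intro has_integral_mult_right)
    then have "((\<lambda>x. if x \<in> ?S i j then ?s * poly ?p x else 0) has_integral
        ?s * (cell_size D i / 2 * integral {y j..y (j + 1)} (poly (V i)))) ?T"
      by (simp only: has_integral_restrict[OF ST])
    moreover have "(\<lambda>x. if x \<in> ?S i j then ?s * poly ?p x else 0) =
        (\<lambda>x. v x * (star_val D w i j * indicator (?S i j) x))"
    proof
      fix x
      show "(if x \<in> ?S i j then ?s * poly ?p x else 0) = v x * (star_val D w i j * indicator (?S i j) x)"
        using sub j cell_rep_eq[OF v i, of x] star_val_ref[OF w i, of j]
        by (auto simp: indicator_def)
    qed
    ultimately show ?thesis by (simp add: mult_ac)
  qed
  have "((\<lambda>x. \<Sum>i\<in>{1..N}. \<Sum>j\<in>{0..k}. v x * (star_val D w i j * indicator (?S i j) x)) has_integral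
      (\<Sum>i\<in>{1..N}. \<Sum>j\<in>{0..k}. cell_size D i / 2 *
        (ref_star meth k y (W i) j * integral {y j..y (j + 1)} (poly (V i))))) ?T"
    by (intro has_integral_sum piece) auto
  then show ?thesis
    unfolding L2_inner_def star_def D_simps sum_distrib_left by (rule integral_unique)
qed

lemma L2_inner_cells:
  assumes e: "\<forall>v w. degree v \<le> k \<longrightarrow> degree w \<le> k \<longrightarrow>
      (\<Sum>j\<in>{0..k}. ref_star meth k y w j * integral {y j..y (j + 1)} (poly v)) = cell_inner k e v w"
    and v: "cell_rep D v V" and w: "cell_rep D w W"
  shows "L2_inner D v (star D w) = (\<Sum>i\<in>{1..N}. cell_size D i / 2 * cell_inner k e (V i) (W i))"
  unfolding L2_inner_star[OF v w]
proof (intro sum.cong refl)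
  fix i assume "i \<in> {1..N}"
  then have "degree (V i) \<le> k" "degree (W i) \<le> k" using v w by (auto simp: cell_rep_def)
  with e show "cell_size D i / 2 *
      (\<Sum>j\<in>{0..k}. ref_star meth k y (W i) j * integral {y j..y (j + 1)} (poly (V i))) =
    cell_size D i / 2 * cell_inner k e (V i) (W i)"
    by simp
qed

end


section \<open>Boundedness and the negative semidefinite symmetric part\<close>

text \<open>The Cauchy--Schwarz inequality for a semidefinite form, reduced to one real parameter.\<close>

lemma discriminant_bound:
  fixes A B C :: real
  assumes nonneg: "\<And>t. 0 \<le> A + 2 * t * B + t\<^sup>2 * C" and C: "0 \<le> C"
  shows "B\<^sup>2 \<le> A * C"
proof (cases "C = 0")
  case True
  have "B = 0"
  proof (rule ccontr)
    assume "B \<noteq> 0"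
    then have "A + 2 * (- (A + 1) / (2 * B)) * B = -1" by (simp add: field_simps)
    then show False using nonneg[of "- (A + 1) / (2 * B)"] True by simp
  qed
  then show ?thesis using True by simp
next
  case False
  have "0 \<le> A + 2 * (- B / C) * B + (- B / C)\<^sup>2 * C" by (rule nonneg)
  also have "\<dots> = A - B\<^sup>2 / C" using False by (simp add: field_simps power2_eq_square)
  finally show ?thesis using C False by (simp add: field_simps)
qed

lemma cell_inner_add_smult:
  "cell_inner k e (v + Polynomial.smult t w) (v + Polynomial.smult t w) =
    cell_inner k e v v + 2 * t * cell_inner k e v w + t\<^sup>2 * cell_inner k e w w"
proof -
  have "(v + Polynomial.smult t w) * (v + Polynomial.smult t w) =
      v * v + (Polynomial.smult t (v * w) + Polynomial.smult t (v * w)) + Polynomial.smult (t\<^sup>2) (w * w)"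
    by (simp only: distrib_left distrib_right mult_smult_left mult_smult_right smult_smult
        smult_add_right power2_eq_square add.assoc mult.commute[of w v])
  then show ?thesis
    unfolding cell_inner_def
    by (simp only: ref_integral_add ref_integral_smult coeff_add coeff_smult)
      (simp add: algebra_simps power2_eq_square)
qed

lemma cell_inner_nonneg: "0 \<le> e \<Longrightarrow> 0 \<le> cell_inner k e v v"
  using cell_inner_ge[of e v k] ref_integral_square_nonneg[of v] by linarith

lemma cell_inner_sum:
  "cell_inner k e (\<Sum>p\<in>A. Polynomial.smult (c p) (v p)) (\<Sum>q\<in>B. Polynomial.smult (d q) (w q)) =
    (\<Sum>p\<in>A. \<Sum>q\<in>B. c p * d q * cell_inner k e (v p) (w q))"
proof -
  have "ref_integral ((\<Sum>p\<in>A. Polynomial.smult (c p) (v p)) * (\<Sum>q\<in>B. Polynomial.smult (d q) (w q))) =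
      (\<Sum>p\<in>A. \<Sum>q\<in>B. c p * (d q * ref_integral (v p * w q)))"
    by (simp only: sum_product mult_smult_left mult_smult_right ref_integral_sum ref_integral_smult)
      (simp add: sum_distrib_left mult_ac)
  moreover have "e * coeff (\<Sum>p\<in>A. Polynomial.smult (c p) (v p)) k *
      coeff (\<Sum>q\<in>B. Polynomial.smult (d q) (w q)) k =
      (\<Sum>p\<in>A. \<Sum>q\<in>B. c p * (d q * (e * coeff (v p) k * coeff (w q) k)))"
    by (simp only: coeff_sum coeff_smult mult.assoc sum_product) (simp add: sum_distrib_left mult_ac)
  ultimately show ?thesis
    unfolding cell_inner_def by (simp add: sum.distrib[symmetric] algebra_simps)
qed

lemma square_sum_le: "(a + b)\<^sup>2 \<le> 2 * a\<^sup>2 + 2 * (b :: real)\<^sup>2"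
  using zero_le_power2[of "a - b"] unfolding power2_sum power2_diff by linarith

context sv_mesh
begin

definition global_inner :: "real \<Rightarrow> (nat \<Rightarrow> real poly) \<Rightarrow> (nat \<Rightarrow> real poly) \<Rightarrow> real" where
  "global_inner e V W = (\<Sum>i\<in>{1..N}. cell_size D i / 2 * cell_inner k e (V i) (W i))"

lemma global_inner_commute: "global_inner e V W = global_inner e W V"
  by (simp add: global_inner_def cell_inner_commute)

lemma global_inner_nonneg: "0 \<le> e \<Longrightarrow> 0 \<le> global_inner e V V"
  unfolding global_inner_def using cell_size_pos
  by (intro sum_nonneg mult_nonneg_nonneg cell_inner_nonneg) (auto intro: less_imp_le)

lemma global_inner_Cauchy_Schwarz:
  assumes e: "0 \<le> e"
  shows "(global_inner e V W)\<^sup>2 \<le> global_inner e V V * global_inner e W W"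
proof (rule discriminant_bound)
  fix t
  have "0 \<le> global_inner e (\<lambda>i. V i + Polynomial.smult t (W i)) (\<lambda>i. V i + Polynomial.smult t (W i))"
    by (rule global_inner_nonneg[OF e])
  then show "0 \<le> global_inner e V V + 2 * t * global_inner e V W + t\<^sup>2 * global_inner e W W"
    unfolding global_inner_def cell_inner_add_smult
    by (simp add: algebra_simps sum.distrib sum_distrib_left)
qed (rule global_inner_nonneg[OF e])

lemma global_inner_sum:
  "global_inner e (\<lambda>i. \<Sum>p\<in>A. Polynomial.smult (c p) (V p i)) (\<lambda>i. \<Sum>q\<in>A. Polynomial.smult (c q) (V q i)) =
    (\<Sum>p\<in>A. \<Sum>q\<in>A. c p * c q * global_inner e (V p) (V q))"
proof -
  have "global_inner e (\<lambda>i. \<Sum>p\<in>A. Polynomial.smult (c p) (V p i)) (\<lambda>i. \<Sum>q\<in>A. Polynomial.smult (c q) (V q i)) =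
      (\<Sum>i\<in>{1..N}. \<Sum>p\<in>A. \<Sum>q\<in>A. c p * c q * (cell_size D i / 2 * cell_inner k e (V p i) (V q i)))"
    unfolding global_inner_def cell_inner_sum by (simp add: sum_distrib_left mult_ac)
  also have "\<dots> = (\<Sum>p\<in>A. \<Sum>q\<in>A. \<Sum>i\<in>{1..N}. c p * c q * (cell_size D i / 2 * cell_inner k e (V p i) (V q i)))"
    by (simp only: sum.swap[of _ A "{1..N}"])
  finally show ?thesis by (simp only: global_inner_def sum_distrib_left)
qed

text \<open>The neighbour on the inflow side, where the first cell is preceded by the last one. This is a permutation of
  the cells, so that sums over inflow traces become sums over outflow traces.\<close>

definition upwind :: "nat \<Rightarrow> nat" where
  "upwind i = (if i = 1 then N else i - 1)"

lemma sum_upwind: "(\<Sum>i\<in>{1..N}. f (upwind i)) = (\<Sum>i\<in>{1..N}. f i :: real)"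
proof -
  have "bij_betw upwind {1..N} {1..N}"
  proof (rule bij_betw_byWitness[where f' = "\<lambda>i. if i = N then 1 else i + 1"])
  qed (use N_pos in \<open>auto simp: upwind_def\<close>)
  then show ?thesis by (rule sum.reindex_bij_betw)
qed

lemma inflow_upwind:
  "inflow V i = (if i = 1 \<and> bc = Homogeneous then 0 else poly (V (upwind i)) 1)"
  by (auto simp: inflow_def upwind_def split: boundary_condition.split)

text \<open>Index \<open>0\<close> is reserved for the outflow at the right end of the interval, which dissipates energy in the
  homogeneous case, when it does not flow back in at the left end.\<close>

definition jump :: "(nat \<Rightarrow> real poly) \<Rightarrow> nat \<Rightarrow> real" where
  "jump V i = (if i = 0 then (if bc = Homogeneous then poly (V N) 1 else 0)
     else poly (V i) (-1) - inflow V i)"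

lemma sum_jump_split: "(\<Sum>i\<in>{0..N}. f i) = f 0 + (\<Sum>i\<in>{1..N}. f i :: real)"
  by (simp add: sum.atLeast_Suc_atMost)

lemma sv_form_sym:
  assumes v: "cell_rep D v V" and w: "cell_rep D w W"
  shows "sv_form D v w + sv_form D w v = - (\<Sum>i\<in>{0..N}. jump V i * jump W i)"
proof -
  have "sv_form D v w + sv_form D w v =
      (\<Sum>i\<in>{1..N}. - (jump V i * jump W i) + (inflow V i * inflow W i - poly (V i) 1 * poly (W i) 1))"
    unfolding sv_form_cells[OF v w] sv_form_cells[OF w v] sum.distrib[symmetric]
    by (intro sum.cong refl) (simp add: cell_form_sym jump_def algebra_simps)
  also have "\<dots> = - (\<Sum>i\<in>{1..N}. jump V i * jump W i)
      + ((\<Sum>i\<in>{1..N}. inflow V i * inflow W i) - (\<Sum>i\<in>{1..N}. poly (V i) 1 * poly (W i) 1))"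
    by (simp only: sum.distrib sum_subtractf sum_negf)
  also have "(\<Sum>i\<in>{1..N}. inflow V i * inflow W i) =
      (\<Sum>i\<in>{1..N}. poly (V (upwind i)) 1 * poly (W (upwind i)) 1
        - (if i = 1 then jump V 0 * jump W 0 else 0))"
    by (intro sum.cong refl) (auto simp: inflow_upwind jump_def upwind_def)
  also have "\<dots> = (\<Sum>i\<in>{1..N}. poly (V i) 1 * poly (W i) 1) - jump V 0 * jump W 0"
    using N_pos sum_upwind[of "\<lambda>i. poly (V i) 1 * poly (W i) 1"] by (simp add: sum_subtractf)
  finally show ?thesis by (simp add: sum_jump_split)
qed

definition coeff_energy :: "(nat \<Rightarrow> real poly) \<Rightarrow> real" where
  "coeff_energy V = (\<Sum>i\<in>{1..N}. (coeff_norm k (V i))\<^sup>2)"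

lemma coeff_energy_nonneg: "0 \<le> coeff_energy V"
  by (simp add: coeff_energy_def sum_nonneg)

lemma upwind_in: "i \<in> {1..N} \<Longrightarrow> upwind i \<in> {1..N}"
  using N_pos by (auto simp: upwind_def)

lemma inflow_sum_le:
  assumes V: "\<And>i. i \<in> {1..N} \<Longrightarrow> degree (V i) \<le> k"
  shows "(\<Sum>i\<in>{1..N}. (inflow V i)\<^sup>2) \<le> coeff_energy V"
proof -
  have "(\<Sum>i\<in>{1..N}. (inflow V i)\<^sup>2) \<le> (\<Sum>i\<in>{1..N}. (coeff_norm k (V (upwind i)))\<^sup>2)"
  proof (intro sum_mono)
    fix i assume "i \<in> {1..N}"
    then have "\<bar>poly (V (upwind i)) 1\<bar> \<le> coeff_norm k (V (upwind i))"
      by (intro abs_poly_le_coeff_norm V upwind_in) auto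
    then have "\<bar>inflow V i\<bar> \<le> coeff_norm k (V (upwind i))"
      by (simp add: inflow_upwind coeff_norm_nonneg)
    then show "(inflow V i)\<^sup>2 \<le> (coeff_norm k (V (upwind i)))\<^sup>2"
      using coeff_norm_nonneg[of k "V (upwind i)"] by (simp add: abs_le_square_iff[symmetric])
  qed
  also have "\<dots> = coeff_energy V"
    unfolding coeff_energy_def by (rule sum_upwind)
  finally show ?thesis .
qed

lemma jump_sum_le:
  assumes V: "\<And>i. i \<in> {1..N} \<Longrightarrow> degree (V i) \<le> k"
  shows "(\<Sum>i\<in>{0..N}. (jump V i)\<^sup>2) \<le> 5 * coeff_energy V"
proof -
  have sq: "(poly (V i) t)\<^sup>2 \<le> (coeff_norm k (V i))\<^sup>2" if "i \<in> {1..N}" "\<bar>t\<bar> \<le> 1" for i t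
    using abs_poly_le_coeff_norm[OF V[OF that(1)] that(2)] coeff_norm_nonneg[of k "V i"]
    by (simp add: abs_le_square_iff[symmetric])
  have "(jump V 0)\<^sup>2 \<le> (coeff_norm k (V N))\<^sup>2"
    using sq[of N 1] N_pos by (simp add: jump_def)
  also have "\<dots> \<le> coeff_energy V"
    unfolding coeff_energy_def using N_pos
    by (intro member_le_sum[of N "{1..N}" "\<lambda>i. (coeff_norm k (V i))\<^sup>2"]) auto
  finally have J0: "(jump V 0)\<^sup>2 \<le> coeff_energy V" .
  have "(\<Sum>i\<in>{1..N}. (jump V i)\<^sup>2) \<le> (\<Sum>i\<in>{1..N}. 2 * (coeff_norm k (V i))\<^sup>2 + 2 * (inflow V i)\<^sup>2)"
  proof (intro sum_mono)
    fix i assume i: "i \<in> {1..N}"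
    have "(jump V i)\<^sup>2 = (poly (V i) (-1) + - inflow V i)\<^sup>2" using i by (simp add: jump_def)
    also have "\<dots> \<le> 2 * (poly (V i) (-1))\<^sup>2 + 2 * (- inflow V i)\<^sup>2" by (rule square_sum_le)
    also have "\<dots> \<le> 2 * (coeff_norm k (V i))\<^sup>2 + 2 * (inflow V i)\<^sup>2" using sq[OF i, of "-1"] by simp
    finally show "(jump V i)\<^sup>2 \<le> 2 * (coeff_norm k (V i))\<^sup>2 + 2 * (inflow V i)\<^sup>2" .
  qed
  also have "\<dots> = 2 * coeff_energy V + 2 * (\<Sum>i\<in>{1..N}. (inflow V i)\<^sup>2)"
    by (simp add: coeff_energy_def sum.distrib sum_distrib_left)
  also have "\<dots> \<le> 4 * coeff_energy V" using inflow_sum_le[OF V] by simp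
  finally show ?thesis using J0 by (simp add: sum_jump_split)
qed

text \<open>Neighbouring cells interact only through the inflow traces, so the Cauchy--Schwarz inequality for sums
  over cells suffices.\<close>

lemma sv_form_bound:
  assumes v: "cell_rep D v V" and w: "cell_rep D w W"
  shows "(sv_form D v w)\<^sup>2 \<le> (2 * (2 * real k + 1))\<^sup>2 * (coeff_energy V * coeff_energy W)"
proof -
  let ?c = "2 * real k + 1"
  have V: "degree (V i) \<le> k" and W: "degree (W i) \<le> k" if "i \<in> {1..N}" for i
    using v w that by (auto simp: cell_rep_def)
  define x where "x i = ?c * (coeff_norm k (V i) + \<bar>inflow V i\<bar>)" for i
  have "\<bar>sv_form D v w\<bar> \<le> (\<Sum>i\<in>{1..N}. x i * coeff_norm k (W i))"
    unfolding sv_form_cells[OF v w] x_def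
    by (rule order.trans[OF sum_abs], intro sum_mono) (use abs_cell_form_le V W in auto)
  then have "(sv_form D v w)\<^sup>2 \<le> (\<Sum>i\<in>{1..N}. x i * coeff_norm k (W i))\<^sup>2"
    by (metis abs_ge_zero power2_abs power_mono)
  also have "\<dots> \<le> (\<Sum>i\<in>{1..N}. (x i)\<^sup>2) * coeff_energy W"
    unfolding coeff_energy_def by (rule Cauchy_Schwarz_ineq_sum)
  also have "\<dots> \<le> ((2 * ?c)\<^sup>2 * coeff_energy V) * coeff_energy W"
  proof (intro mult_right_mono coeff_energy_nonneg)
    have "(\<Sum>i\<in>{1..N}. (x i)\<^sup>2) \<le> (\<Sum>i\<in>{1..N}. ?c\<^sup>2 * (2 * (coeff_norm k (V i))\<^sup>2 + 2 * (inflow V i)\<^sup>2))"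
      unfolding x_def power_mult_distrib
    proof (intro sum_mono mult_left_mono)
      show "(coeff_norm k (V i) + \<bar>inflow V i\<bar>)\<^sup>2 \<le> 2 * (coeff_norm k (V i))\<^sup>2 + 2 * (inflow V i)\<^sup>2" for i
        using square_sum_le[of "coeff_norm k (V i)" "\<bar>inflow V i\<bar>"] by simp
    qed simp
    also have "\<dots> = ?c\<^sup>2 * (2 * coeff_energy V + 2 * (\<Sum>i\<in>{1..N}. (inflow V i)\<^sup>2))"
      by (simp only: coeff_energy_def sum.distrib[symmetric] sum_distrib_left)
    also have "\<dots> \<le> ?c\<^sup>2 * (4 * coeff_energy V)"
      using inflow_sum_le[OF V] by (intro mult_left_mono) auto
    also have "\<dots> = (2 * ?c)\<^sup>2 * coeff_energy V" by (simp only: power_mult_distrib) simp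
    finally show "(\<Sum>i\<in>{1..N}. (x i)\<^sup>2) \<le> (2 * ?c)\<^sup>2 * coeff_energy V" .
  qed
  finally show ?thesis by (simp only: mult.assoc)
qed

lemma mesh_size_bounds:
  assumes "0 < \<alpha>star"
  shows "0 < mesh_size D" and "i \<in> {1..N} \<Longrightarrow> \<alpha>star * mesh_size D \<le> cell_size D i"
proof -
  have "cell_size D 1 \<le> mesh_size D"
    unfolding mesh_size_def using N_pos by (intro Max_ge) auto
  then show "0 < mesh_size D" using cell_size_pos[of 1] N_pos by simp
  assume "i \<in> {1..N}"
  then have "Min (cell_size D ` {1..N}) \<le> cell_size D i" by (intro Min_le) auto
  then show "\<alpha>star * mesh_size D \<le> cell_size D i" using D by (auto simp: regular_family_def)
qed

text \<open>This is the inverse inequality. The factor \<open>1 / mesh_size D\<close> comes from the Jacobian \<open>cell_size D i / 2\<close>;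
  mesh regularity makes it uniform over the cells.\<close>

lemma coeff_energy_le:
  assumes \<alpha>: "0 < \<alpha>star" and e: "0 \<le> e" and C: "0 \<le> C"
    and CN: "\<And>p. degree p \<le> k \<Longrightarrow> (coeff_norm k p)\<^sup>2 \<le> C * ref_integral (p * p)"
    and V: "\<And>i. i \<in> {1..N} \<Longrightarrow> degree (V i) \<le> k"
  shows "coeff_energy V \<le> 2 * C / \<alpha>star / mesh_size D * global_inner e V V"
  unfolding coeff_energy_def global_inner_def sum_distrib_left
proof (intro sum_mono)
  fix i assume i: "i \<in> {1..N}"
  note h = mesh_size_bounds(1)[OF \<alpha>] mesh_size_bounds(2)[OF \<alpha> i]
  have "(coeff_norm k (V i))\<^sup>2 \<le> C * ref_integral (V i * V i)" by (intro CN V i)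
  also have "\<dots> \<le> C * cell_inner k e (V i) (V i)"
    by (intro mult_left_mono cell_inner_ge e C)
  also have "\<dots> \<le> (cell_size D i / (\<alpha>star * mesh_size D)) * (C * cell_inner k e (V i) (V i))"
  proof -
    have "1 \<le> cell_size D i / (\<alpha>star * mesh_size D)" using h \<alpha> by simp
    then have "1 * (C * cell_inner k e (V i) (V i)) \<le>
        (cell_size D i / (\<alpha>star * mesh_size D)) * (C * cell_inner k e (V i) (V i))"
      using C cell_inner_nonneg[OF e] by (intro mult_right_mono) auto
    then show ?thesis by simp
  qed
  also have "\<dots> = 2 * C / \<alpha>star / mesh_size D * (cell_size D i / 2 * cell_inner k e (V i) (V i))"
    by simp
  finally show "(coeff_norm k (V i))\<^sup>2 \<le>
      2 * C / \<alpha>star / mesh_size D * (cell_size D i / 2 * cell_inner k e (V i) (V i))" .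
qed

end

lemma diff_coeff_above:
  assumes "p < l" "l \<le> s"
  shows "diff_coeff s p l = 0"
proof (cases p)
  case 0
  then show ?thesis using assms by simp
next
  case (Suc p')
  have "stage_increment s m l = 0" if "m \<le> p'" for m
    using that assms Suc by (simp add: stage_increment_def)
  then show ?thesis by (simp add: Suc)
qed


section \<open>Stability of the scheme\<close>

lemma le_from_square:
  fixes x c z :: real
  assumes "x\<^sup>2 \<le> c * (z * x)" "0 \<le> x" "0 \<le> c" "0 \<le> z"
  shows "x \<le> c * z"
proof (cases "x = 0")
  case False
  then have "x * x \<le> (c * z) * x" using assms(1) by (simp add: power2_eq_square mult.assoc)
  then show ?thesis using False assms(2) by (simp add: mult_le_cancel_right)
qed (use assms in simp)

lemma smult_sum_right:
  "Polynomial.smult c (\<Sum>i\<in>A. f i) = (\<Sum>i\<in>A. Polynomial.smult c (f i))"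
  by (induction A rule: infinite_finite_induct) (simp_all add: smult_add_right)

text \<open>The scheme enters only here. The constant \<open>K\<close> depends on the reference points, the degree and the mesh
  regularity, but not on the mesh, the time step or the solution.\<close>

lemma stage_gram_of_scheme:
  fixes y :: "nat \<Rightarrow> real"
  assumes y: "reference_points meth k y" and k: "1 \<le> k" and \<alpha>: "0 < \<alpha>star"
    and ev: "evolution_coeffs s \<alpha>"
  shows "\<exists>K\<ge>1. \<forall>D\<in>regular_family meth bc k y a b \<alpha>star. \<forall>\<tau> u n.
    0 < \<tau> \<and> \<tau> / mesh_size D \<le> 1 \<and> rksv_solution D s \<tau> u \<longrightarrow>
    (\<exists>G. stage_gram s K \<tau> (\<tau> / mesh_size D) G \<and> G 0 0 = sv_norm_sq D (u n 0) \<and>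
      (\<alpha> 0)\<^sup>2 * (sv_norm_sq D (u (Suc n) 0) - sv_norm_sq D (u n 0)) = stage_energy s (transfer_a s \<alpha> 0) G)"
proof -
  obtain e where e: "0 \<le> e" and mass: "\<forall>v w. degree v \<le> k \<longrightarrow> degree w \<le> k \<longrightarrow>
      (\<Sum>j\<in>{0..k}. ref_star meth k y w j * integral {y j..y (j + 1)} (poly v)) = cell_inner k e v w"
    using ref_mass[OF y k] by blast
  obtain C where C: "0 \<le> C" and CN: "\<And>p. degree p \<le> k \<Longrightarrow> (coeff_norm k p)\<^sup>2 \<le> C * ref_integral (p * p)"
    using coeff_norm_le_L2[of k k] by blast
  define Q where "Q = 2 * C / \<alpha>star"
  define c where "c = 2 * (2 * real k + 1)"
  \<comment> \<open>The jumps need \<open>5 * Q\<close>, the ratio of successive temporal differences \<open>c * Q\<close>.\<close>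
  define K where "K = 1 + 5 * Q + c * Q"
  have Q: "0 \<le> Q" using C \<alpha> by (simp add: Q_def)
  have K: "1 \<le> K" "5 * Q \<le> K" "c * Q \<le> K" using Q by (simp_all add: K_def c_def)
  have "\<exists>G. stage_gram s K \<tau> (\<tau> / mesh_size D) G \<and> G 0 0 = sv_norm_sq D (u n 0) \<and>
      (\<alpha> 0)\<^sup>2 * (sv_norm_sq D (u (Suc n) 0) - sv_norm_sq D (u n 0)) = stage_energy s (transfer_a s \<alpha> 0) G"
    if D: "D \<in> regular_family meth bc k y a b \<alpha>star"
      and \<tau>: "0 < \<tau>" "\<tau> / mesh_size D \<le> 1" and u: "rksv_solution D s \<tau> u" for D \<tau> u n
  proof -
    interpret sv_mesh meth bc k y a b \<alpha>star D
      by unfold_locales (fact y k D)+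
    define h where "h = mesh_size D"
    define \<mu> where "\<mu> = \<tau> / h"
    have h: "0 < h" unfolding h_def by (rule mesh_size_bounds(1)[OF \<alpha>])
    have \<mu>: "0 \<le> \<mu>" "\<mu> \<le> 1" using \<tau> h by (simp_all add: \<mu>_def h_def)
    have "\<forall>l. \<exists>U. l \<le> s \<longrightarrow> cell_rep D (u n l) U"
      using u trial_space_iff_cell_rep unfolding rksv_solution_def by blast
    then obtain U where U: "\<And>l. l \<le> s \<Longrightarrow> cell_rep D (u n l) (U l)"
      by (elim choice[THEN exE]) blast
    define d where "d p = (\<lambda>x. \<Sum>l\<in>{0..p}. diff_coeff s p l * u n l x)" for p
    define P where "P p = (\<lambda>i. \<Sum>l\<in>{0..p}. Polynomial.smult (diff_coeff s p l) (U l i))" for p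
    have rep: "cell_rep D (d p) (P p)" if "p \<le> s" for p
      unfolding d_def P_def using that by (intro cell_rep_sum U) auto
    have deg: "degree (P p i) \<le> k" if "p \<le> s" "i \<in> {1..N}" for p i
      using rep[OF that(1)] that(2) by (simp add: cell_rep_def)
    have trial: "d p \<in> trial_space D" if "p \<le> s" for p
      using rep[OF that] trial_space_iff_cell_rep by blast
    define G where "G p q = global_inner e (P p) (P q)" for p q
    have inner: "L2_inner D v (star D w) = global_inner e V W"
      if "cell_rep D v V" "cell_rep D w W" for v w V W
      unfolding global_inner_def by (rule L2_inner_cells[OF mass that])
    have step: "G (Suc p) q = \<tau> * sv_form D (d p) (d q)" if "p < s" "q \<le> s" for p q
    proof -
      have "G (Suc p) q = L2_inner D (d (Suc p)) (star D (d q))"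
        unfolding G_def using that by (intro inner[symmetric] rep) auto
      also have "\<dots> = \<tau> * sv_form D (d p) (d q)"
        using temporal_difference[OF y D u, of "Suc p" "d q" n] trial[of q] that
        unfolding d_def by (simp del: diff_coeff.simps)
      finally show ?thesis .
    qed
    have G0: "0 \<le> G p p" for p unfolding G_def by (rule global_inner_nonneg[OF e])
    have Gsym: "G p q = G q p" for p q unfolding G_def by (rule global_inner_commute)
    have energy: "coeff_energy (P p) \<le> Q / h * G p p" if "p \<le> s" for p
      using coeff_energy_le[OF \<alpha> e C CN deg[OF that]] by (simp add: Q_def h_def G_def)
    have decay: "G (Suc p) (Suc p) \<le> (K * \<mu>)\<^sup>2 * G p p" if p: "p < s" for p
    proof (rule le_from_square)
      let ?x = "G (Suc p) (Suc p)"
      have "?x = \<tau> * sv_form D (d p) (d (Suc p))" using step[of p "Suc p"] p by simp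
      then have "?x\<^sup>2 = \<tau>\<^sup>2 * (sv_form D (d p) (d (Suc p)))\<^sup>2" by (simp only: power_mult_distrib)
      also have "\<dots> \<le> \<tau>\<^sup>2 * (c\<^sup>2 * (coeff_energy (P p) * coeff_energy (P (Suc p))))"
        unfolding c_def using p by (intro mult_left_mono sv_form_bound rep) auto
      also have "\<dots> \<le> \<tau>\<^sup>2 * (c\<^sup>2 * ((Q / h * G p p) * (Q / h * ?x)))"
        using p Q h G0 by (intro mult_left_mono mult_mono energy coeff_energy_nonneg) auto
      also have "\<dots> = (c * Q * \<mu>)\<^sup>2 * (G p p * ?x)"
        by (simp add: \<mu>_def power2_eq_square)
      also have "\<dots> \<le> (K * \<mu>)\<^sup>2 * (G p p * ?x)"
        using K(3) Q \<mu> G0 by (intro mult_right_mono power_mono) (auto simp: c_def)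
      finally show "?x\<^sup>2 \<le> (K * \<mu>)\<^sup>2 * (G p p * ?x)" .
    qed (use G0 in auto)
    have skew: "G (Suc p) q + G p (Suc q) = - \<tau> * (\<Sum>i\<in>{0..N}. jump (P p) i * jump (P q) i)"
      if "p < s" "q < s" for p q
    proof -
      have "G (Suc p) q + G p (Suc q) = \<tau> * (sv_form D (d p) (d q) + sv_form D (d q) (d p))"
        using step[of p q] step[of q p] Gsym[of p "Suc q"] that by (simp add: distrib_left)
      then show ?thesis using sv_form_sym[OF rep rep, of p q] that by simp
    qed
    have jumps: "\<tau> * (\<Sum>i\<in>{0..N}. (jump (P p) i)\<^sup>2) \<le> K * \<mu> * G p p" if p: "p \<le> s" for p
    proof -
      have "(\<Sum>i\<in>{0..N}. (jump (P p) i)\<^sup>2) \<le> 5 * (Q / h * G p p)"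
      proof -
        have "(\<Sum>i\<in>{0..N}. (jump (P p) i)\<^sup>2) \<le> 5 * coeff_energy (P p)"
          by (rule jump_sum_le) (rule deg[OF p])
        then show ?thesis using energy[OF p] by linarith
      qed
      then have "\<tau> * (\<Sum>i\<in>{0..N}. (jump (P p) i)\<^sup>2) \<le> \<tau> * (5 * (Q / h * G p p))"
        using \<tau> by (intro mult_left_mono) auto
      also have "\<dots> = 5 * Q * \<mu> * G p p" by (simp add: \<mu>_def)
      also have "\<dots> \<le> K * \<mu> * G p p"
        using K(2) \<mu> G0 by (intro mult_right_mono) auto
      finally show ?thesis .
    qed
    have gram: "stage_gram s K \<tau> \<mu> G"
      unfolding stage_gram_def
    proof (intro conjI allI impI)
      show "(G p q)\<^sup>2 \<le> G p p * G q q" for p q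
        unfolding G_def by (rule global_inner_Cauchy_Schwarz[OF e])
      show "\<exists>(I :: nat set) J. finite I \<and>
        (\<forall>p<s. \<forall>q<s. G (Suc p) q + G p (Suc q) = - \<tau> * (\<Sum>i\<in>I. J i p * J i q)) \<and>
        (\<forall>p\<le>s. \<tau> * (\<Sum>i\<in>I. (J i p)\<^sup>2) \<le> K * \<mu> * G p p)"
        using skew jumps by (intro exI[of _ "{0..N}"] exI[of _ "\<lambda>i p. jump (P p) i"]) auto
    qed (use \<tau> \<mu> G0 Gsym decay in auto)
    have G00: "G 0 0 = sv_norm_sq D (u n 0)"
    proof -
      have "d 0 = u n 0" by (simp add: d_def)
      then show ?thesis unfolding sv_norm_sq_def G_def using inner[OF rep rep, of 0 0] by simp
    qed
    have P_all: "P p i = (\<Sum>l\<in>{0..s}. Polynomial.smult (diff_coeff s p l) (U l i))" if "p \<le> s" for p i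
      unfolding P_def using that by (intro sum.mono_neutral_left) (auto simp: diff_coeff_above)
    have evol: "Polynomial.smult (\<alpha> 0) (U s i) = (\<Sum>p\<in>{..s}. Polynomial.smult (\<alpha> p) (P p i))" for i
    proof -
      have "(\<Sum>p\<in>{..s}. Polynomial.smult (\<alpha> p) (P p i)) =
          (\<Sum>p\<in>{..s}. \<Sum>l\<in>{0..s}. Polynomial.smult (\<alpha> p * diff_coeff s p l) (U l i))"
        by (intro sum.cong refl) (simp add: P_all smult_sum_right)
      also have "\<dots> = (\<Sum>l\<in>{0..s}. Polynomial.smult (\<Sum>p\<in>{0..s}. \<alpha> p * diff_coeff s p l) (U l i))"
        by (subst sum.swap) (simp add: smult_sum atLeast0AtMost)
      also have "\<dots> = (\<Sum>l\<in>{0..s}. if l = s then Polynomial.smult (\<alpha> 0) (U l i) else 0)"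
      proof (intro sum.cong refl)
        fix l assume "l \<in> {0..s}"
        then have "(\<Sum>p\<in>{0..s}. \<alpha> p * diff_coeff s p l) = \<alpha> 0 * of_bool (l = s)"
          using ev by (simp add: evolution_coeffs_def)
        then show "Polynomial.smult (\<Sum>p\<in>{0..s}. \<alpha> p * diff_coeff s p l) (U l i) =
            (if l = s then Polynomial.smult (\<alpha> 0) (U l i) else 0)" by simp
      qed
      finally show ?thesis by simp
    qed
    have "(\<alpha> 0)\<^sup>2 * sv_norm_sq D (u (Suc n) 0) =
        global_inner e (\<lambda>i. \<Sum>l\<in>{s}. Polynomial.smult (\<alpha> 0) (U l i)) (\<lambda>i. \<Sum>l\<in>{s}. Polynomial.smult (\<alpha> 0) (U l i))"
    proof -
      have "sv_norm_sq D (u (Suc n) 0) = global_inner e (U s) (U s)"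
        using u inner[OF U U, of s s] unfolding sv_norm_sq_def rksv_solution_def by simp
      then show ?thesis
        using global_inner_sum[where A = "{s}" and c = "\<lambda>_. \<alpha> 0" and V = U]
        by (simp add: power2_eq_square)
    qed
    also have "\<dots> = (\<Sum>p\<le>s. \<Sum>q\<le>s. \<alpha> p * \<alpha> q * G p q)"
      using global_inner_sum[of e \<alpha> P "{..s}"] by (simp add: evol G_def)
    also have "\<dots> = stage_energy s (transfer_a s \<alpha> 0) G + (\<alpha> 0)\<^sup>2 * G 0 0"
    proof -
      have "stage_energy s (transfer_a s \<alpha> 0) G =
        (\<Sum>p\<le>s. \<Sum>q\<le>s. \<alpha> p * \<alpha> q * G p q - (if p = 0 then if q = 0 then (\<alpha> 0)\<^sup>2 * G 0 0 else 0 else 0))"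
        unfolding stage_energy_def by (intro sum.cong refl) (auto simp: power2_eq_square)
      also have "\<dots> = (\<Sum>p\<le>s. \<Sum>q\<le>s. \<alpha> p * \<alpha> q * G p q) -
          (\<Sum>p\<le>s. if p = 0 then \<Sum>q\<le>s. if q = 0 then (\<alpha> 0)\<^sup>2 * G 0 0 else 0 else 0)"
        unfolding sum_subtractf by (intro arg_cong2[where f = minus] refl sum.cong) auto
      finally show ?thesis by simp
    qed
    finally have "(\<alpha> 0)\<^sup>2 * (sv_norm_sq D (u (Suc n) 0) - sv_norm_sq D (u n 0)) =
        stage_energy s (transfer_a s \<alpha> 0) G"
      using G00 by (simp add: right_diff_distrib del: transfer_a.simps)
    then show ?thesis using gram G00 unfolding \<mu>_def h_def by blast
  qed
  then show ?thesis using K(1) by blast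
qed

text \<open>The numbers \<open>gz\<close> and \<open>gr\<close> are the squared norms of the temporal differences of orders \<open>z\<close> and \<open>r\<close>.\<close>

lemma one_step_estimate:
  fixes y :: "nat \<Rightarrow> real"
  assumes y: "reference_points meth k y" and k: "1 \<le> k" and \<alpha>: "0 < \<alpha>star"
    and ev: "evolution_coeffs s \<alpha>" and nz: "transfer_a s \<alpha> z z z \<noteq> 0"
    and z: "z = termination_index s \<alpha>" and r: "r = contribution_index s \<alpha>"
  shows "\<exists>C>0. \<forall>D\<in>regular_family meth bc k y a b \<alpha>star. \<forall>\<tau> u n.
    0 < \<tau> \<and> \<tau> / mesh_size D \<le> 1 \<and> rksv_solution D s \<tau> u \<longrightarrow>
    (\<exists>gz gr. 0 \<le> gz \<and> 0 \<le> gr \<and> (r = z \<longrightarrow> gr = gz) \<and>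
      gz \<le> C * (\<tau> / mesh_size D) ^ (2 * z) * sv_norm_sq D (u n 0) \<and>
      gr \<le> C * (\<tau> / mesh_size D) ^ (2 * r) * sv_norm_sq D (u n 0) \<and>
      0 \<le> sv_norm_sq D (u n 0) \<and>
      (\<alpha> 0)\<^sup>2 * (sv_norm_sq D (u (Suc n) 0) - sv_norm_sq D (u n 0)) \<le>
        (transfer_a s \<alpha> z z z + C * (\<tau> / mesh_size D)) * gz + C * (\<tau> / mesh_size D) * gr)"
proof -
  obtain K where K: "1 \<le> K" and sch: "\<forall>D\<in>regular_family meth bc k y a b \<alpha>star. \<forall>\<tau> u n.
    0 < \<tau> \<and> \<tau> / mesh_size D \<le> 1 \<and> rksv_solution D s \<tau> u \<longrightarrow>
    (\<exists>G. stage_gram s K \<tau> (\<tau> / mesh_size D) G \<and> G 0 0 = sv_norm_sq D (u n 0) \<and>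
      (\<alpha> 0)\<^sup>2 * (sv_norm_sq D (u (Suc n) 0) - sv_norm_sq D (u n 0)) = stage_energy s (transfer_a s \<alpha> 0) G)"
    using stage_gram_of_scheme[OF y k \<alpha> ev] by blast
  note inc = energy_increment[OF K nz z r]
  obtain c where c: "0 < c" and en: "\<forall>\<tau> \<mu> G. stage_gram s K \<tau> \<mu> G \<longrightarrow>
    stage_energy s (transfer_a s \<alpha> 0) G \<le>
      transfer_a s \<alpha> z z z * G z z + c * \<mu> * G z z + c * \<mu> * G r r"
    using inc(1) by (elim exE conjE)
  define C where "C = c + K ^ (2 * s)"
  have Ks: "K ^ (2 * p) \<le> C" if "p \<le> s" for p
  proof -
    have "K ^ (2 * p) \<le> K ^ (2 * s)" using K that by (intro power_increasing) auto
    then show ?thesis using c by (simp add: C_def)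
  qed
  have C: "0 < C" "c \<le> C" using c K by (simp_all add: C_def add_pos_nonneg)
  have "\<exists>gz gr. 0 \<le> gz \<and> 0 \<le> gr \<and> (r = z \<longrightarrow> gr = gz) \<and>
      gz \<le> C * (\<tau> / mesh_size D) ^ (2 * z) * sv_norm_sq D (u n 0) \<and>
      gr \<le> C * (\<tau> / mesh_size D) ^ (2 * r) * sv_norm_sq D (u n 0) \<and>
      0 \<le> sv_norm_sq D (u n 0) \<and>
      (\<alpha> 0)\<^sup>2 * (sv_norm_sq D (u (Suc n) 0) - sv_norm_sq D (u n 0)) \<le>
        (transfer_a s \<alpha> z z z + C * (\<tau> / mesh_size D)) * gz + C * (\<tau> / mesh_size D) * gr"
    if D: "D \<in> regular_family meth bc k y a b \<alpha>star"
      and \<tau>: "0 < \<tau>" "\<tau> / mesh_size D \<le> 1" "rksv_solution D s \<tau> u" for D \<tau> u n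
  proof -
    define \<mu> where "\<mu> = \<tau> / mesh_size D"
    obtain G where G: "stage_gram s K \<tau> \<mu> G" "G 0 0 = sv_norm_sq D (u n 0)"
      "(\<alpha> 0)\<^sup>2 * (sv_norm_sq D (u (Suc n) 0) - sv_norm_sq D (u n 0)) = stage_energy s (transfer_a s \<alpha> 0) G"
      using sch D \<tau> unfolding \<mu>_def by blast
    have \<mu>: "0 \<le> \<mu>" and G0: "\<And>p. 0 \<le> G p p" using G(1) by (auto simp: stage_gram_def)
    have bound: "G p p \<le> C * \<mu> ^ (2 * p) * sv_norm_sq D (u n 0)" if "p \<le> s" for p
    proof -
      have "G p p \<le> (K * \<mu>) ^ (2 * (p - 0)) * G 0 0"
        by (rule stage_gram_decay[OF G(1) _ that]) simp
      also have "\<dots> = K ^ (2 * p) * (\<mu> ^ (2 * p) * G 0 0)" by (simp add: power_mult_distrib)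
      also have "\<dots> \<le> C * (\<mu> ^ (2 * p) * G 0 0)"
        using Ks[OF that] \<mu> G0 by (intro mult_right_mono) auto
      finally show ?thesis by (simp add: G(2) mult.assoc)
    qed
    have "c * \<mu> * G p p \<le> C * \<mu> * G p p" for p
      using C \<mu> G0 by (intro mult_right_mono) auto
    from this[of z] this[of r] en[rule_format, OF G(1)]
    have "(\<alpha> 0)\<^sup>2 * (sv_norm_sq D (u (Suc n) 0) - sv_norm_sq D (u n 0)) \<le>
        (transfer_a s \<alpha> z z z + C * \<mu>) * G z z + C * \<mu> * G r r"
      unfolding G(3) by (simp only: distrib_right)
    then show ?thesis
      using bound[of z] bound[of r] inc(2,3) G0 G(2)[symmetric] unfolding \<mu>_def
      by (intro exI[of _ "G z z"] exI[of _ "G r r"]) simp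
  qed
  then show ?thesis using C(1) by blast
qed

lemma mesh_ratio_pos:
  assumes "reference_points meth k y" "1 \<le> k" "0 < \<alpha>star" "D \<in> regular_family meth bc k y a b \<alpha>star" "0 < \<tau>"
  shows "0 < \<tau> / mesh_size D"
proof -
  interpret sv_mesh meth bc k y a b \<alpha>star D by unfold_locales (fact assms)+
  show ?thesis using mesh_size_bounds(1) assms by simp
qed

theorem theorem4p2:
  fixes s k :: nat and meth :: sv_method and bc :: boundary_condition
    and y \<alpha> :: "nat \<Rightarrow> real" and a b T \<alpha>star :: real
  assumes "1 \<le> s" and "1 \<le> k"
    and "a < b" and "0 < T" and "0 < \<alpha>star"
    and "reference_points meth k y"
    and "evolution_coeffs s \<alpha>"
  shows "let \<F> = regular_family meth bc k y a b \<alpha>star;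
             \<zeta> = termination_index s \<alpha>;
             \<rho> = contribution_index s \<alpha>;
             a\<zeta> = transfer_a s \<alpha> \<zeta> \<zeta> \<zeta>
         in (a\<zeta> < 0 \<and> \<rho> = \<zeta> \<longrightarrow> monotonicity_stable \<F> s T) \<and>
            (a\<zeta> < 0 \<and> \<rho> < \<zeta> \<longrightarrow> weakly_stable (2 * \<rho> + 1) \<F> s T) \<and>
            (a\<zeta> > 0 \<longrightarrow> weakly_stable (min (2 * \<zeta>) (2 * \<rho> + 1)) \<F> s T)"
proof -
  let ?F = "regular_family meth bc k y a b \<alpha>star"
  define z where "z = termination_index s \<alpha>"
  define r where "r = contribution_index s \<alpha>"
  define A where "A = transfer_a s \<alpha> z z z"
  have \<alpha>0: "0 < (\<alpha> 0)\<^sup>2" using assms(7) by (simp add: evolution_coeffs_def)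
  have pos: "0 < \<tau>" "0 < \<tau> / mesh_size D" if "D \<in> ?F" "1 \<le> M" "\<tau> = T / real M" for D M \<tau>
  proof -
    show "0 < \<tau>" using that assms(4) by simp
    then show "0 < \<tau> / mesh_size D"
      using mesh_ratio_pos[OF assms(6,2,5) that(1)] by blast
  qed
  have est: "\<exists>C>0. \<forall>D\<in>?F. \<forall>\<tau> u n.
    0 < \<tau> \<and> \<tau> / mesh_size D \<le> 1 \<and> rksv_solution D s \<tau> u \<longrightarrow>
    (\<exists>gz gr. 0 \<le> gz \<and> 0 \<le> gr \<and> (r = z \<longrightarrow> gr = gz) \<and>
      gz \<le> C * (\<tau> / mesh_size D) ^ (2 * z) * sv_norm_sq D (u n 0) \<and>
      gr \<le> C * (\<tau> / mesh_size D) ^ (2 * r) * sv_norm_sq D (u n 0) \<and>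
      0 \<le> sv_norm_sq D (u n 0) \<and>
      (\<alpha> 0)\<^sup>2 * (sv_norm_sq D (u (Suc n) 0) - sv_norm_sq D (u n 0)) \<le>
        (A + C * (\<tau> / mesh_size D)) * gz + C * (\<tau> / mesh_size D) * gr)" if "A \<noteq> 0"
    using one_step_estimate[OF assms(6,2,5,7) _ z_def r_def] that unfolding A_def by blast
  have case1: "monotonicity_stable ?F s T" if A: "A < 0" and rz: "r = z"
  proof -
    obtain C where C: "0 < C" and bound: "\<And>D \<tau> u n. D \<in> ?F \<Longrightarrow> 0 < \<tau> \<Longrightarrow> \<tau> / mesh_size D \<le> 1 \<Longrightarrow>
      rksv_solution D s \<tau> u \<Longrightarrow> \<exists>g\<ge>0.
      (\<alpha> 0)\<^sup>2 * (sv_norm_sq D (u (Suc n) 0) - sv_norm_sq D (u n 0)) \<le>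
        (A + C * (\<tau> / mesh_size D)) * g + C * (\<tau> / mesh_size D) * g"
      using est A rz by (metis less_irrefl)
    \<comment> \<open>As \<open>r = z\<close>, both error terms are absorbed by the negative leading term.\<close>
    define L where "L = min 1 (- A / (2 * C))"
    have L: "0 < L" "L \<le> 1" "2 * C * L \<le> - A"
      using A C by (auto simp: L_def min_def field_simps)
    have "sv_norm_sq D (u (Suc n) 0) \<le> sv_norm_sq D (u n 0)"
      if D: "D \<in> ?F" and M: "1 \<le> M" "\<tau> = T / real M" and \<mu>: "\<tau> / mesh_size D \<le> L"
        and u: "rksv_solution D s \<tau> u" for D M \<tau> u n
    proof -
      let ?\<mu> = "\<tau> / mesh_size D"
      obtain g where g: "0 \<le> g" "(\<alpha> 0)\<^sup>2 * (sv_norm_sq D (u (Suc n) 0) - sv_norm_sq D (u n 0)) \<le>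
          (A + C * ?\<mu>) * g + C * ?\<mu> * g"
        using bound[OF D pos(1)[OF D M] _ u, of n] \<mu> L by auto
      have "2 * C * ?\<mu> \<le> 2 * C * L" using \<mu> C by (intro mult_left_mono) auto
      then have "(A + 2 * C * ?\<mu>) * g \<le> 0"
        using L g(1) by (intro mult_nonpos_nonneg) auto
      then have "(\<alpha> 0)\<^sup>2 * (sv_norm_sq D (u (Suc n) 0) - sv_norm_sq D (u n 0)) \<le> 0"
        using g(2) by (simp add: distrib_right)
      then show ?thesis using \<alpha>0 by (simp add: mult_le_0_iff)
    qed
    then show ?thesis unfolding monotonicity_stable_def using L(1) by blast
  qed
  have case2: "weakly_stable (2 * r + 1) ?F s T" if A: "A < 0"
  proof -
    obtain C where C: "0 < C" and bound: "\<forall>D\<in>?F. \<forall>\<tau> u n.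
      0 < \<tau> \<and> \<tau> / mesh_size D \<le> 1 \<and> rksv_solution D s \<tau> u \<longrightarrow>
      (\<exists>gz gr. 0 \<le> gz \<and> 0 \<le> gr \<and> (r = z \<longrightarrow> gr = gz) \<and>
      gz \<le> C * (\<tau> / mesh_size D) ^ (2 * z) * sv_norm_sq D (u n 0) \<and>
      gr \<le> C * (\<tau> / mesh_size D) ^ (2 * r) * sv_norm_sq D (u n 0) \<and>
      0 \<le> sv_norm_sq D (u n 0) \<and>
      (\<alpha> 0)\<^sup>2 * (sv_norm_sq D (u (Suc n) 0) - sv_norm_sq D (u n 0)) \<le>
        (A + C * (\<tau> / mesh_size D)) * gz + C * (\<tau> / mesh_size D) * gr)"
      using est A by (metis less_irrefl)
    \<comment> \<open>The error term of order \<open>z\<close> is absorbed, that of order \<open>r\<close> remains.\<close>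
    define L where "L = min 1 (- A / C)"
    have L: "0 < L" "L \<le> 1" "C * L \<le> - A"
      using A C by (auto simp: L_def min_def field_simps)
    define B where "B = C * C / (\<alpha> 0)\<^sup>2"
    have "sv_norm_sq D (u (Suc n) 0) \<le> (1 + B * (\<tau> / mesh_size D) ^ (2 * r + 1)) * sv_norm_sq D (u n 0)"
      if D: "D \<in> ?F" and M: "1 \<le> M" "\<tau> = T / real M" and \<mu>: "\<tau> / mesh_size D \<le> L"
        and u: "rksv_solution D s \<tau> u" for D M \<tau> u n
    proof -
      define \<mu> where "\<mu> = \<tau> / mesh_size D"
      have \<mu>0: "0 < \<mu>" "\<mu> \<le> L" unfolding \<mu>_def using pos(2)[OF D M] \<mu> by auto
      obtain gz gr where g: "0 \<le> gz" "gr \<le> C * \<mu> ^ (2 * r) * sv_norm_sq D (u n 0)"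
        "(\<alpha> 0)\<^sup>2 * (sv_norm_sq D (u (Suc n) 0) - sv_norm_sq D (u n 0)) \<le> (A + C * \<mu>) * gz + C * \<mu> * gr"
        using bound[rule_format, OF D, of \<tau> u n] pos(1)[OF D M] \<mu>0 L u unfolding \<mu>_def by force
      have "C * \<mu> \<le> C * L" using \<mu>0 C by (intro mult_left_mono) auto
      then have "(A + C * \<mu>) * gz \<le> 0"
        using L g(1) by (intro mult_nonpos_nonneg) auto
      moreover have "C * \<mu> * gr \<le> C * \<mu> * (C * \<mu> ^ (2 * r) * sv_norm_sq D (u n 0))"
        using C \<mu>0 g(2) by (intro mult_left_mono) auto
      ultimately have "(\<alpha> 0)\<^sup>2 * (sv_norm_sq D (u (Suc n) 0) - sv_norm_sq D (u n 0)) \<le>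
          C * \<mu> * (C * \<mu> ^ (2 * r) * sv_norm_sq D (u n 0))"
        using g(3) by linarith
      also have "\<dots> = (\<alpha> 0)\<^sup>2 * (B * \<mu> ^ (2 * r + 1) * sv_norm_sq D (u n 0))"
        using \<alpha>0 by (simp add: B_def)
      finally have "sv_norm_sq D (u (Suc n) 0) - sv_norm_sq D (u n 0) \<le> B * \<mu> ^ (2 * r + 1) * sv_norm_sq D (u n 0)"
        using \<alpha>0 by (simp only: mult_le_cancel_left_pos)
      then show ?thesis by (simp only: \<mu>_def[symmetric] mult_1 distrib_right diff_le_eq add.commute)
    qed
    moreover have "0 < B" using C \<alpha>0 by (simp add: B_def)
    ultimately show ?thesis unfolding weakly_stable_def using L(1) by blast
  qed
  have case3: "weakly_stable (min (2 * z) (2 * r + 1)) ?F s T" if A: "0 < A"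
  proof -
    let ?m = "min (2 * z) (2 * r + 1)"
    obtain C where C: "0 < C" and bound: "\<forall>D\<in>?F. \<forall>\<tau> u n.
      0 < \<tau> \<and> \<tau> / mesh_size D \<le> 1 \<and> rksv_solution D s \<tau> u \<longrightarrow>
      (\<exists>gz gr. 0 \<le> gz \<and> 0 \<le> gr \<and> (r = z \<longrightarrow> gr = gz) \<and>
      gz \<le> C * (\<tau> / mesh_size D) ^ (2 * z) * sv_norm_sq D (u n 0) \<and>
      gr \<le> C * (\<tau> / mesh_size D) ^ (2 * r) * sv_norm_sq D (u n 0) \<and>
      0 \<le> sv_norm_sq D (u n 0) \<and>
      (\<alpha> 0)\<^sup>2 * (sv_norm_sq D (u (Suc n) 0) - sv_norm_sq D (u n 0)) \<le>
        (A + C * (\<tau> / mesh_size D)) * gz + C * (\<tau> / mesh_size D) * gr)"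
      using est A by (metis less_irrefl)
    define B where "B = ((A + C) * C + C * C) / (\<alpha> 0)\<^sup>2"
    have step: "sv_norm_sq D (u (Suc n) 0) \<le> (1 + B * (\<tau> / mesh_size D) ^ ?m) * sv_norm_sq D (u n 0)"
      if D: "D \<in> ?F" and M: "1 \<le> M" "\<tau> = T / real M" and \<mu>: "\<tau> / mesh_size D \<le> 1"
        and u: "rksv_solution D s \<tau> u" for D M \<tau> u n
    proof -
      define \<mu> where "\<mu> = \<tau> / mesh_size D"
      have \<mu>0: "0 < \<mu>" "\<mu> \<le> 1" unfolding \<mu>_def using pos(2)[OF D M] \<mu> by auto
      define E where "E = sv_norm_sq D (u n 0)"
      obtain gz gr where g: "0 \<le> gz" "gz \<le> C * \<mu> ^ (2 * z) * E" "gr \<le> C * \<mu> ^ (2 * r) * E" "0 \<le> E"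
        "(\<alpha> 0)\<^sup>2 * (sv_norm_sq D (u (Suc n) 0) - E) \<le> (A + C * \<mu>) * gz + C * \<mu> * gr"
        using bound[rule_format, OF D, of \<tau> u n] pos(1)[OF D M] \<mu>0 u unfolding \<mu>_def E_def by force
      have pw: "\<mu> ^ (2 * z) \<le> \<mu> ^ ?m" "\<mu> ^ (2 * r + 1) \<le> \<mu> ^ ?m"
        using \<mu>0 by (intro power_decreasing; simp)+
      have "(A + C * \<mu>) * gz \<le> (A + C) * (C * \<mu> ^ (2 * z) * E)"
        using A C \<mu>0 g by (intro mult_mono) auto
      also have "\<dots> \<le> (A + C) * (C * \<mu> ^ ?m * E)"
        using A C pw g by (intro mult_left_mono mult_right_mono) auto
      finally have 1: "(A + C * \<mu>) * gz \<le> (A + C) * (C * \<mu> ^ ?m * E)" .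
      have "C * \<mu> * gr \<le> C * \<mu> * (C * \<mu> ^ (2 * r) * E)"
        using C \<mu>0 g by (intro mult_left_mono) auto
      also have "\<dots> = C * C * (\<mu> ^ (2 * r + 1) * E)" by simp
      also have "\<dots> \<le> C * C * (\<mu> ^ ?m * E)"
        using C pw g by (intro mult_left_mono mult_right_mono) auto
      finally have "(\<alpha> 0)\<^sup>2 * (sv_norm_sq D (u (Suc n) 0) - E) \<le>
          (A + C) * (C * \<mu> ^ ?m * E) + C * C * (\<mu> ^ ?m * E)"
        using 1 g(5) by linarith
      also have "\<dots> = ((A + C) * C + C * C) * (\<mu> ^ ?m * E)" by (simp only: distrib_right mult.assoc)
      also have "\<dots> = (\<alpha> 0)\<^sup>2 * (B * \<mu> ^ ?m * E)"
        using \<alpha>0 by (simp add: B_def)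
      finally have "sv_norm_sq D (u (Suc n) 0) - E \<le> B * \<mu> ^ ?m * E"
        using \<alpha>0 by (simp only: mult_le_cancel_left_pos)
      then show ?thesis by (simp only: \<mu>_def[symmetric] E_def[symmetric] mult_1 distrib_right diff_le_eq add.commute)
    qed
    have "0 < B" using A C \<alpha>0 by (simp add: B_def add_pos_pos)
    show ?thesis
      unfolding weakly_stable_def
    proof (rule exI, intro conjI)
      show "0 < (1 :: real)" by simp
      show "\<exists>B>0. \<forall>D\<in>?F. \<forall>M::nat. \<forall>\<tau> u.
          1 \<le> M \<and> \<tau> = T / real M \<and> \<tau> / mesh_size D \<le> 1 \<and> rksv_solution D s \<tau> u \<longrightarrow>
          (\<forall>n. sv_norm_sq D (u (Suc n) 0)
            \<le> (1 + B * (\<tau> / mesh_size D) ^ ?m) * sv_norm_sq D (u n 0))"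
        using step \<open>0 < B\<close> by blast
    qed
  qed
  show ?thesis
    using case1 case2 case3 by (simp add: Let_def z_def[symmetric] r_def[symmetric] A_def)
qed

end
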